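(* Let $0<q<1$ and let $\Theta:V_B\to(-2\pi,2\pi)$ be prescribed cone angles at the boundary vertices of $G$. Assume that $|\Theta(j)|<\pi$ for the boundary vertices of valence $1$. Consider the functional $$S_{hyp}(\gamma)=\sum_{(jk)}\big(F(\gamma_j-\gamma_k)+F(\gamma_j+\gamma_k)\big)+\sum_j\Phi_j\gamma_j,\qquad \gamma\in\mathbb{R}^G,$$ where the first sum is over all pairs of neighboring vertices (edges) of $G$ and the second over all vertices of $G$. Then the critical points of $S_{hyp}$ with $$\Phi_j=-2\pi\ \text{ for inner rings},$$ $$\Phi_j=-\Theta(j)\ \text{ for positively oriented boundary rings},$$ $$\Phi_j=-\pi V(j)-\Theta(j)\ \text{ for negatively oriented boundary rings}$$ correspond to hyperbolic orthogonal ring patterns. Here $V(j)$ is the number of rings neighboring to the $j$-th boundary ring. In particular, if $\gamma$ is a critical point of $S_{hyp}$ then all $\gamma_j\in[0,2K]$.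
   Context: Combinatorics: $\Pi\subset\mathbb{Z}^2$ is a simply connected (finite) cell complex defined by a set of elementary squares of the $\mathbb{Z}^2$ lattice, identified with its vertex set. $G=\{(m,n)\in\Pi: m+n\text{ even}\}$, $G^*=\{(m,n)\in\Pi:m+n\text{ odd}\}$. Vertices $v_{m,n}$ and $v_{m\pm1,n\pm1}$ of $G$ are called neighboring; the valence of a vertex of $G$ is its number of neighbors in $G$. A vertex of $G$ is internal (inner) if it has four neighbors, and a boundary vertex if it has fewer than four; $V_B$ is the set of boundary vertices. Rings: a hyperbolic ring is a pair of concentric circles in the hyperbolic plane $H^2$: the inner circle $c$ with signed hyperbolic radius $r$ (positive for counter-clockwise, negative for clockwise orientation) and the outer circle $C$ with hyperbolic radius $R>0$, $|r|\le R$. The ring is positively (negatively) oriented if $r>0$ ($r<0$). A hyperbolic orthogonal ring pattern with combinatorics $\Pi$ assigns rings $(C_{m,n},c_{m,n})$ to the vertices of $G$ and points $\ell\in H^2$ to the vertices of $G^*$ such that: (1) the rings at neighboring vertices $v_i,v_j$ intersect orthogonally: $C_i$ intersects $c_j$ orthogonally and $C_j$ intersects $c_i$ orthogonally; (2) for any four consecutively neighboring rings at $v_{m,n},v_{m+1,n-1},v_{m+2,n},v_{m+1,n+1}$ ($m+n$ even) the inner circles $c_{m,n},c_{m+2,n}$ and the outer circles $C_{m+1,n-1},C_{m+1,n+1}$ pass through one point $\ell_{m+1,n}$ (so the two inner circles touch there, and so do the two outer circles); (3) for any ring the four touching points $\ell_{m+1,n}=c_{m,n}\cap c_{m+2,n}$,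 $\ell_{m,n+1}=C_{m,n}\cap C_{m,n+2}$, $\ell_{m-1,n}=c_{m,n}\cap c_{m-2,n}$, $\ell_{m,n-1}=C_{m,n}\cap C_{m,n-2}$ are in counter-clockwise order if $r_{m,n}>0$ and in clockwise order if $r_{m,n}<0$. Uniformization (the correspondence between $\gamma$ and rings): all rings of a pattern satisfy $\cosh r=q\cosh R$ with a common constant $q$, and the ring corresponding to $\gamma\in[0,2K]$ is given by $\cosh R=\frac{1}{q\operatorname{sn}(\gamma,q)}$, $\tanh R=\operatorname{dn}(\gamma,q)$, $\sinh r=\frac{\operatorname{cn}(\gamma,q)}{\operatorname{sn}(\gamma,q)}$. Here $\operatorname{sn},\operatorname{cn},\operatorname{dn}$ are the Jacobi elliptic functions of modulus $q$ with complete elliptic integrals $K,K'$. Functions: $g:\mathbb{R}\to\mathbb{R}$ is the smooth function $g(x)=\frac{\pi}{2}-\arg\operatorname{sn}\big(\frac{x+iK'}{2},q\big)$ with the continuous branch normalized by $g(0)=0$, and $F(x)=\int_0^xg(u)\,du$. Angles and orientation: the opening angle at a ring $(r,R)$ towards a neighboring ring $(r_k,R_k)$ is $\theta_k=\arctan\frac{\tanh R_k}{\sinh r}+\arctan\frac{\tanh r_k}{\sinh R}$; the nominal cone angle is $\Theta=\sum_k\theta_k$ over all neighbors. A prescribed boundary angle $\Theta(j)$ is positive for a positively oriented boundary ring and negative for a negatively oriented one. In terms of $\gamma$, the prescription of $\Theta(j)$ means $\sum_k(g(\gamma_j-\gamma_k)+g(\gamma_j+\gamma_k))=\Theta(j)$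 for a positively oriented ring and $\sum_k(g(\gamma_j-\gamma_k)+g(\gamma_j+\gamma_k))=\Theta(j)+\pi V(j)$ for a negatively oriented ring. *)

theory Defs
  imports "HOL-Analysis.Analysis"
begin

section \<open>Combinatorics\<close>

text \<open>A cell complex is given by the set \<open>Q\<close> of its elementary squares, each square being
  represented by its lower left corner.\<close>

definition corners :: "int \<times> int \<Rightarrow> (int \<times> int) set" where
  "corners s = {fst s, fst s + 1} \<times> {snd s, snd s + 1}"

definition cells :: "(int \<times> int) set \<Rightarrow> (real \<times> real) set" where
  "cells Q = (\<Union>(m, n)\<in>Q. cbox (of_int m, of_int n) (of_int m + 1, of_int n + 1))"

definition verts :: "(int \<times> int) set \<Rightarrow> (int \<times> int) set" where
  "verts Q = (\<Union>s\<in>Q. corners s)"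

definition G :: "(int \<times> int) set \<Rightarrow> (int \<times> int) set" where
  "G Q = {v \<in> verts Q. even (fst v + snd v)}"

definition Gstar :: "(int \<times> int) set \<Rightarrow> (int \<times> int) set" where
  "Gstar Q = {v \<in> verts Q. odd (fst v + snd v)}"

text \<open>Neighbours \<open>(m, n)\<close>, \<open>(m \<plusminus> 1, n \<plusminus> 1)\<close> are the ends of a diagonal of a square
  of the complex.\<close>

definition nb :: "(int \<times> int) set \<Rightarrow> int \<times> int \<Rightarrow> int \<times> int \<Rightarrow> bool" where
  "nb Q v w \<longleftrightarrow> v \<in> G Q \<and> w \<in> G Q \<and> \<bar>fst w - fst v\<bar> = 1 \<and> \<bar>snd w - snd v\<bar> = 1 \<and>
     (\<exists>s\<in>Q. v \<in> corners s \<and> w \<in> corners s)"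

definition nbs :: "(int \<times> int) set \<Rightarrow> int \<times> int \<Rightarrow> (int \<times> int) set" where
  "nbs Q v = {w. nb Q v w}"

definition valence :: "(int \<times> int) set \<Rightarrow> int \<times> int \<Rightarrow> nat" where
  "valence Q v = card (nbs Q v)"

definition inner_verts :: "(int \<times> int) set \<Rightarrow> (int \<times> int) set" where
  "inner_verts Q = {v \<in> G Q. valence Q v = 4}"

definition boundary_verts :: "(int \<times> int) set \<Rightarrow> (int \<times> int) set" where
  "boundary_verts Q = {v \<in> G Q. valence Q v < 4}"

text \<open>Each unordered pair of neighbours is listed exactly once, with its left end first.\<close>

definition edges :: "(int \<times> int) set \<Rightarrow> ((int \<times> int) \<times> (int \<times> int)) set" where
  "edges Q = {(j, k). nb Q j k \<and> fst j < fst k}"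


section \<open>The hyperbolic plane\<close>

text \<open>\<open>H\<^sup>2\<close> is the Poincare disk \<open>ball 0 1\<close> with the metric of curvature \<open>-1\<close>.\<close>

definition hdist :: "complex \<Rightarrow> complex \<Rightarrow> real" where
  "hdist z w = arcosh (1 + 2 * (norm (z - w))\<^sup>2 / ((1 - (norm z)\<^sup>2) * (1 - (norm w)\<^sup>2)))"

text \<open>The orientation preserving isometry \<open>hdir x\<close> moves \<open>x\<close> to the origin and has positive
  derivative there. Hence \<open>hdir x p\<close> has the direction of the initial velocity
  of the geodesic from \<open>x\<close> to \<open>p\<close>; it is \<open>0\<close> if \<open>p = x\<close>.\<close>

definition hdir :: "complex \<Rightarrow> complex \<Rightarrow> complex" where
  "hdir x p = (p - x) / (1 - cnj x * p)"

text \<open>The circle of signed radius \<open>a\<close>, a single point if \<open>a = 0\<close>.\<close>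

definition hcircle :: "complex \<Rightarrow> real \<Rightarrow> complex set" where
  "hcircle p a = {z \<in> ball 0 1. hdist p z = \<bar>a\<bar>}"

text \<open>Circles intersect orthogonally iff their radii at a common point are orthogonal. If one
  circle is a point, this says that the point lies on the other circle.\<close>

definition orthogonal_circles :: "complex \<Rightarrow> real \<Rightarrow> complex \<Rightarrow> real \<Rightarrow> bool" where
  "orthogonal_circles p a p' a' \<longleftrightarrow>
     (\<exists>x \<in> hcircle p a \<inter> hcircle p' a'. orthogonal (hdir x p) (hdir x p'))"

text \<open>Contact of oriented circles: exterior if the signs of the radii agree, interior if they
  are opposite.\<close>

definition touch_at :: "complex \<Rightarrow> real \<Rightarrow> complex \<Rightarrow> real \<Rightarrow> complex \<Rightarrow> bool" where
  "touch_at p a p' a' x \<longleftrightarrow> x \<in> hcircle p a \<inter> hcircle p' a' \<and> hdist p p' = \<bar>a + a'\<bar>"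

text \<open>Seen from \<open>p\<close>, the points \<open>x1, x2, x3, x4\<close> are met in this order on one
  counter-clockwise turn.\<close>

definition ccw_around :: "complex \<Rightarrow> complex \<Rightarrow> complex \<Rightarrow> complex \<Rightarrow> complex \<Rightarrow> bool" where
  "ccw_around p x1 x2 x3 x4 \<longleftrightarrow>
     (\<exists>t1 t2 t3 t4. t1 < t2 \<and> t2 < t3 \<and> t3 < t4 \<and> t4 < t1 + 2 * pi \<and>
        is_Arg (hdir p x1) t1 \<and> is_Arg (hdir p x2) t2 \<and>
        is_Arg (hdir p x3) t3 \<and> is_Arg (hdir p x4) t4)"

text \<open>The signed turn at \<open>p\<close> from \<open>x\<close> to \<open>y\<close>: \<open>1\<close> for an angle in \<open>(0, \<pi>)\<close>, \<open>-1\<close> for an angle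
  in \<open>(-\<pi>, 0)\<close>, and \<open>0\<close> in the degenerate cases.\<close>

definition turn :: "complex \<Rightarrow> complex \<Rightarrow> complex \<Rightarrow> real" where
  "turn p x y = sgn (Im (cnj (hdir p x) * hdir p y))"


section \<open>Hyperbolic orthogonal ring patterns\<close>

text \<open>The ring at \<open>v \<in> G\<close> has centre \<open>p v\<close>, signed inner radius \<open>r v\<close> and outer
  radius \<open>R v\<close>; the point at \<open>u \<in> G\<^sup>*\<close> is \<open>l u\<close>.

  For neighbours \<open>v, w\<close> the other two corners of their common square are \<open>(fst w, snd v)\<close>, on the
  horizontal line through \<open>v\<close>, and \<open>(fst v, snd w)\<close>, on the vertical one. The conditions are:

  \<^item> the rings at neighbouring vertices intersect orthogonally;
  \<^item> \<open>l u\<close> lies on the inner circles of the horizontally adjacent and on the outer circles of the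
    vertically adjacent rings, and the two inner (outer) circles meeting at \<open>l u\<close> touch. If the
    ring at \<open>v\<close> has \<open>r v \<noteq> 0\<close>, then the kind of contact between its neighbours follows from the
    other conditions; it is needed to exclude folded configurations when \<open>r v = 0\<close>, where the
    orientation conditions are void;
  \<^item> the touching points of each ring are in counter-clockwise (clockwise) order if \<open>r v > 0\<close>
    (\<open>r v < 0\<close>). The turn condition states this for two consecutive points, bounding the opening
    angle towards a neighbour; it gives a meaning to the orientation of boundary rings, which
    have fewer than four touching points. The cyclic condition states it for all four points of
    an inner ring.\<close>

definition ring_pattern ::
  "(int \<times> int) set \<Rightarrow> (int \<times> int \<Rightarrow> complex) \<Rightarrow> (int \<times> int \<Rightarrow> real) \<Rightarrow> (int \<times> int \<Rightarrow> real)
     \<Rightarrow> (int \<times> int \<Rightarrow> complex) \<Rightarrow> bool" where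
  "ring_pattern Q p r R l \<longleftrightarrow>
     (\<forall>v\<in>G Q. p v \<in> ball 0 1 \<and> 0 < R v \<and> \<bar>r v\<bar> \<le> R v) \<and>
     (\<forall>u\<in>Gstar Q. l u \<in> ball 0 1) \<and>
     (\<forall>v w. nb Q v w \<longrightarrow>
        orthogonal_circles (p v) (R v) (p w) (r w) \<and>
        orthogonal_circles (p w) (R w) (p v) (r v)) \<and>
     (\<forall>v w. nb Q v w \<longrightarrow>
        l (fst w, snd v) \<in> hcircle (p v) (r v) \<inter> hcircle (p w) (R w) \<and>
        l (fst v, snd w) \<in> hcircle (p v) (R v) \<inter> hcircle (p w) (r w)) \<and>
     (\<forall>v w w'. nb Q v w \<and> nb Q v w' \<and> w \<noteq> w' \<longrightarrow>
        (snd w = snd w' \<longrightarrow> touch_at (p w) (r w) (p w') (r w') (l (fst v, snd w))) \<and>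
        (fst w = fst w' \<longrightarrow> touch_at (p w) (R w) (p w') (R w') (l (fst w, snd v)))) \<and>
     (\<forall>v w. nb Q v w \<longrightarrow>
        of_int ((fst w - fst v) * (snd w - snd v)) *
          turn (p v) (l (fst w, snd v)) (l (fst v, snd w)) = sgn (r v)) \<and>
     (\<forall>m n. (m, n) \<in> inner_verts Q \<longrightarrow>
        (r (m, n) > 0 \<longrightarrow>
           ccw_around (p (m, n)) (l (m + 1, n)) (l (m, n + 1)) (l (m - 1, n)) (l (m, n - 1))) \<and>
        (r (m, n) < 0 \<longrightarrow>
           ccw_around (p (m, n)) (l (m, n - 1)) (l (m - 1, n)) (l (m, n + 1)) (l (m + 1, n))))"

text \<open>For \<open>r = 0\<close> the opening angle is not defined (division by zero).\<close>

definition opening_angle :: "real \<Rightarrow> real \<Rightarrow> real \<Rightarrow> real \<Rightarrow> real" where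
  "opening_angle r R r' R' = arctan (tanh R' / sinh r) + arctan (tanh r' / sinh R)"

definition cone_angle ::
  "(int \<times> int) set \<Rightarrow> (int \<times> int \<Rightarrow> real) \<Rightarrow> (int \<times> int \<Rightarrow> real) \<Rightarrow> int \<times> int \<Rightarrow> real" where
  "cone_angle Q r R j = (\<Sum>k\<in>nbs Q j. opening_angle (r j) (R j) (r k) (R k))"


section \<open>Jacobi elliptic functions of modulus k\<close>

definition ellF :: "real \<Rightarrow> real \<Rightarrow> real" where
  "ellF k \<phi> = (LBINT t=0..\<phi>. 1 / sqrt (1 - k\<^sup>2 * (sin t)\<^sup>2))"

definition ellK :: "real \<Rightarrow> real" where
  "ellK k = ellF k (pi / 2)"

definition compl_mod :: "real \<Rightarrow> real" where
  "compl_mod k = sqrt (1 - k\<^sup>2)"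

definition ellK' :: "real \<Rightarrow> real" where
  "ellK' k = ellK (compl_mod k)"

definition am :: "real \<Rightarrow> real \<Rightarrow> real" where
  "am k u = (THE \<phi>. ellF k \<phi> = u)"

definition sn :: "real \<Rightarrow> real \<Rightarrow> real" where
  "sn k u = sin (am k u)"

definition cn :: "real \<Rightarrow> real \<Rightarrow> real" where
  "cn k u = cos (am k u)"

definition dn :: "real \<Rightarrow> real \<Rightarrow> real" where
  "dn k u = sqrt (1 - k\<^sup>2 * (sn k u)\<^sup>2)"

text \<open>The extension of \<open>sn\<close> to complex arguments \<open>x + i y\<close>, by the addition theorem and Jacobi's
  imaginary transformation (Abramowitz and Stegun, 16.21.2).\<close>

definition csn :: "real \<Rightarrow> complex \<Rightarrow> complex" where
  "csn k z =
     (let s = sn k (Re z); c = cn k (Re z); d = dn k (Re z);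
          s1 = sn (compl_mod k) (Im z); c1 = cn (compl_mod k) (Im z); d1 = dn (compl_mod k) (Im z)
      in Complex (s * d1) (c * d * s1 * c1) / of_real (c1\<^sup>2 + k\<^sup>2 * s\<^sup>2 * s1\<^sup>2))"

text \<open>The ring \<open>(r, R)\<close> corresponding to \<open>\<gamma>\<close>. Since \<open>1 / 0 = 0\<close>, no ring corresponds to the ends
  of the interval, where the outer radius becomes infinite.\<close>

definition ring_of :: "real \<Rightarrow> real \<Rightarrow> real \<Rightarrow> real \<Rightarrow> bool" where
  "ring_of q \<gamma> r R \<longleftrightarrow> \<gamma> \<in> {0 .. 2 * ellK q} \<and>
     cosh R = 1 / (q * sn q \<gamma>) \<and> tanh R = dn q \<gamma> \<and> sinh r = cn q \<gamma> / sn q \<gamma>"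


section \<open>The functional\<close>

text \<open>\<open>\<pi> / 2 - g x\<close> is the continuous branch of the argument of \<open>sn ((x + i K') / 2)\<close>.\<close>

definition g :: "real \<Rightarrow> real \<Rightarrow> real" where
  "g q = (THE h. continuous_on UNIV h \<and> h 0 = 0 \<and>
            (\<forall>x. is_Arg (csn q (Complex (x / 2) (ellK' q / 2))) (pi / 2 - h x)))"

definition F :: "real \<Rightarrow> real \<Rightarrow> real" where
  "F q x = (LBINT u=0..x. g q u)"

definition S_hyp ::
  "(int \<times> int) set \<Rightarrow> real \<Rightarrow> (int \<times> int \<Rightarrow> real) \<Rightarrow> (int \<times> int \<Rightarrow> real) \<Rightarrow> real" where
  "S_hyp Q q \<Phi> \<gamma> =
     (\<Sum>(j, k)\<in>edges Q. F q (\<gamma> j - \<gamma> k) + F q (\<gamma> j + \<gamma> k)) + (\<Sum>j\<in>G Q. \<Phi> j * \<gamma> j)"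

text \<open>A function \<open>S\<close> on \<open>\<real>\<^sup>V\<close> has a critical point at \<open>\<gamma>\<close> iff all its partial derivatives
  vanish there.\<close>

definition critical_point ::
  "'v set \<Rightarrow> (('v \<Rightarrow> real) \<Rightarrow> real) \<Rightarrow> ('v \<Rightarrow> real) \<Rightarrow> bool" where
  "critical_point V S \<gamma> \<longleftrightarrow>
     (\<forall>j\<in>V. ((\<lambda>t. S (\<gamma>(j := t))) has_real_derivative 0) (at (\<gamma> j)))"

text \<open>The sign of a prescribed boundary angle is the prescribed orientation of the ring.\<close>

definition \<Phi>_of ::
  "(int \<times> int) set \<Rightarrow> (int \<times> int \<Rightarrow> real) \<Rightarrow> int \<times> int \<Rightarrow> real" where
  "\<Phi>_of Q \<Theta> j =
     (if j \<in> inner_verts Q then - 2 * pi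
      else if \<Theta> j > 0 then - \<Theta> j
      else - pi * of_nat (valence Q j) - \<Theta> j)"

text \<open>The prescription of the boundary angle at \<open>j\<close> in terms of \<open>\<gamma>\<close>.\<close>

definition prescribed_angle ::
  "(int \<times> int) set \<Rightarrow> real \<Rightarrow> (int \<times> int \<Rightarrow> real) \<Rightarrow> (int \<times> int \<Rightarrow> real) \<Rightarrow> int \<times> int \<Rightarrow> bool" where
  "prescribed_angle Q q \<Theta> \<gamma> j \<longleftrightarrow>
     (\<Sum>k\<in>nbs Q j. g q (\<gamma> j - \<gamma> k) + g q (\<gamma> j + \<gamma> k)) =
       (if \<Theta> j > 0 then \<Theta> j else \<Theta> j + pi * of_nat (valence Q j))"

end

theory Submission
  imports Defs
begin

text \<open>The gradient of \<open>S_hyp\<close> at \<open>j\<close> is the sum of the angles \<open>f(\<gamma>\<^sub>j, \<gamma>\<^sub>k) = g(\<gamma>\<^sub>j - \<gamma>\<^sub>k) + g(\<gamma>\<^sub>j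
  + \<gamma>\<^sub>k)\<close> over the neighbours \<open>k\<close> of \<open>j\<close>, plus \<open>\<Phi>\<^sub>j\<close>. So a critical point is a solution of the
  equations \<open>\<Sum>\<^sub>k f(\<gamma>\<^sub>j, \<gamma>\<^sub>k) = -\<Phi>\<^sub>j\<close>, and the theorem says that these equations are the closing
  conditions for the quadrilaterals cut out by neighbouring rings.

  \<^item> \<open>The function g.\<close> It is elementary in the Jacobi functions: \<open>g x = (am x + arcsin (q sn x)) /
    2\<close>, because both sides solve the pendulum equation \<open>h'\<^sup>2 = ((1 + q) / 2)\<^sup>2 - q sin\<^sup>2 h\<close>
    (\<open>g_eq_phase\<close>). Hence \<open>f(x, y)\<close> increases in \<open>x\<close> from \<open>0\<close> at \<open>0\<close> to \<open>\<pi>\<close> at \<open>2K\<close>, which forces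
    the critical values into the open interval (\<open>critical_point_range\<close>). Separating variables for
    the sum and the difference of two solutions of the pendulum equation yields \<open>tan (f(x, y) /
    2)\<close>, and in terms of the rings \<open>(r, R)\<close>, \<open>(r', R')\<close> of \<open>x\<close> and \<open>y\<close> the number \<open>cis (f(x, y))\<close>
    is the direction of \<open>(sinh r + i tanh R') (sinh R + i tanh r')\<close> (\<open>cis_angle_ring\<close>). The
    arguments of these factors are the angles at the centre of the first ring in the two right
    triangles that form a kite, with the centres of the rings and their two common points as
    vertices; so \<open>f\<close> is the opening angle, up to \<open>\<pi>\<close> if the ring is negatively oriented
    (\<open>opening_angle_eq\<close>).

  \<^item> \<open>From patterns to equations.\<close> The turn conditions decide on which side of the line of centres
    each of the two shared points lies (\<open>kite_horizontal\<close>, \<open>kite_vertical\<close>). Going around an inner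
    ring, the angles \<open>f\<close> therefore add up to a multiple of \<open>2\<pi>\<close>; as each of the four lies in \<open>(0,
    \<pi>)\<close>, the sum is \<open>2\<pi>\<close> (\<open>ring_pattern_inner_angle\<close>).

  \<^item> \<open>From equations to patterns.\<close> Each vertex of the complex carries a frame, an isometry of the
    disc, and the kites prescribe how the frames at the ends of an edge of the lattice differ.
    This connection is flat around each square because the kite closes up (\<open>kite_identity\<close>), and
    it is well defined at inner vertices of \<open>G\<close> by the equations. With signed radii the frames
    need no case distinction on the orientation of the rings or on \<open>r = 0\<close>. On a simply connected
    complex a flat connection is trivial (\<open>lattice_connection_trivial\<close>), and the images of the
    origin under the frames form the pattern (\<open>ring_pattern_exists\<close>).\<close>

section \<open>Jacobi elliptic functions on the real line\<close>

lemma has_real_derivative_LBINT: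
  fixes h :: "real \<Rightarrow> real"
  assumes "continuous_on UNIV h"
  shows "((\<lambda>x. LBINT t=0..x. h t) has_real_derivative h x) (at x)"
proof -
  let ?a = "- \<bar>x\<bar> - 1" and ?b = "\<bar>x\<bar> + 1"
  have "((\<lambda>u. LBINT t=(0::real)..u. h t) has_vector_derivative h x) (at x within {?a..?b})"
    by (rule interval_integral_FTC2) (use assms continuous_on_subset in auto)
  moreover have "x \<in> {?a<..<?b}" by auto
  ultimately have "((\<lambda>u. LBINT t=(0::real)..u. h t) has_vector_derivative h x) (at x)"
    by (metis at_within_interior greaterThanLessThan_iff interior_atLeastAtMost_real)
  then show ?thesis
    by (simp add: has_real_derivative_iff_has_vector_derivative zero_ereal_def)
qed

locale elliptic_modulus =
  fixes k :: real
  assumes k_pos: "0 < k" and k_less_1: "k < 1"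
begin

definition delta :: "real \<Rightarrow> real" where
  "delta \<phi> = sqrt (1 - k\<^sup>2 * (sin \<phi>)\<^sup>2)"

lemma k_sq_less_1: "k\<^sup>2 < 1"
  using k_pos k_less_1 by (simp add: power_less_one_iff abs_square_less_1)

lemma k_sq_sin_le: "k\<^sup>2 * (sin \<phi>)\<^sup>2 \<le> k\<^sup>2"
  by (simp add: abs_square_le_1 mult_left_le)

lemma radicand_pos: "0 < 1 - k\<^sup>2 * (sin \<phi>)\<^sup>2"
  using k_sq_sin_le[of \<phi>] k_sq_less_1 by linarith

lemma delta_pos: "0 < delta \<phi>"
  using radicand_pos by (simp add: delta_def)

lemma delta_le_1: "delta \<phi> \<le> 1"
  by (simp add: delta_def)

lemma delta_sq: "(delta \<phi>)\<^sup>2 = 1 - k\<^sup>2 * (sin \<phi>)\<^sup>2"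
  using radicand_pos[of \<phi>] by (simp add: delta_def)

lemma DERIV_ellF: "(ellF k has_real_derivative 1 / delta \<phi>) (at \<phi>)"
proof -
  have "continuous_on UNIV (\<lambda>t. 1 / delta t)"
    unfolding delta_def
    by (intro continuous_intros) (use radicand_pos in \<open>metis less_irrefl real_sqrt_eq_zero_cancel_iff\<close>)
  from has_real_derivative_LBINT[OF this] show ?thesis
    unfolding ellF_def delta_def by simp
qed

lemma ellF_0 [simp]: "ellF k 0 = 0"
  by (simp add: ellF_def zero_ereal_def)

lemma ellF_diff_ge: "x \<le> y \<Longrightarrow> y - x \<le> ellF k y - ellF k x"
proof -
  assume "x \<le> y"
  have "(\<lambda>t. ellF k t - t) x \<le> (\<lambda>t. ellF k t - t) y"
  proof (rule DERIV_nonneg_imp_nondecreasing[OF \<open>x \<le> y\<close>])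
    fix t
    have "((\<lambda>t. ellF k t - t) has_real_derivative 1 / delta t - 1) (at t)"
      by (intro derivative_intros DERIV_ellF)
    moreover have "0 \<le> 1 / delta t - 1"
      using delta_pos[of t] delta_le_1[of t] by simp
    ultimately show "\<exists>z. ((\<lambda>t. ellF k t - t) has_real_derivative z) (at t) \<and> 0 \<le> z"
      by blast
  qed
  then show ?thesis by simp
qed

lemma ellF_less_iff: "ellF k x < ellF k y \<longleftrightarrow> x < y"
  using ellF_diff_ge[of x y] ellF_diff_ge[of y x] by linarith

lemma ellF_eq_iff: "ellF k x = ellF k y \<longleftrightarrow> x = y"
  using ellF_less_iff by (metis linorder_neq_iff)

lemma ellF_surj: "\<exists>\<phi>. ellF k \<phi> = u"
proof -
  have "\<exists>\<phi>\<ge>- \<bar>u\<bar>. \<phi> \<le> \<bar>u\<bar> \<and> ellF k \<phi> = u"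
  proof (rule IVT')
    show "ellF k (- \<bar>u\<bar>) \<le> u" "u \<le> ellF k \<bar>u\<bar>"
      using ellF_diff_ge[of "- \<bar>u\<bar>" 0] ellF_diff_ge[of 0 "\<bar>u\<bar>"] by auto
    show "continuous_on {- \<bar>u\<bar>..\<bar>u\<bar>} (ellF k)"
      using DERIV_ellF DERIV_isCont by (blast intro: continuous_at_imp_continuous_on)
  qed auto
  then show ?thesis by blast
qed

lemma ellF_am [simp]: "ellF k (am k u) = u"
  unfolding am_def by (rule theI') (use ellF_surj ellF_eq_iff in metis)

lemma am_ellF [simp]: "am k (ellF k \<phi>) = \<phi>"
  using ellF_eq_iff ellF_am by blast

lemma am_less_iff: "am k u < am k v \<longleftrightarrow> u < v"
  using ellF_less_iff[of "am k u" "am k v"] by simp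

lemma isCont_am: "isCont (am k) u"
proof -
  have "\<bar>am k x - am k y\<bar> \<le> \<bar>x - y\<bar>" for x y
    using ellF_diff_ge[of "am k x" "am k y"] ellF_diff_ge[of "am k y" "am k x"]
    unfolding ellF_am by linarith
  then have "continuous_on UNIV (am k)"
    by (auto simp: continuous_on_iff dist_real_def) (meson le_less_trans)
  then show ?thesis
    by (simp add: continuous_on_eq_continuous_at)
qed

lemma dn_eq_delta: "dn k u = delta (am k u)"
  by (simp add: dn_def delta_def sn_def)

lemma DERIV_am: "(am k has_real_derivative dn k u) (at u)"
proof -
  have "(am k has_real_derivative inverse (1 / delta (am k u))) (at u)"
    by (rule DERIV_inverse_function[where f = "ellF k" and a = "u - 1" and b = "u + 1"])
      (use DERIV_ellF delta_pos[of "am k u"] isCont_am in auto)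
  then show ?thesis by (simp add: dn_eq_delta)
qed

lemma dn_pos: "0 < dn k u"
  by (simp add: dn_eq_delta delta_pos)

lemma dn_sq: "(dn k u)\<^sup>2 = 1 - k\<^sup>2 * (sn k u)\<^sup>2"
  by (simp add: dn_eq_delta delta_sq sn_def)

lemma sn_cn_sq: "(sn k u)\<^sup>2 + (cn k u)\<^sup>2 = 1"
  by (simp add: sn_def cn_def)

lemma DERIV_sn: "(sn k has_real_derivative cn k u * dn k u) (at u)"
proof -
  have "((\<lambda>u. sin (am k u)) has_real_derivative cos (am k u) * dn k u) (at u)"
    by (intro derivative_intros DERIV_am)
  then show ?thesis by (simp add: sn_def[abs_def] cn_def)
qed

lemma ellF_minus: "ellF k (- \<phi>) = - ellF k \<phi>"
proof -
  have "ellF k \<phi> + ellF k (- \<phi>) = ellF k 0 + ellF k (- 0)"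
  proof (rule DERIV_isconst_all[where f = "\<lambda>t. ellF k t + ellF k (- t)"], intro allI)
    fix t
    have "((\<lambda>t. ellF k t + ellF k (- t)) has_real_derivative 1 / delta t + 1 / delta (- t) * (-1)) (at t)"
      by (intro DERIV_add DERIV_ellF DERIV_chain2[OF DERIV_ellF]) (auto intro!: derivative_eq_intros)
    then show "((\<lambda>t. ellF k t + ellF k (- t)) has_real_derivative 0) (at t)"
      by (simp add: delta_def)
  qed
  then show ?thesis by simp
qed

lemma ellF_add_pi: "ellF k (\<phi> + pi) = ellF k \<phi> + 2 * ellK k"
proof -
  have "ellF k (\<phi> + pi) - ellF k \<phi> = ellF k (- (pi / 2) + pi) - ellF k (- (pi / 2))"
  proof (rule DERIV_isconst_all[where f = "\<lambda>t. ellF k (t + pi) - ellF k t"], intro allI)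
    fix t
    have "((\<lambda>t. ellF k (t + pi) - ellF k t) has_real_derivative 1 / delta (t + pi) * 1 - 1 / delta t) (at t)"
      by (intro DERIV_diff DERIV_ellF DERIV_chain2[OF DERIV_ellF]) (auto intro!: derivative_eq_intros)
    then show "((\<lambda>t. ellF k (t + pi) - ellF k t) has_real_derivative 0) (at t)"
      by (simp add: delta_def)
  qed
  then show ?thesis by (simp add: ellF_minus ellK_def)
qed

lemma am_0 [simp]: "am k 0 = 0"
  using am_ellF[of 0] by simp

text \<open>The symmetries of the amplitude follow from those of its inverse, the elliptic integral.\<close>

lemma am_minus: "am k (- u) = - am k u"
  by (metis ellF_am am_ellF ellF_minus)

lemma am_add_2K: "am k (u + 2 * ellK k) = am k u + pi"
  by (metis ellF_am am_ellF ellF_add_pi)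

lemma am_2K_minus: "am k (2 * ellK k - u) = pi - am k u"
  using am_add_2K[of "- u"] by (simp add: am_minus)

lemma am_2K: "am k (2 * ellK k) = pi"
  using am_2K_minus[of 0] by simp

lemma ellK_pos: "0 < ellK k"
  using ellF_less_iff[of 0 "pi / 2"] by (simp add: ellK_def)

lemma am_in_0_pi_iff: "0 < am k u \<and> am k u < pi \<longleftrightarrow> 0 < u \<and> u < 2 * ellK k"
  using am_less_iff[of 0 u] am_less_iff[of u "2 * ellK k"] am_2K by simp

text \<open>The substitution \<open>tan \<phi> \<cdot> tan \<psi> = 1 / k'\<close> exchanges \<open>[0, \<phi>]\<close> and \<open>[\<psi>, \<pi> / 2]\<close> in the
  elliptic integral; its fixed point is the amplitude of the half period.\<close>

lemma am_half_period:
  "tan (am k (ellK k / 2)) = 1 / sqrt (compl_mod k)" "0 < am k (ellK k / 2)"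
    "am k (ellK k / 2) < pi / 2"
proof -
  define k' where "k' = compl_mod k"
  have k': "0 < k'" "k'\<^sup>2 = 1 - k\<^sup>2"
    using k_sq_less_1 by (auto simp: k'_def compl_mod_def)
  define \<phi>0 where "\<phi>0 = arctan (1 / sqrt k')"
  have \<phi>0: "0 < \<phi>0" "\<phi>0 < pi / 2" "tan \<phi>0 = 1 / sqrt k'"
    using k' arctan_ubound[of "1 / sqrt k'"] by (auto simp: \<phi>0_def tan_arctan)
  \<comment> \<open>The substitution, written so that it is defined at 0.\<close>
  define \<psi> where "\<psi> = (\<lambda>\<phi>. pi / 2 - arctan (k' * tan \<phi>))"
  have cos_pos: "0 < cos t" if "0 \<le> t" "t \<le> \<phi>0" for t
    using that \<phi>0 by (intro cos_gt_zero_pi) auto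
  have deriv: "((\<lambda>t. ellF k t + ellF k (\<psi> t)) has_real_derivative 0) (at t)"
    if t: "0 \<le> t" "t \<le> \<phi>0" for t
  proof -
    have c: "0 < cos t" using cos_pos t by simp
    have "(\<psi> has_real_derivative 0 - inverse (1 + (k' * tan t)\<^sup>2) * (k' * inverse ((cos t)\<^sup>2))) (at t)"
      unfolding \<psi>_def
      by (intro DERIV_diff DERIV_const DERIV_chain2[OF DERIV_arctan] DERIV_cmult DERIV_tan)
         (use c in auto)
    from DERIV_add[OF DERIV_ellF DERIV_chain2[OF DERIV_ellF this]]
    have "((\<lambda>t. ellF k t + ellF k (\<psi> t)) has_real_derivative
        1 / delta t + 1 / delta (\<psi> t) * (- (k' * inverse ((cos t)\<^sup>2) * inverse (1 + (k' * tan t)\<^sup>2)))) (at t)"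
      by (simp add: mult_ac)
    moreover have "1 / delta t + 1 / delta (\<psi> t) * (- (k' * inverse ((cos t)\<^sup>2) * inverse (1 + (k' * tan t)\<^sup>2))) = 0"
    proof -
      have d: "(delta t)\<^sup>2 = (cos t)\<^sup>2 + k'\<^sup>2 * (sin t)\<^sup>2"
        unfolding delta_sq k' cos_squared_eq by (simp add: algebra_simps)
      have e1: "1 + (k' * tan t)\<^sup>2 = (delta t)\<^sup>2 / (cos t)\<^sup>2"
        unfolding d using c by (simp add: tan_def field_simps power_mult_distrib power_divide)
      have "sin (\<psi> t) = cos (arctan (k' * tan t))"
        by (simp add: \<psi>_def sin_diff)
      then have "(sin (\<psi> t))\<^sup>2 = inverse (1 + (k' * tan t)\<^sup>2)"
        using cos_arctan[of "k' * tan t"] zero_le_power2[of "k' * tan t"]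
        by (simp add: power_divide divide_inverse power_inverse del: zero_le_power2)
      then have e2: "(sin (\<psi> t))\<^sup>2 = (cos t)\<^sup>2 / (delta t)\<^sup>2"
        unfolding e1 by simp
      have "(delta (\<psi> t))\<^sup>2 = ((delta t)\<^sup>2 - k\<^sup>2 * (cos t)\<^sup>2) / (delta t)\<^sup>2"
        unfolding delta_sq[of "\<psi> t"] e2 using delta_pos[of t] by (simp add: field_simps)
      also have "(delta t)\<^sup>2 - k\<^sup>2 * (cos t)\<^sup>2 = k'\<^sup>2"
        unfolding delta_sq k' cos_squared_eq by (simp add: algebra_simps)
      finally have "(delta (\<psi> t))\<^sup>2 = (k' / delta t)\<^sup>2"
        by (simp add: power_divide)
      then have e3: "delta (\<psi> t) = k' / delta t"
        using delta_pos[of "\<psi> t"] delta_pos[of t] k' by (simp add: power2_eq_iff_nonneg)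
      show ?thesis
        unfolding e1 e3 using c delta_pos[of t] k' by (simp add: field_simps power2_eq_square)
    qed
    ultimately show ?thesis by simp
  qed
  have "ellF k \<phi>0 + ellF k (\<psi> \<phi>0) = ellF k 0 + ellF k (\<psi> 0)"
  proof (rule DERIV_isconst_end[where f = "\<lambda>t. ellF k t + ellF k (\<psi> t)"])
    show "continuous_on {0..\<phi>0} (\<lambda>t. ellF k t + ellF k (\<psi> t))"
      by (intro continuous_at_imp_continuous_on ballI DERIV_isCont[OF deriv]) auto
  qed (use \<phi>0 deriv in auto)
  moreover have "\<psi> 0 = pi / 2" by (simp add: \<psi>_def)
  moreover have "\<psi> \<phi>0 = \<phi>0"
  proof -
    have "k' * tan \<phi>0 = sqrt k'"
      using k' by (simp add: \<phi>0(3) real_div_sqrt)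
    moreover have "arctan (sqrt k') = pi / 2 - \<phi>0"
      using k' arctan_inverse[of "1 / sqrt k'"] by (simp add: \<phi>0_def)
    ultimately show ?thesis by (simp add: \<psi>_def)
  qed
  ultimately have "ellF k \<phi>0 = ellK k / 2"
    by (simp add: ellK_def)
  then have "am k (ellK k / 2) = \<phi>0" by (metis am_ellF)
  then show "tan (am k (ellK k / 2)) = 1 / sqrt (compl_mod k)" "0 < am k (ellK k / 2)"
    "am k (ellK k / 2) < pi / 2" using \<phi>0 by (auto simp: k'_def)
qed

section \<open>The phase function\<close>


text \<open>This turns out to be the function \<open>g\<close>. In the notation of the rings, it is half the sum of
  the angles \<open>a\<close> and \<open>b\<close> with \<open>cot a = sinh r\<close> and \<open>cot b = sinh R\<close>.\<close>

definition phase :: "real \<Rightarrow> real" where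
  "phase x = (am k x + arcsin (k * sn k x)) / 2"

definition phase' :: "real \<Rightarrow> real" where
  "phase' x = (dn k x + k * cn k x) / 2"

lemma cn_sq: "(cn k u)\<^sup>2 = 1 - (sn k u)\<^sup>2"
  using sn_cn_sq[of u] by simp

lemma abs_k_sn_less_1: "\<bar>k * sn k x\<bar> < 1"
proof -
  have "(k * sn k x)\<^sup>2 < 1"
    using k_sq_sin_le[of "am k x"] k_sq_less_1 by (simp add: sn_def power_mult_distrib)
  then show ?thesis by (simp add: abs_square_less_1)
qed

lemma sin_arcsin_k_sn: "sin (arcsin (k * sn k x)) = k * sn k x"
  and cos_arcsin_k_sn: "cos (arcsin (k * sn k x)) = dn k x"
  using abs_k_sn_less_1[of x] by (simp_all add: cos_arcsin dn_def power_mult_distrib)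

lemma DERIV_cn: "(cn k has_real_derivative - (sn k u * dn k u)) (at u)"
proof -
  have "((\<lambda>u. cos (am k u)) has_real_derivative - sin (am k u) * dn k u) (at u)"
    by (intro derivative_intros DERIV_am)
  then show ?thesis by (simp add: cn_def[abs_def] sn_def)
qed

lemma DERIV_dn: "(dn k has_real_derivative - (k\<^sup>2 * sn k u * cn k u)) (at u)"
proof -
  have pos: "0 < 1 - k\<^sup>2 * (sn k u)\<^sup>2"
    using radicand_pos by (simp add: sn_def)
  have "((\<lambda>u. 1 - k\<^sup>2 * (sn k u)\<^sup>2) has_real_derivative
      0 - k\<^sup>2 * (of_nat 2 * (cn k u * dn k u * sn k u ^ (2 - Suc 0)))) (at u)"
    by (intro DERIV_diff DERIV_const DERIV_cmult DERIV_power DERIV_sn)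
  from DERIV_chain2[OF DERIV_real_sqrt[OF pos] this]
  have "(dn k has_real_derivative inverse (dn k u) / 2 * - (k\<^sup>2 * (2 * (cn k u * dn k u * sn k u)))) (at u)"
    by (simp add: dn_def[abs_def])
  moreover have "inverse (dn k u) / 2 * - (k\<^sup>2 * (2 * (cn k u * dn k u * sn k u))) = - (k\<^sup>2 * sn k u * cn k u)"
    using dn_pos[of u] by (simp add: field_simps)
  ultimately show ?thesis by (simp only:)
qed

lemma two_phase: "2 * phase x = am k x + arcsin (k * sn k x)"
  by (simp add: phase_def)

lemma DERIV_phase: "(phase has_real_derivative phase' x) (at x)"
proof -
  have "((\<lambda>x. arcsin (k * sn k x)) has_real_derivative
      inverse (sqrt (1 - (k * sn k x)\<^sup>2)) * (k * (cn k x * dn k x))) (at x)"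
    by (intro DERIV_chain2[OF DERIV_arcsin] DERIV_cmult DERIV_sn)
       (use abs_k_sn_less_1[of x] in auto)
  moreover have "sqrt (1 - (k * sn k x)\<^sup>2) = dn k x"
    by (simp add: dn_def power_mult_distrib)
  ultimately have "((\<lambda>x. arcsin (k * sn k x)) has_real_derivative k * cn k x) (at x)"
    using dn_pos[of x] by (simp add: field_simps)
  then have "((\<lambda>x. (am k x + arcsin (k * sn k x)) / 2) has_real_derivative (dn k x + k * cn k x) / 2) (at x)"
    by (intro DERIV_cdivide DERIV_add DERIV_am)
  then show ?thesis
    by (simp add: phase_def[abs_def] phase'_def)
qed

lemma DERIV_phase': "(phase' has_real_derivative - (k / 2) * sin (2 * phase x)) (at x)"
proof -
  have "((\<lambda>x. (dn k x + k * cn k x) / 2) has_real_derivative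
      (- (k\<^sup>2 * sn k x * cn k x) + k * (- (sn k x * dn k x))) / 2) (at x)"
    by (intro DERIV_cdivide DERIV_add DERIV_cmult DERIV_dn DERIV_cn)
  moreover have "sin (2 * phase x) = sn k x * dn k x + cn k x * (k * sn k x)"
    by (simp add: two_phase sin_add sin_arcsin_k_sn cos_arcsin_k_sn flip: sn_def cn_def)
  then have "(- (k\<^sup>2 * sn k x * cn k x) + k * (- (sn k x * dn k x))) / 2 = - (k / 2) * sin (2 * phase x)"
    by (simp add: field_simps power2_eq_square)
  ultimately show ?thesis
    by (simp only: phase'_def[abs_def])
qed

lemma abs_k_cn_less_dn: "\<bar>k * cn k x\<bar> < dn k x"
proof -
  have "(k * cn k x)\<^sup>2 = (dn k x)\<^sup>2 - (1 - k\<^sup>2)"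
    by (simp add: cn_sq dn_sq power_mult_distrib algebra_simps)
  then have "(k * cn k x)\<^sup>2 < (dn k x)\<^sup>2"
    using k_sq_less_1 by simp
  then show ?thesis
    using dn_pos[of x] by (metis less_imp_le power2_abs power2_less_imp_less)
qed

lemma phase'_pos: "0 < phase' x"
  using abs_k_cn_less_dn[of x] by (simp add: phase'_def abs_less_iff)

lemma sin_2_phase: "sin (2 * phase x) = 2 * sn k x * phase' x"
  by (simp add: two_phase phase'_def sin_add sin_arcsin_k_sn cos_arcsin_k_sn
      flip: sn_def cn_def) (simp add: algebra_simps)

lemma phase'_sq: "(phase' x)\<^sup>2 = ((1 + k) / 2)\<^sup>2 - k * (sin (phase x))\<^sup>2"
proof -
  have "cos (2 * phase x) = cn k x * dn k x - sn k x * (k * sn k x)"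
    by (simp add: two_phase cos_add sin_arcsin_k_sn cos_arcsin_k_sn flip: sn_def cn_def)
  then have s: "(sin (phase x))\<^sup>2 = (1 - (cn k x * dn k x - sn k x * (k * sn k x))) / 2"
    using cos_double_sin[of "phase x"] by simp
  have "4 * (phase' x)\<^sup>2 = (dn k x)\<^sup>2 + k\<^sup>2 * (cn k x)\<^sup>2 + 2 * k * (cn k x * dn k x)"
    by (simp add: phase'_def power2_eq_square field_simps)
  then show ?thesis
    unfolding s cn_sq dn_sq by (simp add: power2_eq_square field_simps)
qed

lemma phase_less_iff: "phase x < phase y \<longleftrightarrow> x < y"
proof -
  have "phase x < phase y" if "x < y" for x y
    by (rule DERIV_pos_imp_increasing[OF that]) (use DERIV_phase phase'_pos in blast)
  then show ?thesis by (metis linorder_neq_iff order_less_asym)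
qed

lemma phase_minus: "phase (- x) = - phase x"
  using abs_k_sn_less_1[of x] by (simp add: phase_def sn_def am_minus arcsin_minus field_simps)

lemma phase_0 [simp]: "phase 0 = 0"
  using phase_minus[of 0] by simp

lemma phase'_minus: "phase' (- x) = phase' x"
  by (simp add: phase'_def dn_def cn_def sn_def am_minus)

lemma phase'_0: "phase' 0 = (1 + k) / 2"
  by (simp add: phase'_def dn_def cn_def sn_def)

lemma phase_2K_symmetry: "phase (2 * ellK k - y) + phase (2 * ellK k + y) = pi"
proof -
  have "am k (2 * ellK k + y) = am k y + pi"
    using am_add_2K[of y] by (simp add: add.commute)
  then show ?thesis
    using abs_k_sn_less_1[of y]
    by (simp add: phase_def am_2K_minus sn_def arcsin_minus) (simp add: field_simps)
qed

lemma continuous_on_phase: "continuous_on A phase"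
  using DERIV_phase DERIV_isCont by (blast intro: continuous_at_imp_continuous_on)

text \<open>Separation of variables in the pendulum equation \<open>h'\<^sup>2 = ((1 + k) / 2)\<^sup>2 - k sin\<^sup>2 h\<close>, which
  \<open>phase\<close> solves: its increasing solution through the origin is unique, since the radicand is
  positive.\<close>

lemma phase_unique:
  assumes deriv: "\<And>x. (h has_real_derivative h' x) (at x)" and "\<And>x. 0 < h' x"
    and sq: "\<And>x. (h' x)\<^sup>2 = ((1 + k) / 2)\<^sup>2 - k * (sin (h x))\<^sup>2" and "h 0 = 0"
  shows "h x = phase x"
proof -
  define w where "w t = sqrt (((1 + k) / 2)\<^sup>2 - k * (sin t)\<^sup>2)" for t
  have pos: "0 < ((1 + k) / 2)\<^sup>2 - k * (sin t)\<^sup>2" for t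
  proof -
    have "k * (sin t)\<^sup>2 \<le> k"
      using k_pos by (simp add: abs_square_le_1 mult_left_le)
    moreover have "((1 + k) / 2)\<^sup>2 - k = ((1 - k) / 2)\<^sup>2"
      by (simp add: power2_eq_square field_simps)
    moreover have "0 < ((1 - k) / 2)\<^sup>2"
      using k_less_1 by simp
    ultimately show ?thesis by linarith
  qed
  have w_pos: "0 < w t" for t using pos by (simp add: w_def)
  \<comment> \<open>The inverse of the solution.\<close>
  define \<Lambda> where "\<Lambda> x = (LBINT t=0..x. 1 / w t)" for x :: real
  have \<Lambda>: "(\<Lambda> has_real_derivative 1 / w t) (at t)" for t
    unfolding \<Lambda>_def[abs_def]
  proof (rule has_real_derivative_LBINT)
    show "continuous_on UNIV (\<lambda>t. 1 / w t)"
      unfolding w_def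
      by (intro continuous_intros) (use pos in \<open>metis less_irrefl real_sqrt_eq_zero_cancel_iff\<close>)
  qed
  have inj: "\<Lambda> s < \<Lambda> t" if "s < t" for s t
    by (rule DERIV_pos_imp_increasing[OF that]) (use \<Lambda> w_pos in \<open>meson divide_pos_pos zero_less_one\<close>)
  have *: "\<Lambda> (u x) = x" if deriv: "\<And>x. (u has_real_derivative u' x) (at x)" and "\<And>x. 0 < u' x"
    and sq: "\<And>x. (u' x)\<^sup>2 = ((1 + k) / 2)\<^sup>2 - k * (sin (u x))\<^sup>2" and "u 0 = 0" for u u' :: "real \<Rightarrow> real" and x
  proof -
    have "\<Lambda> (u x) - x = \<Lambda> (u 0) - 0"
    proof (rule DERIV_isconst_all[where f = "\<lambda>x. \<Lambda> (u x) - x"], intro allI)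
      fix x
      have "u' x = w (u x)"
        using \<open>0 < u' x\<close> sq[of x] unfolding w_def by (metis abs_of_pos real_sqrt_abs)
      then show "((\<lambda>x. \<Lambda> (u x) - x) has_real_derivative 0) (at x)"
        using DERIV_diff[OF DERIV_chain2[OF \<Lambda> deriv] DERIV_ident, of x] w_pos[of "u x"]
        by simp
    qed
    moreover have "\<Lambda> 0 = 0" by (simp add: \<Lambda>_def zero_ereal_def)
    ultimately show ?thesis by (simp add: \<open>u 0 = 0\<close>)
  qed
  have "\<Lambda> (h x) = \<Lambda> (phase x)"
    using *[of h h'] *[of phase phase'] assms DERIV_phase phase'_pos phase'_sq by simp
  then show ?thesis
    using inj by (metis linorder_neq_iff)
qed


section \<open>The angle function\<close>

definition angle :: "real \<Rightarrow> real \<Rightarrow> real" where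
  "angle x y = phase (x - y) + phase (x + y)"

lemma angle_0: "angle 0 y = 0"
  by (simp add: angle_def phase_minus)

lemma angle_2K: "angle (2 * ellK k) y = pi"
  by (simp add: angle_def phase_2K_symmetry)

lemma angle_less_iff: "angle x y < angle x' y \<longleftrightarrow> x < x'"
proof -
  have "angle u y < angle v y" if "u < v" for u v
    using that by (simp add: angle_def add_strict_mono phase_less_iff)
  then show ?thesis by (metis linorder_neq_iff order_less_asym)
qed

lemma angle_le_iff: "angle x y \<le> angle x' y \<longleftrightarrow> x \<le> x'"
  using angle_less_iff[of x' y x] by linarith

lemma angle_bounds:
  assumes "0 < x" "x < 2 * ellK k"
  shows "0 < angle x y" "angle x y < pi"
  using assms angle_less_iff[of 0 y x] angle_less_iff[of x y "2 * ellK k"]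
  by (simp_all add: angle_0 angle_2K)

lemma sn_pos: "0 < x \<Longrightarrow> x < 2 * ellK k \<Longrightarrow> 0 < sn k x"
  using am_in_0_pi_iff[of x] by (simp add: sn_def sin_gt_zero)

lemma phase'_sq_diff: "(phase' u)\<^sup>2 - (phase' v)\<^sup>2 = - k * (sin (u' + v') * sin (u' - v'))"
  if "u' = phase u" "v' = phase v"
proof -
  have "sin (u' + v') * sin (u' - v') = (sin u')\<^sup>2 * (cos v')\<^sup>2 - (cos u')\<^sup>2 * (sin v')\<^sup>2"
    by (simp add: sin_add sin_diff algebra_simps power2_eq_square)
  also have "\<dots> = (sin u')\<^sup>2 - (sin v')\<^sup>2"
    unfolding cos_squared_eq by (simp add: algebra_simps)
  finally show ?thesis
    unfolding phase'_sq that[symmetric] by (simp only:) (simp add: algebra_simps)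
qed

text \<open>For \<open>P = phase (x + y) + phase (x - y)\<close> and \<open>M = phase (x + y) - phase (x - y)\<close> the pendulum
  equation gives \<open>P\<^sub>x M\<^sub>x = - k sin P sin M\<close>, while \<open>P\<^sub>y = M\<^sub>x\<close> and \<open>P\<^sub>x\<^sub>y = - k cos P sin M\<close>.
  Hence the derivative of \<open>P\<^sub>x / sin P\<close> with respect to \<open>y\<close> vanishes, and the value at \<open>y = 0\<close> is
  \<open>1 / sn x\<close>.\<close>

lemma phase'_add_eq:
  assumes "0 < x" "x < 2 * ellK k"
  shows "phase' (x - y) + phase' (x + y) = sin (angle x y) / sn k x"
proof -
  have sin_pos: "0 < sin (angle x y)" for y
    using angle_bounds[OF assms] by (simp add: sin_gt_zero)
  have "(phase' (x - y) + phase' (x + y)) / sin (angle x y) = (phase' (x - 0) + phase' (x + 0)) / sin (angle x 0)"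
  proof (rule DERIV_isconst_all[where f = "\<lambda>y. (phase' (x - y) + phase' (x + y)) / sin (angle x y)"], intro allI)
    fix y
    let ?A = "phase (x + y)" and ?B = "phase (x - y)"
    let ?N = "phase' (x - y) + phase' (x + y)"
    have dN: "((\<lambda>y. phase' (x - y) + phase' (x + y)) has_real_derivative
        (- (k / 2) * sin (2 * ?B)) * (-1) + (- (k / 2) * sin (2 * ?A)) * 1) (at y)"
      by (intro DERIV_add DERIV_chain2[OF DERIV_phase']) (auto intro!: derivative_eq_intros)
    have dP: "((\<lambda>y. angle x y) has_real_derivative phase' (x - y) * (-1) + phase' (x + y) * 1) (at y)"
      unfolding angle_def
      by (intro DERIV_add DERIV_chain2[OF DERIV_phase]) (auto intro!: derivative_eq_intros)
    have dsin: "((\<lambda>y. sin (angle x y)) has_real_derivative cos (angle x y) * (phase' (x + y) - phase' (x - y))) (at y)"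
      using DERIV_chain2[OF DERIV_sin dP] by simp
    have e: "sin (2 * ?A) - sin (2 * ?B) = 2 * (cos (angle x y) * sin (?A - ?B))"
      using sin_diff_sin[of "2 * ?A" "2 * ?B"]
      by (simp add: angle_def algebra_simps add_divide_distrib diff_divide_distrib)
    have m: "?N * (phase' (x + y) - phase' (x - y)) = - k * (sin (angle x y) * sin (?A - ?B))"
      using phase'_sq_diff[of ?A "x + y" ?B "x - y"]
      by (simp add: angle_def power2_eq_square algebra_simps)
    have "((- (k / 2) * sin (2 * ?B)) * (-1) + (- (k / 2) * sin (2 * ?A)) * 1) * sin (angle x y)
        - ?N * (cos (angle x y) * (phase' (x + y) - phase' (x - y))) = 0"
    proof -
      have "(- (k / 2) * sin (2 * ?B)) * (-1) + (- (k / 2) * sin (2 * ?A)) * 1 = - (k / 2) * (sin (2 * ?A) - sin (2 * ?B))"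
        by (simp add: algebra_simps)
      also have "\<dots> = - k * (cos (angle x y) * sin (?A - ?B))"
        unfolding e by simp
      finally show ?thesis
        unfolding mult.left_commute[of ?N] m by simp
    qed
    with DERIV_divide[OF dN dsin] sin_pos[of y]
    show "((\<lambda>y. (phase' (x - y) + phase' (x + y)) / sin (angle x y)) has_real_derivative 0) (at y)"
      by (simp add: less_imp_neq)
  qed
  moreover have "angle x 0 = 2 * phase x" by (simp add: angle_def)
  ultimately show ?thesis
    using sin_pos[of y] phase'_pos[of x] sn_pos[OF assms]
    by (simp add: sin_2_phase field_simps)
qed

text \<open>By \<open>phase'_add_eq\<close>, the logarithmic derivatives of \<open>tan (angle x y / 2)\<close> and of \<open>tan (phase
  x)\<close> with respect to \<open>x\<close> are both \<open>1 / sn x\<close>. So their quotient depends on \<open>y\<close> only; its value is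
  the limit for \<open>x \<rightarrow> 0\<close>.\<close>

lemma tan_half_angle:
  assumes x: "0 < x" "x < 2 * ellK k"
  shows "tan (angle x y / 2) = tan (phase x) * (phase' y / phase' 0)"
proof -
  let ?q = "\<lambda>x. tan (angle x y / 2) / tan (phase x)"
  have half: "0 < angle t y / 2" "angle t y / 2 < pi / 2" "0 < phase t" "phase t < pi / 2"
    if "0 < t" "t < 2 * ellK k" for t
    using angle_bounds[OF that, of y] angle_bounds[OF that, of 0] by (auto simp: angle_def)
  have deriv: "(?q has_real_derivative 0) (at t)" if t: "0 < t" "t < 2 * ellK k" for t
  proof -
    note h = half[OF t]
    have c: "0 < cos (angle t y / 2)" "0 < cos (phase t)" "0 < sin (phase t)"
      using h by (auto intro!: cos_gt_zero_pi sin_gt_zero)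
    have "((\<lambda>t. angle t y / 2) has_real_derivative (phase' (t - y) * 1 + phase' (t + y) * 1) / 2) (at t)"
      unfolding angle_def
      by (intro DERIV_cdivide DERIV_add DERIV_chain2[OF DERIV_phase]) (auto intro!: derivative_eq_intros)
    then have "((\<lambda>t. angle t y / 2) has_real_derivative sin (angle t y) / sn k t / 2) (at t)"
      using phase'_add_eq[OF t, of y] by simp
    from DERIV_divide[OF DERIV_chain2[OF DERIV_tan this] DERIV_chain2[OF DERIV_tan DERIV_phase]]
    have "(?q has_real_derivative (inverse ((cos (angle t y / 2))\<^sup>2) * (sin (angle t y) / sn k t / 2) * tan (phase t)
        - tan (angle t y / 2) * (inverse ((cos (phase t))\<^sup>2) * phase' t)) / (tan (phase t) * tan (phase t))) (at t)"
      using c by (simp add: tan_def)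
    moreover have "inverse ((cos (angle t y / 2))\<^sup>2) * (sin (angle t y) / sn k t / 2) * tan (phase t)
        - tan (angle t y / 2) * (inverse ((cos (phase t))\<^sup>2) * phase' t) = 0"
    proof -
      have "sin (angle t y) = 2 * sin (angle t y / 2) * cos (angle t y / 2)"
        using sin_double[of "angle t y / 2"] by simp
      moreover have "phase' t = sin (phase t) * cos (phase t) / sn k t"
        using sin_2_phase[of t] sin_double[of "phase t"] sn_pos[OF t] by (simp add: field_simps)
      ultimately show ?thesis
        using c sn_pos[OF t] by (simp add: tan_def field_simps power2_eq_square)
    qed
    ultimately show ?thesis by simp
  qed
  have const: "?q t = ?q x" if "0 < t" "t < 2 * ellK k" for t
    by (rule DERIV_isconst3[of 0 "2 * ellK k"]) (use that x ellK_pos deriv in auto)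
  have "((\<lambda>x. tan (angle x y / 2)) has_real_derivative phase' y) (at 0)"
  proof -
    have "((\<lambda>t. angle t y / 2) has_real_derivative (phase' (0 - y) * 1 + phase' (0 + y) * 1) / 2) (at 0)"
      unfolding angle_def
      by (intro DERIV_cdivide DERIV_add DERIV_chain2[OF DERIV_phase]) (auto intro!: derivative_eq_intros)
    then have "((\<lambda>t. angle t y / 2) has_real_derivative phase' y) (at 0)"
      by (simp add: phase'_minus)
    from DERIV_chain2[OF DERIV_tan this] show ?thesis by (simp add: angle_0)
  qed
  then have lim1: "((\<lambda>t. tan (angle t y / 2) / t) \<longlongrightarrow> phase' y) (at 0)"
    by (simp add: has_field_derivative_iff angle_0)
  have "((\<lambda>x. tan (phase x)) has_real_derivative phase' 0) (at 0)"
    using DERIV_chain2[OF DERIV_tan DERIV_phase[of 0]] by simp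
  then have lim2: "((\<lambda>t. tan (phase t) / t) \<longlongrightarrow> phase' 0) (at 0)"
    by (simp add: has_field_derivative_iff)
  have "((\<lambda>t. (tan (angle t y / 2) / t) / (tan (phase t) / t)) \<longlongrightarrow> phase' y / phase' 0) (at_right 0)"
    using tendsto_divide[OF lim1 lim2] phase'_pos[of 0] by (auto intro: filterlim_at_within_not_equal filterlim_mono at_le)
  moreover have "eventually (\<lambda>t. (tan (angle t y / 2) / t) / (tan (phase t) / t) = ?q x) (at_right 0)"
    using eventually_at_right_real[of 0 "2 * ellK k"] ellK_pos
    by (auto elim!: eventually_mono simp: const)
  ultimately have "?q x = phase' y / phase' 0"
    by (intro tendsto_unique[OF trivial_limit_at_right_real tendsto_eventually])
  moreover have "tan (phase x) \<noteq> 0"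
    using half[OF x] by (metis less_irrefl tan_gt_zero)
  ultimately show ?thesis by (simp add: field_simps)
qed

text \<open>The two factors have the same modulus, and \<open>tan_half_angle\<close> gives the direction of their
  sum, which bisects them.\<close>

lemma cis_angle:
  assumes x: "0 < x" "x < 2 * ellK k"
  shows "cis (angle x y) = sgn (Complex (cn k x) (sn k x * dn k y) * Complex (dn k x) (k * sn k x * cn k y))"
proof -
  define U where "U = Complex (cn k x) (sn k x * dn k y)"
  define V where "V = Complex (dn k x) (k * sn k x * cn k y)"
  define t where "t = tan (angle x y / 2)"
  have half: "0 < angle x y / 2" "angle x y / 2 < pi / 2" "0 < phase x" "phase x < pi / 2"
    using angle_bounds[OF x, of y] angle_bounds[OF x, of 0] by (auto simp: angle_def)
  have "\<bar>cn k x\<bar> < dn k x"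
  proof -
    have "(dn k x)\<^sup>2 - (cn k x)\<^sup>2 = (1 - k\<^sup>2) * (sn k x)\<^sup>2"
      by (simp add: cn_sq dn_sq algebra_simps)
    moreover have "0 < (1 - k\<^sup>2) * (sn k x)\<^sup>2"
      using k_sq_less_1 sn_pos[OF x] by simp
    ultimately have "(cn k x)\<^sup>2 < (dn k x)\<^sup>2" by linarith
    then show ?thesis using dn_pos[of x]
      by (metis less_imp_le power2_abs power2_less_imp_less)
  qed
  then have s_pos: "0 < cn k x + dn k x" by linarith
  have "tan (phase x) = (1 + k) * sn k x / (cn k x + dn k x)"
  proof -
    have cpos: "cos (phase x) \<noteq> 0" 
      using half by (metis cos_gt_zero less_irrefl)
    have "(cn k x + dn k x) * sin (phase x) = (sn k x + k * sn k x) * cos (phase x)"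
    proof -
      define u v where "u = am k x" and "v = arcsin (k * sn k x)"
      have p: "phase x = (u + v) / 2" by (simp add: phase_def u_def v_def)
      have "cn k x = cos u" "dn k x = cos v" "sn k x = sin u" "k * sn k x = sin v"
        by (simp_all add: u_def v_def sin_arcsin_k_sn cos_arcsin_k_sn) (simp_all add: cn_def sn_def)
      moreover have "(cos u + cos v) * sin ((u + v) / 2) = (sin u + sin v) * cos ((u + v) / 2)"
        by (simp add: cos_plus_cos sin_plus_sin)
      ultimately show ?thesis unfolding p by metis
    qed
    then show ?thesis using cpos s_pos by (simp add: tan_def field_simps)
  qed
  then have t: "t = (sn k x * dn k y + k * sn k x * cn k y) / (cn k x + dn k x)"
    unfolding t_def tan_half_angle[OF x] phase'_0 using s_pos k_pos
    by (simp add: phase'_def field_simps)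
  have UV: "U + V = (cn k x + dn k x) * Complex 1 t"
    using s_pos by (simp add: U_def V_def t complex_eq_iff)
  have "Complex 1 t = Complex (cos (angle x y / 2)) (sin (angle x y / 2)) / cos (angle x y / 2)"
    using half by (simp add: t_def tan_def complex_eq_iff cos_gt_zero less_imp_neq[symmetric])
  then have UV': "U + V = complex_of_real ((cn k x + dn k x) / cos (angle x y / 2)) * cis (angle x y / 2)"
    unfolding UV by (simp add: cis.code)
  have pos: "0 < (cn k x + dn k x) / cos (angle x y / 2)"
    using s_pos half by (simp add: cos_gt_zero)
  have "sgn (complex_of_real c * cis t) = cis t" if "0 < c" for c t
    using that by (simp add: sgn_mult sgn_of_real)
  from this[OF pos] have "sgn (U + V) = cis (angle x y / 2)"
    unfolding UV' .
  then have "cis (angle x y) = (sgn (U + V))\<^sup>2"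
    by (simp add: cis_mult power2_eq_square)
  also have "\<dots> = sgn (U * V)"
  proof -
    have eq: "U * cnj U = V * cnj V"
    proof -
      have "(cn k x)\<^sup>2 + (sn k x * dn k y)\<^sup>2 = (dn k x)\<^sup>2 + (k * sn k x * cn k y)\<^sup>2"
        by (simp add: cn_sq dn_sq power_mult_distrib algebra_simps)
      then show ?thesis
        by (simp add: complex_mult_cnj U_def V_def del: of_real_add)
    qed
    have nz: "U \<noteq> 0" "V \<noteq> 0" "U + V \<noteq> 0"
      using dn_pos sn_pos[OF x] UV' pos
      by (auto simp: U_def V_def complex_eq_iff less_imp_neq[symmetric]) 
    have n: "norm U = norm V"
    proof -
      have "complex_of_real ((norm U)\<^sup>2) = complex_of_real ((norm V)\<^sup>2)"
        using eq by (simp only: complex_norm_square)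
      then show ?thesis by (simp only: of_real_eq_iff power2_eq_iff_nonneg norm_ge_zero)
    qed
    have "(U + V)\<^sup>2 * (norm (U * V)) = U * V * (norm (U + V))\<^sup>2"
    proof -
      have "complex_of_real (norm (U * V)) = U * cnj U"
        using n by (simp add: norm_mult complex_norm_square[symmetric] power2_eq_square)
      moreover have "complex_of_real ((norm (U + V))\<^sup>2) = (U + V) * (cnj U + cnj V)"
        by (metis complex_cnj_add complex_norm_square)
      moreover have "(U + V) * (U * cnj U) = U * V * (cnj U + cnj V)"
      proof -
        have "(U + V) * (U * cnj U) = U * (U * cnj U) + V * (U * cnj U)"
          by (rule distrib_right)
        also have "\<dots> = U * (V * cnj V) + V * (U * cnj U)"
          by (simp only: eq)
        also have "\<dots> = U * V * (cnj U + cnj V)"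
          by (simp add: distrib_left mult_ac)
        finally show ?thesis .
      qed
      ultimately show ?thesis
        by (simp only: power2_eq_square[of "U + V"] mult.assoc) (simp only: mult.left_commute)
    qed
    then show ?thesis
      using nz by (simp add: sgn_eq power_divide frac_eq_eq del: norm_mult)
  qed
  finally show ?thesis by (simp add: U_def V_def)
qed

section \<open>The phase function is the branch of the argument\<close>


text \<open>An ascending Landen transformation. The point on the right moves on the unit circle with
  angular velocity \<open>(1 + k) (1 - k s\<^sup>2) / (2 (1 + k s\<^sup>2))\<close>, so its angle solves the pendulum
  equation as well.\<close>

lemma sin_cos_phase:
  fixes x :: real
  defines "s \<equiv> sn k (x / 2)"
  shows "sin (phase x) = (1 + k) * s / (1 + k * s\<^sup>2)"
    and "cos (phase x) = cn k (x / 2) * dn k (x / 2) / (1 + k * s\<^sup>2)"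
proof -
  define D where "D x = 1 + k * (sn k (x / 2))\<^sup>2" for x
  define S where "S x = (1 + k) * sn k (x / 2) / D x" for x
  define C where "C x = cn k (x / 2) * dn k (x / 2) / D x" for x
  define w where "w x = (1 + k) / 2 * (1 - k * (sn k (x / 2))\<^sup>2) / D x" for x
  have D_pos: "0 < D x" for x
    using k_pos by (simp add: D_def add_pos_nonneg)
  have half: "((\<lambda>x. x / 2) has_real_derivative 1 / 2) (at x)" for x :: real
    by (auto intro!: derivative_eq_intros)
  note dsn = DERIV_chain2[OF DERIV_sn half] and dcn = DERIV_chain2[OF DERIV_cn half]
    and ddn = DERIV_chain2[OF DERIV_dn half]
  have dD: "(D has_real_derivative k * (2 * (sn k (x / 2) * (cn k (x / 2) * dn k (x / 2) * (1 / 2))))) (at x)" for x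
    unfolding D_def[abs_def]
    using DERIV_add[OF DERIV_const[of 1] DERIV_cmult[OF DERIV_power[OF dsn[of x], of 2], of k]]
    by (simp add: algebra_simps)
  have dS: "(S has_real_derivative C x * w x) (at x)" for x
  proof -
    have "(S has_real_derivative ((1 + k) * (cn k (x / 2) * dn k (x / 2) * (1 / 2)) * D x
        - (1 + k) * sn k (x / 2) * (k * (2 * (sn k (x / 2) * (cn k (x / 2) * dn k (x / 2) * (1 / 2)))))) / (D x * D x)) (at x)"
      unfolding S_def[abs_def]
      by (intro DERIV_divide DERIV_cmult dsn dD) (use D_pos[of x] in simp)
    moreover have "((1 + k) * (cn k (x / 2) * dn k (x / 2) * (1 / 2)) * D x
        - (1 + k) * sn k (x / 2) * (k * (2 * (sn k (x / 2) * (cn k (x / 2) * dn k (x / 2) * (1 / 2)))))) = 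
        cn k (x / 2) * dn k (x / 2) * ((1 + k) / 2 * (1 - k * (sn k (x / 2))\<^sup>2))"
      by (simp add: D_def power2_eq_square field_simps)
    ultimately show ?thesis
      by (simp only: C_def w_def times_divide_times_eq)
  qed
  have dC: "(C has_real_derivative - S x * w x) (at x)" for x
  proof -
    let ?s = "sn k (x / 2)" and ?c = "cn k (x / 2)" and ?d = "dn k (x / 2)"
    have "(C has_real_derivative ((- (?s * ?d) * (1 / 2) * ?d + - (k\<^sup>2 * ?s * ?c) * (1 / 2) * ?c) * D x
        - ?c * ?d * (k * (2 * (?s * (?c * ?d * (1 / 2)))))) / (D x * D x)) (at x)"
      unfolding C_def[abs_def]
      by (intro DERIV_divide DERIV_mult dcn ddn dD) (use D_pos[of x] in simp)
    moreover have "(- (?s * ?d) * (1 / 2) * ?d + - (k\<^sup>2 * ?s * ?c) * (1 / 2) * ?c) * D x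
        - ?c * ?d * (k * (2 * (?s * (?c * ?d * (1 / 2)))))
        = - ((1 + k) * ?s) * ((1 + k) / 2 * (1 - k * ?s\<^sup>2))"
    proof -
      have "(- (?s * ?d) * (1 / 2) * ?d + - (k\<^sup>2 * ?s * ?c) * (1 / 2) * ?c) * D x
        - ?c * ?d * (k * (2 * (?s * (?c * ?d * (1 / 2)))))
        = - (?s / 2) * ((?d\<^sup>2 + k\<^sup>2 * ?c\<^sup>2) * D x + 2 * k * ?c\<^sup>2 * ?d\<^sup>2)"
        by (simp add: power2_eq_square field_simps)
      also have "(?d\<^sup>2 + k\<^sup>2 * ?c\<^sup>2) * D x + 2 * k * ?c\<^sup>2 * ?d\<^sup>2 = (1 + k)\<^sup>2 * (1 - k * ?s\<^sup>2)"
        unfolding D_def cn_sq dn_sq by (simp add: power2_eq_square algebra_simps)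
      finally show ?thesis by (simp add: power2_eq_square)
    qed
    ultimately have "(C has_real_derivative - ((1 + k) * ?s) * ((1 + k) / 2 * (1 - k * ?s\<^sup>2)) / (D x * D x)) (at x)"
      by simp
    then show ?thesis
      by (simp only: S_def w_def times_divide_times_eq minus_divide_left)
  qed
  define h where "h x = (LBINT t=0..x. w t)" for x :: real
  have "isCont w x" for x
  proof -
    have "isCont D x" "isCont (\<lambda>x. sn k (x / 2)) x"
      using dD dsn DERIV_isCont by blast+
    then show ?thesis
      unfolding w_def[abs_def] using D_pos[of x] by (intro continuous_intros) auto
  qed
  then have dh: "(h has_real_derivative w x) (at x)" for x
    unfolding h_def[abs_def]
    by (intro has_real_derivative_LBINT continuous_at_imp_continuous_on) auto
  have h0: "h 0 = 0" by (simp add: h_def zero_ereal_def)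
  have "C x * cos (h x) + S x * sin (h x) = C 0 * cos (h 0) + S 0 * sin (h 0)" for x
    by (rule DERIV_isconst_all[where f = "\<lambda>x. C x * cos (h x) + S x * sin (h x)"])
       (auto intro!: derivative_eq_intros dS dC dh simp: algebra_simps)
  then have c1: "C x * cos (h x) + S x * sin (h x) = 1" for x
    by (simp add: h0 C_def S_def D_def sn_def cn_def dn_def)
  have "S x * cos (h x) - C x * sin (h x) = S 0 * cos (h 0) - C 0 * sin (h 0)" for x
    by (rule DERIV_isconst_all[where f = "\<lambda>x. S x * cos (h x) - C x * sin (h x)"])
       (auto intro!: derivative_eq_intros dS dC dh simp: algebra_simps)
  then have c2: "S x * cos (h x) - C x * sin (h x) = 0" for x
    by (simp add: h0 C_def S_def D_def sn_def cn_def dn_def)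
  have sin_h: "sin (h x) = S x" for x
  proof -
    have "S x * ((sin (h x))\<^sup>2 + (cos (h x))\<^sup>2)
      = (C x * cos (h x) + S x * sin (h x)) * sin (h x) + (S x * cos (h x) - C x * sin (h x)) * cos (h x)"
      by algebra
    then show ?thesis by (simp add: c1 c2)
  qed
  have cos_h: "cos (h x) = C x" for x
  proof -
    have "C x * ((sin (h x))\<^sup>2 + (cos (h x))\<^sup>2)
      = (C x * cos (h x) + S x * sin (h x)) * cos (h x) - (S x * cos (h x) - C x * sin (h x)) * sin (h x)"
      by algebra
    then show ?thesis by (simp add: c1 c2)
  qed
  have "h x = phase x" for x
  proof (rule phase_unique[OF dh])
    fix x
    have "k * (sn k (x / 2))\<^sup>2 < 1"
    proof -
      have "k * (sn k (x / 2))\<^sup>2 \<le> k"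
        using k_pos by (simp add: sn_def abs_square_le_1 mult_left_le)
      then show ?thesis using k_less_1 by simp
    qed
    then show "0 < w x"
      using D_pos[of x] k_pos by (simp add: w_def)
    have "(w x)\<^sup>2 = (((1 + k) / 2)\<^sup>2 * ((D x)\<^sup>2 - 4 * (k * (sn k (x / 2))\<^sup>2))) / (D x)\<^sup>2"
      by (simp add: w_def D_def power2_eq_square field_simps)
    also have "\<dots> = ((1 + k) / 2)\<^sup>2 - k * (S x)\<^sup>2"
      using D_pos[of x] by (simp add: S_def power2_eq_square field_simps)
    finally show "(w x)\<^sup>2 = ((1 + k) / 2)\<^sup>2 - k * (sin (h x))\<^sup>2" 
      by (simp add: sin_h)
  qed (rule h0)
  then show "sin (phase x) = (1 + k) * s / (1 + k * s\<^sup>2)"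
    and "cos (phase x) = cn k (x / 2) * dn k (x / 2) / (1 + k * s\<^sup>2)"
    using sin_h[of x] cos_h[of x] by (simp_all add: S_def C_def D_def s_def)
qed

text \<open>At the half period of the complementary modulus the formula for \<open>csn\<close> becomes algebraic,
  with \<open>sn\<^sup>2 = 1 / (1 + k)\<close>; the result has modulus \<open>1 / sqrt k\<close>.\<close>

lemma csn_half_period:
  "csn k (Complex (x / 2) (ellK' k / 2)) = complex_of_real (1 / sqrt k) * Complex (sin (phase x)) (cos (phase x))"
proof -
  define k' where "k' = compl_mod k"
  have k'_sq: "k'\<^sup>2 = 1 - k\<^sup>2"
    using k_sq_less_1 by (simp add: k'_def compl_mod_def)
  interpret c: elliptic_modulus k'
    using k_pos k_sq_less_1 by unfold_locales (auto simp: k'_def compl_mod_def)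
  have "compl_mod k' = k"
    using k_pos by (simp add: compl_mod_def[of k'] k'_sq)
  note period = c.am_half_period[unfolded this]
  have "0 < 1 + k" "0 < k + k * k"
    using k_pos by (simp_all add: add_pos_pos)
  then have nz: "1 + k \<noteq> 0" "k + k * k \<noteq> 0"
    by linarith+
  define u where "u = ellK k' / 2"
  define s1 c1 d1 where "s1 = sn k' u" and "c1 = cn k' u" and "d1 = dn k' u"
  have c1_pos: "0 < c1"
    unfolding c1_def cn_def u_def using period by (intro cos_gt_zero_pi) auto
  have s1: "s1 = c1 / sqrt k"
    using period(1) c1_pos by (simp add: tan_def s1_def c1_def sn_def cn_def u_def field_simps)
  have c1_sq: "c1\<^sup>2 = k / (1 + k)"
    using c.sn_cn_sq[of u] k_pos nz
    by (simp add: s1 power_divide flip: s1_def c1_def) (simp add: field_simps)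
  have s1_sq: "s1\<^sup>2 = 1 / (1 + k)"
    using k_pos nz by (simp add: s1 power_divide c1_sq field_simps)
  have d1: "d1 = sqrt k"
  proof -
    have "1 - (1 - k\<^sup>2) * (1 / (1 + k)) = k"
      using k_pos by (simp add: power2_eq_square field_simps)
    then show ?thesis
      by (simp add: d1_def dn_def k'_sq s1_sq flip: s1_def)
  qed
  have sc1: "s1 * c1 = sqrt k / (1 + k)"
  proof -
    have "s1 * c1 = c1\<^sup>2 / sqrt k" by (simp add: s1 power2_eq_square)
    also have "\<dots> = (k / sqrt k) / (1 + k)" by (simp add: c1_sq)
    also have "k / sqrt k = sqrt k" using k_pos by (simp add: real_div_sqrt)
    finally show ?thesis .
  qed
  define s where "s = sn k (x / 2)"
  have D: "c1\<^sup>2 + k\<^sup>2 * s\<^sup>2 * s1\<^sup>2 = k * (1 + k * s\<^sup>2) / (1 + k)"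
  proof -
    have "k * (1 + k * s\<^sup>2) = k + k\<^sup>2 * s\<^sup>2"
      by (simp add: power2_eq_square distrib_left)
    then show ?thesis
      unfolding c1_sq s1_sq by (simp add: add_divide_distrib)
  qed
  have sq: "sqrt k * sqrt k = k" "0 < sqrt k" using k_pos by auto
  have "csn k (Complex (x / 2) (ellK' k / 2))
      = Complex (s * d1) (cn k (x / 2) * dn k (x / 2) * s1 * c1) / of_real (c1\<^sup>2 + k\<^sup>2 * s\<^sup>2 * s1\<^sup>2)"
    by (simp add: csn_def Let_def s1_def c1_def d1_def s_def u_def k'_def ellK'_def)
  also have "\<dots> = Complex (((1 + k) * s) * sqrt k / (k * (1 + k * s\<^sup>2)))
      ((cn k (x / 2) * dn k (x / 2)) * sqrt k / (k * (1 + k * s\<^sup>2)))"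
    unfolding D d1 mult.assoc[of _ s1 c1] sc1 using nz(1)
    by (simp add: complex_eq_iff mult_ac)
  also have "\<dots> = Complex (1 / sqrt k * ((1 + k) * s / (1 + k * s\<^sup>2)))
      (1 / sqrt k * (cn k (x / 2) * dn k (x / 2) / (1 + k * s\<^sup>2)))"
  proof -
    have "sqrt k / k = 1 / sqrt k"
      using sq k_pos by (metis divide_divide_eq_left divide_self less_irrefl)
    then have "a * sqrt k / (k * d) = 1 / sqrt k * (a / d)" for a d
      by (metis mult.commute times_divide_times_eq)
    then show ?thesis by (simp only:)
  qed
  also have "\<dots> = complex_of_real (1 / sqrt k) * Complex (sin (phase x)) (cos (phase x))"
  proof -
    have "Complex (c * a) (c * b) = complex_of_real c * Complex a b" for a b c
      by (simp add: complex_eq_iff)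
    then show ?thesis by (simp only: sin_cos_phase s_def)
  qed
  finally show ?thesis .
qed

text \<open>Two continuous branches of an argument differ by a constant multiple of \<open>2\<pi>\<close>.\<close>

lemma g_eq_phase: "g k x = phase x"
proof -
  let ?z = "\<lambda>x. csn k (Complex (x / 2) (ellK' k / 2))"
  let ?P = "\<lambda>h. continuous_on UNIV h \<and> h 0 = 0 \<and> (\<forall>x. is_Arg (?z x) (pi / 2 - h x))"
  have z: "?z x = complex_of_real (1 / sqrt k) * cis (pi / 2 - phase x)" for x
    by (simp add: csn_half_period cis.code cos_diff sin_diff)
  have norm_z: "norm (?z x) = 1 / sqrt k" for x
    unfolding z norm_mult norm_of_real norm_cis using k_pos by simp
  have "?P phase"
  proof (intro conjI allI)
    show "is_Arg (?z x) (pi / 2 - phase x)" for x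
      unfolding is_Arg_def norm_z unfolding z by (simp add: cis_conv_exp)
  qed (simp_all add: continuous_on_phase)
  moreover have "h = phase" if "?P h" for h
  proof -
    define d where "d x = (h x - phase x) / (2 * pi)" for x
    have d_int: "d x \<in> \<int>" for x
    proof -
      have "?z x = complex_of_real (norm (?z x)) * exp (\<i> * of_real (pi / 2 - h x))"
        using that unfolding is_Arg_def by blast
      then have "cis (pi / 2 - phase x) = cis (pi / 2 - h x)"
        unfolding norm_z unfolding z using k_pos by (simp add: cis_conv_exp)
      then have "cis (pi / 2 - phase x) / cis (pi / 2 - h x) = 1" by simp
      then have "cis (h x - phase x) = 1" by (simp add: cis_divide)
      then have "cos (h x - phase x) = 1" by (metis cis.sel(1) one_complex.sel(1))
      then obtain n :: int where "h x - phase x = of_int n * 2 * pi"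
        unfolding cos_one_2pi_int by blast
      then have "d x = of_int n" by (simp add: d_def)
      then show ?thesis by simp
    qed
    have "d constant_on UNIV"
    proof (rule continuous_discrete_range_constant)
      show "continuous_on UNIV d"
        unfolding d_def using that continuous_on_phase by (intro continuous_intros) auto
      fix x
      have "1 \<le> norm (d y - d x)" if "d y \<noteq> d x" for y
        using Ints_nonzero_abs_ge1[OF Ints_diff[OF d_int d_int], of y x] that by simp
      then show "\<exists>e>0. \<forall>y. y \<in> UNIV \<and> d y \<noteq> d x \<longrightarrow> e \<le> norm (d y - d x)"
        by (intro exI[of _ 1]) auto
    qed auto
    then have "d x = d 0" for x by (auto simp: constant_on_def)
    moreover have "d 0 = 0" using that by (simp add: d_def)
    ultimately show ?thesis by (auto simp: d_def fun_eq_iff)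
  qed
  ultimately have "g k = phase"
    unfolding g_def by (rule the_equality)
  then show ?thesis by simp
qed

lemma DERIV_F: "(F k has_real_derivative phase x) (at x)"
proof -
  have "g k = phase" by (simp add: fun_eq_iff g_eq_phase)
  then show ?thesis
    unfolding F_def[abs_def] by (simp only: has_real_derivative_LBINT[OF continuous_on_phase])
qed


section \<open>Rings\<close>

text \<open>The denominators in \<open>ring_of\<close> do not vanish because \<open>cosh R > 0\<close>; this excludes the ends of
  the interval.\<close>

lemma ring_ofD:
  assumes "ring_of k \<gamma> r R"
  shows "0 < \<gamma>" "\<gamma> < 2 * ellK k" "sn k \<gamma> * cosh r = 1" "sn k \<gamma> * sinh r = cn k \<gamma>" "tanh r = cn k \<gamma>"
    "k * sn k \<gamma> * cosh R = 1" "k * sn k \<gamma> * sinh R = dn k \<gamma>" "tanh R = dn k \<gamma>"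
    "0 < R" "\<bar>r\<bar> < R"
proof -
  have ring: "0 \<le> \<gamma>" "\<gamma> \<le> 2 * ellK k" "cosh R = 1 / (k * sn k \<gamma>)" "tanh R = dn k \<gamma>"
    "sinh r = cn k \<gamma> / sn k \<gamma>"
    using assms by (auto simp: ring_of_def)
  have "sn k \<gamma> \<noteq> 0"
  proof
    assume "sn k \<gamma> = 0"
    with ring(3) cosh_real_pos[of R] show False by simp
  qed
  then have "\<gamma> \<noteq> 0" "\<gamma> \<noteq> 2 * ellK k"
    by (auto simp: sn_def am_2K)
  with ring show \<gamma>: "0 < \<gamma>" "\<gamma> < 2 * ellK k" by auto
  have sn: "0 < sn k \<gamma>" using sn_pos[OF \<gamma>] .
  show sinh_r: "sn k \<gamma> * sinh r = cn k \<gamma>" using ring sn by simp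
  have "(sn k \<gamma> * cosh r)\<^sup>2 = 1"
    using sinh_r sn_cn_sq[of \<gamma>] by (simp add: power_mult_distrib cosh_square_eq algebra_simps flip: sinh_r)
  then show cosh_r: "sn k \<gamma> * cosh r = 1"
    using sn by (simp add: power2_eq_1_iff) (smt (verit) cosh_real_pos mult_pos_pos)
  show "tanh r = cn k \<gamma>"
    using sinh_r cosh_r sn by (simp add: tanh_def) (metis mult.commute nonzero_mult_div_cancel_right 
        cosh_real_nonzero mult.assoc mult.right_neutral)
  show cosh_R: "k * sn k \<gamma> * cosh R = 1" using ring sn k_pos by simp
  show tanh_R: "tanh R = dn k \<gamma>" by fact
  have "sinh R = tanh R * cosh R" by (simp add: tanh_def)
  then show "k * sn k \<gamma> * sinh R = dn k \<gamma>"
    using cosh_R tanh_R by (simp add: mult.commute mult.left_commute mult.assoc)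
  have "0 < tanh R" using tanh_R dn_pos by simp
  then show R: "0 < R" by simp
  have "cosh r = k * cosh R"
    using cosh_r cosh_R sn by (metis mult.assoc mult.left_commute mult_left_cancel less_irrefl)
  then have "cosh r < cosh R"
    using k_less_1 cosh_real_pos[of R] by simp
  then have "cosh \<bar>r\<bar> < cosh R" by (simp add: abs_if)
  then show "\<bar>r\<bar> < R" using R cosh_real_nonneg_less_iff[of "\<bar>r\<bar>" R] by simp
qed

lemma ring_of_exists:
  assumes "0 < \<gamma>" "\<gamma> < 2 * ellK k"
  shows "ring_of k \<gamma> (arsinh (cn k \<gamma> / sn k \<gamma>)) (arcosh (1 / (k * sn k \<gamma>)))"
proof -
  have sn: "0 < sn k \<gamma>" using sn_pos[OF assms] .
  have "k * sn k \<gamma> < 1" using abs_k_sn_less_1[of \<gamma>] by linarith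
  then have ge: "1 \<le> 1 / (k * sn k \<gamma>)" using sn k_pos by simp
  define R where "R = arcosh (1 / (k * sn k \<gamma>))"
  have R: "cosh R = 1 / (k * sn k \<gamma>)" "0 \<le> R"
    using ge by (simp_all add: R_def arcosh_nonneg_real cosh_arcosh_real)
  have "(sinh R)\<^sup>2 = (dn k \<gamma> / (k * sn k \<gamma>))\<^sup>2"
    using sn k_pos by (simp add: sinh_square_eq R power_divide dn_sq field_simps power_mult_distrib)
  then have "sinh R = dn k \<gamma> / (k * sn k \<gamma>)"
    using R(2) dn_pos[of \<gamma>] sn k_pos by (simp add: power2_eq_iff_nonneg)
  then have "tanh R = dn k \<gamma>" using R(1) sn k_pos by (simp add: tanh_def)
  then show ?thesis
    using assms R by (simp add: ring_of_def R_def)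
qed

lemma cis_angle_ring:
  assumes "ring_of k x r R" "ring_of k y r' R'"
  shows "cis (angle x y) = sgn (Complex (sinh r) (tanh R') * Complex (sinh R) (tanh r'))"
proof -
  note a = ring_ofD[OF assms(1)] and b = ring_ofD[OF assms(2)]
  have s: "0 < sn k x" using sn_pos a by blast
  have "Complex (cn k x) (sn k x * dn k y) = of_real (sn k x) * Complex (sinh r) (tanh R')"
    using a b by (simp add: complex_eq_iff)
  moreover have "Complex (dn k x) (k * sn k x * cn k y) = of_real (k * sn k x) * Complex (sinh R) (tanh r')"
    using a b by (simp add: complex_eq_iff)
  ultimately show ?thesis
    unfolding cis_angle[OF a(1,2)] using s k_pos by (simp add: sgn_mult sgn_of_real del: of_real_mult)
qed

lemma cis_arctan_div:
  assumes "c \<noteq> 0"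
  shows "cis (arctan (s / c)) = of_real (sgn c) * sgn (Complex c s)"
proof -
  have "cis (arctan (s / c)) = Complex 1 (s / c) / of_real (sqrt (1 + (s / c)\<^sup>2))"
    by (simp add: complex_eq_iff cos_arctan sin_arctan)
  also have "sqrt (1 + (s / c)\<^sup>2) = sqrt (c\<^sup>2 + s\<^sup>2) / \<bar>c\<bar>"
  proof -
    have "1 + (s / c)\<^sup>2 = (c\<^sup>2 + s\<^sup>2) / c\<^sup>2" using assms by (simp add: field_simps)
    then show ?thesis by (simp add: real_sqrt_divide)
  qed
  also have "Complex 1 (s / c) / of_real (sqrt (c\<^sup>2 + s\<^sup>2) / \<bar>c\<bar>) = of_real (sgn c) * sgn (Complex c s)"
    using assms by (simp add: complex_eq_iff sgn_eq cmod_def sgn_if)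
  finally show ?thesis .
qed

lemma cis_eqD:
  assumes "cis u = cis v" "\<bar>u - v\<bar> < 2 * pi"
  shows "u = v"
proof -
  have "cis (u - v) = 1" using assms(1) by (simp flip: cis_divide)
  then have "cos (u - v) = 1" by (metis cis.sel(1) one_complex.sel(1))
  then obtain n :: int where n: "u - v = of_int n * 2 * pi"
    unfolding cos_one_2pi_int by blast
  then have "\<bar>real_of_int n\<bar> * (2 * pi) < 1 * (2 * pi)"
    using assms(2) by (simp add: abs_mult)
  then have "\<bar>real_of_int n\<bar> < 1" by (simp only: mult_less_cancel_right) auto
  then have "n = 0" by linarith
  with n show ?thesis by simp
qed

text \<open>Both sides have the same direction by \<open>cis_angle_ring\<close>, where \<open>arctan\<close> picks the opposite of
  the first factor if \<open>r < 0\<close>; and they differ by less than \<open>2\<pi>\<close>.\<close>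

lemma opening_angle_eq:
  assumes "ring_of k x r R" "ring_of k y r' R'" "r \<noteq> 0"
  shows "opening_angle r R r' R' = (if 0 < r then angle x y else angle x y - pi)"
proof -
  note a = ring_ofD[OF assms(1)] and b = ring_ofD[OF assms(2)]
  have tR: "0 < tanh R'" using b dn_pos by simp
  have bnd: "\<bar>arctan t\<bar> < pi / 2" for t
    using arctan_bounded[of t] by auto
  let ?\<theta> = "opening_angle r R r' R'"
  have "cis ?\<theta> = of_real (sgn (sinh r)) * sgn (Complex (sinh r) (tanh R')) *
      (of_real (sgn (sinh R)) * sgn (Complex (sinh R) (tanh r')))"
    using assms(3) a by (simp add: opening_angle_def cis_arctan_div flip: cis_mult)
  also have "\<dots> = of_real (sgn (sinh r)) * cis (angle x y)"
    using a by (simp add: cis_angle_ring[OF assms(1,2)] sgn_mult)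
  finally have *: "cis ?\<theta> = of_real (sgn (sinh r)) * cis (angle x y)" .
  note ang = angle_bounds[OF a(1,2), of y]
  show ?thesis
  proof (cases "0 < r")
    case True
    then have "0 < arctan (tanh R' / sinh r)" using tR by simp
    then have "\<bar>?\<theta> - angle x y\<bar> < 2 * pi"
      using bnd[of "tanh R' / sinh r"] bnd[of "tanh r' / sinh R"] ang
      unfolding opening_angle_def by linarith
    then show ?thesis using True * by (auto intro: cis_eqD)
  next
    case False
    then have r: "sinh r < 0" using assms(3) by simp
    then have "arctan (tanh R' / sinh r) < 0" using tR by (simp add: divide_pos_neg)
    then have "\<bar>?\<theta> - (angle x y - pi)\<bar> < 2 * pi"
      using bnd[of "tanh R' / sinh r"] bnd[of "tanh r' / sinh R"] ang
      unfolding opening_angle_def by linarith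
    moreover have "cis ?\<theta> = cis (angle x y - pi)"
      using * r by (simp flip: cis_divide)
    ultimately show ?thesis using False by (auto intro: cis_eqD)
  qed
qed

text \<open>The amplitude of \<open>\<gamma>\<close> is the angle in \<open>(0, \<pi>)\<close> with cosine \<open>tanh r\<close>.\<close>

lemma ring_of_unique:
  assumes "0 < R" "cosh r = k * cosh R"
  shows "\<exists>!\<gamma>. ring_of k \<gamma> r R"
proof -
  define \<alpha> where "\<alpha> = arccos (tanh r)"
  have t: "\<bar>tanh r\<bar> < 1" using tanh_real_bounds[of r] by (auto simp: abs_if)
  have \<alpha>: "cos \<alpha> = tanh r" "0 < \<alpha>" "\<alpha> < pi"
    using t arccos_lt_bounded[of "tanh r"] by (auto simp: \<alpha>_def)
  have "(sin \<alpha>)\<^sup>2 = (1 / cosh r)\<^sup>2"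
  proof -
    have "(sin \<alpha>)\<^sup>2 = ((cosh r)\<^sup>2 - (sinh r)\<^sup>2) / (cosh r)\<^sup>2"
      by (simp add: sin_squared_eq \<alpha>(1) tanh_def power_divide diff_divide_distrib)
    then show ?thesis by (simp add: hyperbolic_pythagoras power_divide)
  qed
  then have sin: "sin \<alpha> = 1 / cosh r"
    using \<alpha> by (simp add: power2_eq_iff_nonneg sin_ge_zero)
  define \<gamma> where "\<gamma> = ellF k \<alpha>"
  have am: "am k \<gamma> = \<alpha>" by (simp add: \<gamma>_def)
  then have \<gamma>: "0 < \<gamma>" "\<gamma> < 2 * ellK k" using am_in_0_pi_iff[of \<gamma>] \<alpha> by auto
  have sn: "sn k \<gamma> = 1 / cosh r" and cn: "cn k \<gamma> = tanh r"
    using am sin \<alpha> by (simp_all add: sn_def cn_def)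
  have "(dn k \<gamma>)\<^sup>2 = (tanh R)\<^sup>2"
  proof -
    have "k * sn k \<gamma> = 1 / cosh R"
      unfolding sn assms(2) using k_pos by simp
    then have "(dn k \<gamma>)\<^sup>2 = 1 - (1 / cosh R)\<^sup>2"
      unfolding dn_sq by (metis power_mult_distrib)
    also have "\<dots> = ((cosh R)\<^sup>2 - 1) / (cosh R)\<^sup>2"
      by (simp add: diff_divide_distrib power_divide)
    also have "(cosh R)\<^sup>2 - 1 = (sinh R)\<^sup>2"
      by (simp add: cosh_square_eq)
    finally show ?thesis by (simp only: tanh_def power_divide)
  qed
  then have dn: "tanh R = dn k \<gamma>"
    using power2_eq_iff_nonneg[of "dn k \<gamma>" "tanh R"] assms(1) dn_pos[of \<gamma>] by simp
  have cosh_R: "cosh R = 1 / (k * sn k \<gamma>)"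
    unfolding sn assms(2) using k_pos by simp
  have sinh_r: "sinh r = cn k \<gamma> / sn k \<gamma>"
    unfolding sn cn by (simp add: tanh_def)
  have "ring_of k \<gamma> r R"
    unfolding ring_of_def using \<gamma> cosh_R dn sinh_r by auto
  moreover have "\<gamma>' = \<gamma>" if "ring_of k \<gamma>' r R" for \<gamma>'
  proof -
    note a = ring_ofD[OF that]
    have c: "cos (am k \<gamma>') = cos \<alpha>" unfolding \<alpha>(1) a(5) cn_def ..
    have "0 < am k \<gamma>' \<and> am k \<gamma>' < pi"
      by (rule am_in_0_pi_iff[THEN iffD2, OF conjI[OF a(1,2)]])
    then have "0 \<le> am k \<gamma>'" "am k \<gamma>' \<le> pi" by simp_all
    then have "am k \<gamma>' = \<alpha>"
      using \<alpha>(2,3) by (intro cos_inj_pi[OF _ _ _ _ c]) simp_all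
    then have "ellF k (am k \<gamma>') = \<gamma>" by (simp only: \<gamma>_def)
    then show ?thesis by simp
  qed
  ultimately show ?thesis by (rule ex1I)
qed

end

section \<open>Critical points\<close>

lemma finite_verts: "finite Q \<Longrightarrow> finite (verts Q)"
  by (simp add: verts_def corners_def)

lemma finite_G: "finite Q \<Longrightarrow> finite (G Q)"
  by (simp add: G_def finite_verts)

lemma nb_sym: "nb Q v w \<longleftrightarrow> nb Q w v"
  by (auto simp: nb_def abs_minus_commute)

lemma nb_in_G: "nb Q v w \<Longrightarrow> v \<in> G Q" "nb Q v w \<Longrightarrow> w \<in> G Q"
  by (auto simp: nb_def)

definition nb_candidates :: "int \<times> int \<Rightarrow> (int \<times> int) set" where
  "nb_candidates v = {(fst v + 1, snd v + 1), (fst v - 1, snd v + 1), (fst v - 1, snd v - 1), (fst v + 1, snd v - 1)}"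

lemma nbs_subset: "nbs Q v \<subseteq> nb_candidates v"
  by (auto simp: nbs_def nb_def nb_candidates_def)

lemma card_nb_candidates: "card (nb_candidates v) = 4"
  by (simp add: nb_candidates_def)

lemma finite_nb_candidates: "finite (nb_candidates v)"
  by (simp add: nb_candidates_def)

lemma finite_nbs: "finite (nbs Q v)"
  using finite_subset[OF nbs_subset finite_nb_candidates] .

lemma valence_le_4: "valence Q v \<le> 4"
  unfolding valence_def using card_mono[OF finite_nb_candidates nbs_subset] by (simp add: card_nb_candidates)

lemma valence_4_iff: "valence Q v = 4 \<longleftrightarrow> nbs Q v = nb_candidates v"
  unfolding valence_def
  by (metis card_nb_candidates card_subset_eq finite_nb_candidates nbs_subset)

lemma G_cases: "v \<in> G Q \<longleftrightarrow> v \<in> inner_verts Q \<or> v \<in> boundary_verts Q"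
  using valence_le_4[of Q v] by (auto simp: inner_verts_def boundary_verts_def)

lemma not_inner_boundary: "v \<in> boundary_verts Q \<Longrightarrow> v \<notin> inner_verts Q"
  by (simp add: inner_verts_def boundary_verts_def)

lemma valence_pos:
  assumes "v \<in> G Q"
  shows "0 < valence Q v"
proof -
  from assms obtain s where s: "s \<in> Q" "v \<in> corners s" "even (fst v + snd v)"
    by (auto simp: G_def verts_def)
  define w where "w = (2 * fst s + 1 - fst v, 2 * snd s + 1 - snd v)"
  have "w \<in> corners s" "\<bar>fst w - fst v\<bar> = 1" "\<bar>snd w - snd v\<bar> = 1"
    using s(2) by (auto simp: corners_def w_def)
  moreover have "even (fst w + snd w)"
    using s(3) by (simp add: w_def)
  ultimately have "w \<in> nbs Q v"
    using s assms by (auto simp: nbs_def nb_def G_def verts_def)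
  then show ?thesis
    unfolding valence_def using finite_nbs card_gt_0_iff by blast
qed

lemma finite_edges: "finite Q \<Longrightarrow> finite (edges Q)"
  by (rule finite_subset[of _ "G Q \<times> G Q"]) (auto simp: edges_def nb_in_G finite_G)

text \<open>Each neighbour of \<open>j\<close> belongs to exactly one listed edge, as its left or as its right end.\<close>

lemma edges_at:
  assumes "finite Q"
  shows "(\<Sum>(a, b)\<in>edges Q. if a = j then c b else if b = j then c a else (0::real)) = (\<Sum>k\<in>nbs Q j. c k)"
proof -
  let ?E = "{e \<in> edges Q. fst e = j \<or> snd e = j}"
  have "(\<Sum>(a, b)\<in>edges Q. if a = j then c b else if b = j then c a else 0)
      = (\<Sum>(a, b)\<in>?E. if a = j then c b else c a)"
    using finite_edges[OF assms]
    by (intro sum.mono_neutral_cong_right) (auto split: if_splits)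
  also have "\<dots> = (\<Sum>k\<in>nbs Q j. c k)"
  proof (rule sum.reindex_bij_witness[where i = "\<lambda>k. if fst j < fst k then (j, k) else (k, j)"
        and j = "\<lambda>(a, b). if a = j then b else a"])
  qed (auto simp: edges_def nbs_def nb_sym nb_def split: if_splits)
  finally show ?thesis .
qed

context elliptic_modulus
begin

text \<open>Since \<open>phase\<close> is odd, an edge contributes the same expression to the derivative at either
  end.\<close>

lemma DERIV_S_hyp:
  assumes "finite Q" "j \<in> G Q"
  shows "((\<lambda>t. S_hyp Q k \<Phi> (\<gamma>(j := t))) has_real_derivative
    (\<Sum>i\<in>nbs Q j. angle (\<gamma> j) (\<gamma> i)) + \<Phi> j) (at (\<gamma> j))"
proof -
  have edge: "((\<lambda>t. case e of (a, b) \<Rightarrow> F k ((\<gamma>(j := t)) a - (\<gamma>(j := t)) b) + F k ((\<gamma>(j := t)) a + (\<gamma>(j := t)) b))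
      has_real_derivative (case e of (a, b) \<Rightarrow> if a = j then angle (\<gamma> j) (\<gamma> b)
        else if b = j then angle (\<gamma> j) (\<gamma> a) else 0)) (at (\<gamma> j))"
    if "e \<in> edges Q" for e
  proof -
    obtain a b where e: "e = (a, b)" "a \<noteq> b" using \<open>e \<in> edges Q\<close> by (auto simp: edges_def)
    have d1: "((\<lambda>t. F k (t - c) + F k (t + c)) has_real_derivative phase (u - c) * 1 + phase (u + c) * 1) (at u)" for c u
      by (intro DERIV_add DERIV_chain2[OF DERIV_F]) (auto intro!: derivative_eq_intros)
    have d2: "((\<lambda>t. F k (c - t) + F k (c + t)) has_real_derivative phase (c - u) * (-1) + phase (c + u) * 1) (at u)" for c u
      by (intro DERIV_add DERIV_chain2[OF DERIV_F]) (auto intro!: derivative_eq_intros)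
    have d3: "phase (c - u) * (-1) + phase (c + u) * 1 = angle u c" for c u
      using phase_minus[of "u - c"] by (simp add: angle_def add.commute)
    consider "a = j" "b \<noteq> j" | "a \<noteq> j" "b = j" | "a \<noteq> j" "b \<noteq> j" using e(2) by auto
    then show ?thesis
    proof cases
      case 1 then show ?thesis using d1
        by (simp add: e angle_def)
    next
      case 2 then show ?thesis using d2 d3 by (simp add: e)
    next
      case 3 then show ?thesis by (simp add: e)
    qed
  qed
  have vertex: "((\<lambda>t. \<Phi> i * (\<gamma>(j := t)) i) has_real_derivative (if i = j then \<Phi> j else 0)) (at (\<gamma> j))" for i
    by (auto intro!: derivative_eq_intros)
  have "((\<lambda>t. S_hyp Q k \<Phi> (\<gamma>(j := t))) has_real_derivative
      (\<Sum>(a, b)\<in>edges Q. if a = j then angle (\<gamma> j) (\<gamma> b) else if b = j then angle (\<gamma> j) (\<gamma> a) else 0)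
      + (\<Sum>i\<in>G Q. if i = j then \<Phi> j else 0)) (at (\<gamma> j))"
    unfolding S_hyp_def by (intro DERIV_add DERIV_sum edge vertex)
  then show ?thesis
    using assms by (simp add: edges_at finite_G)
qed

lemma critical_point_iff:
  assumes "finite Q"
  shows "critical_point (G Q) (S_hyp Q k \<Phi>) \<gamma> \<longleftrightarrow>
    (\<forall>j\<in>G Q. (\<Sum>i\<in>nbs Q j. angle (\<gamma> j) (\<gamma> i)) = - \<Phi> j)"
proof -
  have "((\<lambda>t. S_hyp Q k \<Phi> (\<gamma>(j := t))) has_real_derivative 0) (at (\<gamma> j))
      \<longleftrightarrow> (\<Sum>i\<in>nbs Q j. angle (\<gamma> j) (\<gamma> i)) + \<Phi> j = 0" if "j \<in> G Q" for j
  proof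
    assume "((\<lambda>t. S_hyp Q k \<Phi> (\<gamma>(j := t))) has_real_derivative 0) (at (\<gamma> j))"
    from DERIV_unique[OF DERIV_S_hyp[OF assms that] this]
    show "(\<Sum>i\<in>nbs Q j. angle (\<gamma> j) (\<gamma> i)) + \<Phi> j = 0" .
  qed (use DERIV_S_hyp[OF assms that, of \<Phi> \<gamma>] in simp)
  then show ?thesis
    unfolding critical_point_def by (auto simp: add_eq_0_iff2)
qed

lemma prescribed_angle_iff:
  assumes "j \<in> boundary_verts Q"
  shows "prescribed_angle Q k \<Theta> \<gamma> j \<longleftrightarrow> (\<Sum>i\<in>nbs Q j. angle (\<gamma> j) (\<gamma> i)) = - \<Phi>_of Q \<Theta> j"
  using not_inner_boundary[OF assms]
  by (simp add: prescribed_angle_def \<Phi>_of_def g_eq_phase angle_def)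

text \<open>Each summand of the gradient increases from \<open>0\<close> to \<open>\<pi>\<close> on \<open>[0, 2K]\<close>, and the prescribed
  value lies strictly between the resulting bounds \<open>0\<close> and \<open>\<pi>\<close> times the valence.\<close>

lemma critical_point_range:
  assumes eq: "(\<Sum>i\<in>nbs Q j. angle (\<gamma> j) (\<gamma> i)) = - \<Phi>_of Q \<Theta> j" and j: "j \<in> G Q"
    and bound: "j \<in> boundary_verts Q \<Longrightarrow> -2 * pi < \<Theta> j \<and> \<Theta> j < 2 * pi \<and> \<Theta> j \<noteq> 0"
    and bound1: "j \<in> boundary_verts Q \<Longrightarrow> valence Q j = 1 \<Longrightarrow> \<bar>\<Theta> j\<bar> < pi"
  shows "0 < \<gamma> j" "\<gamma> j < 2 * ellK k"
proof -
  let ?n = "real (valence Q j)"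
  have n: "1 \<le> valence Q j" using valence_pos[OF j] by simp
  have val: "0 < - \<Phi>_of Q \<Theta> j \<and> - \<Phi>_of Q \<Theta> j < pi * ?n"
  proof (cases "j \<in> inner_verts Q")
    case True
    then show ?thesis by (simp add: \<Phi>_of_def inner_verts_def)
  next
    case False
    then have b: "j \<in> boundary_verts Q" using j G_cases by blast
    show ?thesis
    proof (cases "valence Q j = 1")
      case True
      then show ?thesis using bound1[OF b] bound[OF b] False by (auto simp: \<Phi>_of_def)
    next
      case v: False
      then have "pi * 2 \<le> pi * ?n" using n by (intro mult_left_mono) auto
      moreover have "- \<Phi>_of Q \<Theta> j = (if 0 < \<Theta> j then \<Theta> j else \<Theta> j + pi * ?n)"
        using False by (simp add: \<Phi>_of_def)
      moreover have "- 2 * pi < \<Theta> j" "\<Theta> j < 2 * pi" "\<Theta> j \<noteq> 0"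
        using bound[OF b] by blast+
      ultimately show ?thesis
        by (intro conjI; cases "0 < \<Theta> j"; simp only: if_True if_False; linarith)
    qed
  qed
  show "0 < \<gamma> j"
  proof (rule ccontr)
    assume "\<not> 0 < \<gamma> j"
    then have "angle (\<gamma> j) (\<gamma> i) \<le> 0" for i
      using angle_le_iff[of "\<gamma> j" "\<gamma> i" 0] by (simp add: angle_0)
    then have "(\<Sum>i\<in>nbs Q j. angle (\<gamma> j) (\<gamma> i)) \<le> 0" by (intro sum_nonpos) auto
    with eq val show False by simp
  qed
  show "\<gamma> j < 2 * ellK k"
  proof (rule ccontr)
    assume "\<not> \<gamma> j < 2 * ellK k"
    then have "pi \<le> angle (\<gamma> j) (\<gamma> i)" for i
      using angle_le_iff[of "2 * ellK k" "\<gamma> i" "\<gamma> j"] by (simp add: angle_2K)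
    then have "(\<Sum>i\<in>nbs Q j. pi) \<le> (\<Sum>i\<in>nbs Q j. angle (\<gamma> j) (\<gamma> i))" by (intro sum_mono) auto
    with eq val show False by (simp add: valence_def mult.commute)
  qed
qed

lemma cone_angle_eq:
  assumes ring: "\<forall>j\<in>G Q. ring_of k (\<gamma> j) (r j) (R j)" and j: "j \<in> G Q" and r: "r j \<noteq> 0"
  shows "cone_angle Q r R j =
    (\<Sum>i\<in>nbs Q j. angle (\<gamma> j) (\<gamma> i)) - (if 0 < r j then 0 else pi * valence Q j)"
proof -
  have "cone_angle Q r R j = (\<Sum>i\<in>nbs Q j. angle (\<gamma> j) (\<gamma> i) - (if 0 < r j then 0 else pi))"
    unfolding cone_angle_def
  proof (rule sum.cong)
    fix i assume "i \<in> nbs Q j"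
    then have "i \<in> G Q" by (simp add: nbs_def nb_in_G)
    then show "opening_angle (r j) (R j) (r i) (R i) = angle (\<gamma> j) (\<gamma> i) - (if 0 < r j then 0 else pi)"
      using ring j r opening_angle_eq[of "\<gamma> j" "r j" "R j" "\<gamma> i" "r i" "R i"] by simp
  qed simp
  also have "\<dots> = (\<Sum>i\<in>nbs Q j. angle (\<gamma> j) (\<gamma> i)) - (\<Sum>i\<in>nbs Q j. if 0 < r j then 0 else pi)"
    by (rule sum_subtractf)
  finally show ?thesis by (simp add: valence_def mult.commute)
qed

end

section \<open>Plane hyperbolic geometry\<close>

text \<open>The basic identity behind the metric: it turns \<open>1 - |hdir x z|\<^sup>2\<close> into a product.\<close>

lemma norm_hdir_identity:
  "(norm (z - x))\<^sup>2 + (1 - (norm x)\<^sup>2) * (1 - (norm z)\<^sup>2) = (norm (1 - cnj x * z))\<^sup>2"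
  by (simp only: cmod_power2) (simp add: power2_eq_square algebra_simps)

lemma one_minus_norm_sq_pos: "z \<in> ball 0 1 \<Longrightarrow> 0 < 1 - (norm (z::complex))\<^sup>2"
  by (simp add: abs_square_less_1)

lemma hdir_denom_nonzero:
  assumes "x \<in> ball 0 1" "z \<in> ball 0 1"
  shows "1 - cnj x * z \<noteq> 0"
proof -
  have "0 < (1 - (norm x)\<^sup>2) * (1 - (norm z)\<^sup>2)"
    using assms by (intro mult_pos_pos one_minus_norm_sq_pos)
  then have "0 < (norm (1 - cnj x * z))\<^sup>2"
    using norm_hdir_identity[of z x] zero_le_power2[of "norm (z - x)"] by linarith
  then show ?thesis by auto
qed

lemma one_minus_norm_hdir_sq:
  assumes "x \<in> ball 0 1" "z \<in> ball 0 1"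
  shows "1 - (norm (hdir x z))\<^sup>2 = (1 - (norm x)\<^sup>2) * (1 - (norm z)\<^sup>2) / (norm (1 - cnj x * z))\<^sup>2"
  using hdir_denom_nonzero[OF assms] norm_hdir_identity[of z x]
  by (simp add: hdir_def norm_divide power_divide field_simps)

lemma hdir_in_ball:
  assumes "x \<in> ball 0 1" "z \<in> ball 0 1"
  shows "hdir x z \<in> ball 0 1"
proof -
  have "0 < 1 - (norm (hdir x z))\<^sup>2"
    unfolding one_minus_norm_hdir_sq[OF assms] using hdir_denom_nonzero[OF assms] assms
    by (intro divide_pos_pos mult_pos_pos one_minus_norm_sq_pos) auto
  then show ?thesis by (simp add: abs_square_less_1)
qed

lemma hdir_0_left [simp]: "hdir 0 z = z"
  by (simp add: hdir_def)

lemma hdir_self [simp]: "hdir x x = 0"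
  by (simp add: hdir_def)

lemma hdist_arg_ge_1:
  fixes x z :: complex
  assumes "x \<in> ball 0 1" "z \<in> ball 0 1"
  shows "1 \<le> 1 + 2 * (norm (x - z))\<^sup>2 / ((1 - (norm x)\<^sup>2) * (1 - (norm z)\<^sup>2))"
proof -
  have "0 < (1 - (norm x)\<^sup>2) * (1 - (norm z)\<^sup>2)"
    using assms by (intro mult_pos_pos one_minus_norm_sq_pos)
  then have "0 \<le> 2 * (norm (x - z))\<^sup>2 / ((1 - (norm x)\<^sup>2) * (1 - (norm z)\<^sup>2))"
    by (intro divide_nonneg_pos) auto
  then show ?thesis by simp
qed

lemma cosh_hdist:
  assumes "x \<in> ball 0 1" "z \<in> ball 0 1"
  shows "cosh (hdist x z) = 1 + 2 * (norm (x - z))\<^sup>2 / ((1 - (norm x)\<^sup>2) * (1 - (norm z)\<^sup>2))"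
  unfolding hdist_def using hdist_arg_ge_1[OF assms] by (rule cosh_arcosh_real)

lemma hdist_nonneg:
  assumes "x \<in> ball 0 1" "z \<in> ball 0 1"
  shows "0 \<le> hdist x z"
  unfolding hdist_def using hdist_arg_ge_1[OF assms] by (rule arcosh_nonneg_real)

lemma cosh_hdist_hdir:
  assumes "x \<in> ball 0 1" "z \<in> ball 0 1"
  shows "cosh (hdist x z) = (1 + (norm (hdir x z))\<^sup>2) / (1 - (norm (hdir x z))\<^sup>2)"
proof -
  define D where "D = (norm (1 - cnj x * z))\<^sup>2"
  define P where "P = (1 - (norm x)\<^sup>2) * (1 - (norm z)\<^sup>2)"
  have D: "0 < D" using hdir_denom_nonzero[OF assms] by (simp add: D_def)
  have P: "0 < P" unfolding P_def using assms by (intro mult_pos_pos one_minus_norm_sq_pos)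
  have n: "(norm (hdir x z))\<^sup>2 = 1 - P / D"
    using one_minus_norm_hdir_sq[OF assms] by (simp add: D_def P_def)
  have "(norm (x - z))\<^sup>2 = D - P"
    using norm_hdir_identity[of z x] by (simp add: D_def P_def norm_minus_commute)
  then have "cosh (hdist x z) = 1 + 2 * (D - P) / P"
    using cosh_hdist[OF assms] by (simp add: P_def)
  also have "\<dots> = (2 - P / D) / (P / D)"
    using D P by (simp add: field_simps)
  finally show ?thesis by (simp add: n)
qed

lemma cosh_double_tanh: "cosh a = (1 + (tanh (a / 2))\<^sup>2) / (1 - (tanh (a / 2))\<^sup>2)" for a :: real
proof -
  have "cosh a = (cosh (a / 2))\<^sup>2 + (sinh (a / 2))\<^sup>2"
    using cosh_double[of "a / 2"] by simp
  moreover have "(cosh (a / 2))\<^sup>2 - (sinh (a / 2))\<^sup>2 = 1"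
    by (rule hyperbolic_pythagoras)
  moreover have "(1 + (tanh (a / 2))\<^sup>2) / (1 - (tanh (a / 2))\<^sup>2) =
      (((cosh (a / 2))\<^sup>2 + (sinh (a / 2))\<^sup>2) / (cosh (a / 2))\<^sup>2) / (((cosh (a / 2))\<^sup>2 - (sinh (a / 2))\<^sup>2) / (cosh (a / 2))\<^sup>2)"
    by (simp add: tanh_def power_divide add_divide_distrib diff_divide_distrib)
  ultimately show ?thesis by simp
qed

lemma hdist_eq_abs_iff:
  assumes "x \<in> ball 0 1" "z \<in> ball 0 1"
  shows "hdist x z = \<bar>a\<bar> \<longleftrightarrow> norm (hdir x z) = \<bar>tanh (a / 2)\<bar>"
proof -
  have t: "(tanh (a / 2))\<^sup>2 < 1"
    using tanh_real_bounds[of "a / 2"] by (simp add: abs_square_less_1 abs_less_iff)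
  have n: "(norm (hdir x z))\<^sup>2 < 1"
    using one_minus_norm_sq_pos[OF hdir_in_ball[OF assms]] by simp
  have inj: "(1 + u) / (1 - u) = (1 + v) / (1 - v) \<longleftrightarrow> u = v" if "u < 1" "v < 1" for u v :: real
    using that by (auto simp: field_simps)
  have "hdist x z = \<bar>a\<bar> \<longleftrightarrow> cosh (hdist x z) = cosh \<bar>a\<bar>"
    using cosh_real_nonneg_less_iff hdist_nonneg[OF assms]
    by (metis abs_ge_zero linorder_neq_iff)
  also have "cosh \<bar>a\<bar> = cosh a" by (simp add: abs_if)
  also have "cosh (hdist x z) = cosh a \<longleftrightarrow> (norm (hdir x z))\<^sup>2 = (tanh (a / 2))\<^sup>2"
    unfolding cosh_hdist_hdir[OF assms] cosh_double_tanh[of a] using inj[OF n t] .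
  also have "\<dots> \<longleftrightarrow> norm (hdir x z) = \<bar>tanh (a / 2)\<bar>"
    by (metis abs_norm_cancel power2_abs power2_eq_iff_nonneg abs_ge_zero norm_ge_zero)
  finally show ?thesis .
qed

lemma hcircle_iff:
  assumes "p \<in> ball 0 1" "x \<in> ball 0 1"
  shows "x \<in> hcircle p a \<longleftrightarrow> norm (hdir p x) = \<bar>tanh (a / 2)\<bar>"
  using assms hdist_eq_abs_iff[OF assms] by (simp add: hcircle_def)

text \<open>The map \<open>hdir p\<close> is an isometry, so it changes directions at \<open>x\<close> by a rotation.\<close>

lemma hdir_hdir:
  assumes "p \<in> ball 0 1" "x \<in> ball 0 1" "z \<in> ball 0 1"
  shows "hdir (hdir p x) (hdir p z) = (1 - p * cnj x) / (1 - cnj p * x) * hdir x z"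
proof -
  have nz: "1 - cnj p * x \<noteq> 0" "1 - cnj p * z \<noteq> 0" "1 - cnj x * z \<noteq> 0" "1 - p * cnj x \<noteq> 0"
    using hdir_denom_nonzero assms by (auto simp: mult.commute)
  have pp: "1 - p * cnj p \<noteq> 0"
    using hdir_denom_nonzero[OF assms(1,1)] by (simp add: mult.commute)
  have 1: "hdir p z - hdir p x = (z - x) * (1 - p * cnj p) / ((1 - cnj p * z) * (1 - cnj p * x))"
    unfolding hdir_def using nz by (simp add: field_simps)
  have 2: "1 - cnj (hdir p x) * hdir p z = (1 - cnj x * z) * (1 - p * cnj p) / ((1 - p * cnj x) * (1 - cnj p * z))"
  proof -
    have "1 - a / b * (c / d) = (b * d - a * c) / (b * d)" if "b \<noteq> 0" "d \<noteq> 0" for a b c d :: complex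
      using that by (simp add: field_simps)
    moreover have "(1 - p * cnj x) * (1 - cnj p * z) - (cnj x - cnj p) * (z - p) = (1 - cnj x * z) * (1 - p * cnj p)"
      by (simp add: algebra_simps)
    ultimately show ?thesis
      using nz by (simp add: hdir_def)
  qed
  show ?thesis
    unfolding hdir_def[of "hdir p x" "hdir p z"] 1 2 hdir_def[of x z]
  proof -
    have "(a * k / (d1 * d2)) / (b * k / (d3 * d1)) = d3 / d2 * (a / b)"
      if "k \<noteq> 0" "d1 \<noteq> 0" "d2 \<noteq> 0" "d3 \<noteq> 0" "b \<noteq> 0" for a b k d1 d2 d3 :: complex
      using that by (simp add: field_simps)
    then show "(z - x) * (1 - p * cnj p) / ((1 - cnj p * z) * (1 - cnj p * x)) /
        ((1 - cnj x * z) * (1 - p * cnj p) / ((1 - p * cnj x) * (1 - cnj p * z))) =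
        (1 - p * cnj x) / (1 - cnj p * x) * ((z - x) / (1 - cnj x * z))"
      using nz pp by blast
  qed
qed

lemma norm_rotation_factor: "norm ((1 - p * cnj x) / (1 - cnj p * x)) = 1"
  if "p \<in> ball 0 1" "x \<in> ball 0 1"
proof -
  have "1 - p * cnj x = cnj (1 - cnj p * x)" by simp
  then have "norm (1 - p * cnj x) = norm (1 - cnj p * x)"
    by (metis complex_mod_cnj)
  then show ?thesis
    using hdir_denom_nonzero[OF that] by (simp add: norm_divide)
qed

lemma hdist_commute: "hdist x z = hdist z x"
  by (simp add: hdist_def norm_minus_commute mult.commute)

lemma Re_cnj_mult: "Re (cnj x * y) = x \<bullet> y"
  by (simp add: inner_complex_def)

lemma law_of_cosines:
  assumes "p \<in> ball 0 1" "x \<in> ball 0 1" "z \<in> ball 0 1"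
  shows "cosh (hdist x z) = cosh (hdist p x) * cosh (hdist p z)
    - sinh (hdist p x) * sinh (hdist p z) * (sgn (hdir p x) \<bullet> sgn (hdir p z))"
proof -
  define X Z where "X = hdir p x" and "Z = hdir p z"
  have XZ: "X \<in> ball 0 1" "Z \<in> ball 0 1"
    using hdir_in_ball[OF assms(1,2)] hdir_in_ball[OF assms(1,3)] by (simp_all only: X_def Z_def)
  define a b where "a = norm X" and "b = norm Z"
  have ab: "0 < 1 - a\<^sup>2" "0 < 1 - b\<^sup>2"
    using XZ one_minus_norm_sq_pos by (auto simp: a_def b_def)
  have sinh: "sinh (hdist p y) = 2 * norm (hdir p y) / (1 - (norm (hdir p y))\<^sup>2)" if "y \<in> ball 0 1" for y
  proof -
    let ?n = "norm (hdir p y)"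
    have n: "0 < 1 - ?n\<^sup>2" using one_minus_norm_sq_pos hdir_in_ball assms(1) that by blast
    have "((1 + m) / (1 - m))\<^sup>2 - 1 = 4 * m / (1 - m)\<^sup>2" if "1 - m \<noteq> 0" for m :: real
    proof -
      have "((1 + m) / (1 - m))\<^sup>2 - 1 = ((1 + m)\<^sup>2 - (1 - m)\<^sup>2) / (1 - m)\<^sup>2"
        using that by (simp add: power_divide diff_divide_distrib)
      also have "(1 + m)\<^sup>2 - (1 - m)\<^sup>2 = 4 * m" by (simp add: power2_eq_square algebra_simps)
      finally show ?thesis .
    qed
    then have "(sinh (hdist p y))\<^sup>2 = (2 * ?n / (1 - ?n\<^sup>2))\<^sup>2"
      unfolding sinh_square_eq cosh_hdist_hdir[OF assms(1) that] using n
      by (simp add: power_divide power_mult_distrib)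
    then show ?thesis
      using hdist_nonneg[OF assms(1) that] n by (simp add: power2_eq_iff_nonneg)
  qed
  have "norm (hdir X Z) = norm (hdir x z)"
    unfolding X_def Z_def hdir_hdir[OF assms] norm_mult norm_rotation_factor[OF assms(1,2)] by simp
  then have "cosh (hdist x z) = cosh (hdist X Z)"
    by (simp only: cosh_hdist_hdir[OF assms(2,3)] cosh_hdist_hdir[OF XZ])
  also have "\<dots> = 1 + 2 * (a\<^sup>2 + b\<^sup>2 - 2 * (X \<bullet> Z)) / ((1 - a\<^sup>2) * (1 - b\<^sup>2))"
    unfolding cosh_hdist[OF XZ] a_def b_def
    by (simp add: power2_norm_eq_inner inner_diff_left inner_diff_right inner_commute)
  also have "\<dots> = (1 + a\<^sup>2) / (1 - a\<^sup>2) * ((1 + b\<^sup>2) / (1 - b\<^sup>2)) - 4 * (X \<bullet> Z) / ((1 - a\<^sup>2) * (1 - b\<^sup>2))"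
  proof -
    have "1 + 2 * (A + B - 2 * i) / ((1 - A) * (1 - B)) = (1 + A) / (1 - A) * ((1 + B) / (1 - B)) - 4 * i / ((1 - A) * (1 - B))"
      if "0 < 1 - A" "0 < 1 - B" for A B i :: real
    proof -
      let ?D = "(1 - A) * (1 - B)"
      have "1 + 2 * (A + B - 2 * i) / ?D = (?D + 2 * (A + B - 2 * i)) / ?D"
        using that by (simp add: add_divide_distrib)
      also have "?D + 2 * (A + B - 2 * i) = (1 + A) * (1 + B) - 4 * i"
        by (simp add: algebra_simps)
      finally show ?thesis by (simp add: diff_divide_distrib)
    qed
    then show ?thesis using ab by blast
  qed
  also have "4 * (X \<bullet> Z) / ((1 - a\<^sup>2) * (1 - b\<^sup>2)) = 2 * a / (1 - a\<^sup>2) * (2 * b / (1 - b\<^sup>2)) * (sgn X \<bullet> sgn Z)"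
  proof -
    have "X \<bullet> Z = a * b * (sgn X \<bullet> sgn Z)"
      by (cases "X = 0 \<or> Z = 0") (auto simp: a_def b_def sgn_div_norm field_simps)
    then show ?thesis by simp
  qed
  finally show ?thesis
    by (simp only: cosh_hdist_hdir[OF assms(1,2)] cosh_hdist_hdir[OF assms(1,3)]
        sinh[OF assms(2)] sinh[OF assms(3)] X_def Z_def a_def b_def)
qed

text \<open>Looking from \<open>b\<close> to \<open>a\<close> instead of from \<open>a\<close> to \<open>b\<close> interchanges left and right. After moving
  \<open>a\<close> to the origin, this is a computation with \<open>B = hdir a b\<close> and \<open>C = hdir a c\<close>.\<close>

lemma orientation_swap:
  assumes "a \<in> ball 0 1" "b \<in> ball 0 1" "c \<in> ball 0 1"
  shows "sgn (Im (cnj (hdir b a) * hdir b c)) = - sgn (Im (cnj (hdir a b) * hdir a c))"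
proof -
  define B C where "B = hdir a b" and "C = hdir a c"
  have B: "B \<in> ball 0 1" and C: "C \<in> ball 0 1"
    using hdir_in_ball[OF assms(1,2)] hdir_in_ball[OF assms(1,3)] by (simp_all only: B_def C_def)
  define u where "u = (1 - a * cnj b) / (1 - cnj a * b)"
  have u: "cnj u * u = 1"
    using norm_rotation_factor[OF assms(1,2)] unfolding u_def
    by (metis complex_norm_square mult.commute of_real_1 one_power2)
  have 1: "hdir B (hdir a a) = u * hdir b a" "hdir B C = u * hdir b c"
    using hdir_hdir[OF assms(1,2,1)] hdir_hdir[OF assms] by (simp_all add: B_def C_def u_def)
  have "cnj (hdir b a) * hdir b c = (cnj u * u) * (cnj (hdir b a) * hdir b c)" by (simp add: u)
  also have "\<dots> = cnj (hdir B 0) * hdir B C"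
    using 1 by (simp add: mult_ac)
  also have "\<dots> = ((norm B)\<^sup>2 - cnj B * C) / (1 - cnj B * C)"
  proof -
    have "complex_of_real ((norm B)\<^sup>2) = B * cnj B" by (rule complex_norm_square)
    then show ?thesis by (simp add: hdir_def right_diff_distrib mult.commute del: of_real_power)
  qed
  also have "\<dots> = (((norm B)\<^sup>2 - cnj B * C) * cnj (1 - cnj B * C)) / of_real ((norm (1 - cnj B * C))\<^sup>2)"
    by (rule complex_div_cnj)
  finally have 2: "Im (cnj (hdir b a) * hdir b c) = Im (((norm B)\<^sup>2 - cnj B * C) * cnj (1 - cnj B * C)) / (norm (1 - cnj B * C))\<^sup>2"
    by (simp only: Im_divide_of_real)
  define m where "m = cnj B * C"
  have 3: "Im (((norm B)\<^sup>2 - m) * cnj (1 - m)) = - ((1 - (norm B)\<^sup>2) * Im m)"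
    by (simp add: algebra_simps)
  have "0 < (1 - (norm B)\<^sup>2) / (norm (1 - m))\<^sup>2"
    using one_minus_norm_sq_pos[OF B] hdir_denom_nonzero[OF B C] by (simp add: m_def)
  moreover have "Im (cnj (hdir b a) * hdir b c) = - ((1 - (norm B)\<^sup>2) / (norm (1 - m))\<^sup>2 * Im m)"
    unfolding 2 m_def[symmetric] 3 by simp
  moreover have "sgn (- (k * t)) = - sgn t" if "0 < k" for k t :: real
    using that by (simp add: sgn_mult sgn_minus)
  ultimately have "sgn (Im (cnj (hdir b a) * hdir b c)) = - sgn (Im m)"
    by (simp only:)
  then show ?thesis by (simp only: m_def B_def C_def)
qed

text \<open>By \<open>pyth\<close>, the triangle \<open>p x z\<close> has a right angle at \<open>x\<close>; the number \<open>y\<close> is its oriented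
  angle at \<open>p\<close>. The law of cosines gives the real part, and the imaginary part then follows up to
  sign.\<close>

lemma right_triangle_direction:
  assumes "p \<in> ball 0 1" "x \<in> ball 0 1" "z \<in> ball 0 1" "x \<noteq> p"
    and pyth: "cosh (hdist p z) = cosh (hdist p x) * cosh (hdist x z)"
  defines "y \<equiv> cnj (sgn (hdir p z)) * sgn (hdir p x)"
  shows "Re y = cosh (hdist x z) * sinh (hdist p x) / sinh (hdist p z)"
    and "\<bar>Im y\<bar> = sinh (hdist x z) / sinh (hdist p z)"
    and "0 < sinh (hdist p z)" "norm y = 1"
proof -
  let ?a = "hdist p x" and ?b = "hdist x z" and ?c = "hdist p z"
  have nn: "0 \<le> ?a" "0 \<le> ?b" "0 \<le> ?c" using assms hdist_nonneg by auto
  have px: "hdir p x \<noteq> 0" using \<open>x \<noteq> p\<close> hdir_denom_nonzero[OF assms(1,2)] by (simp add: hdir_def)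
  have "?a \<noteq> 0"
    using hdist_eq_abs_iff[OF assms(1,2), of 0] px by simp
  then have a: "0 < ?a" using nn by simp
  have "1 < cosh ?a" using cosh_real_nonneg_less_iff[of 0 ?a] a by simp
  also have "cosh ?a \<le> cosh ?a * cosh ?b" using cosh_real_ge_1[of ?b] cosh_real_pos[of ?a] by simp
  finally have "1 < cosh ?c" using pyth by simp
  then have c: "0 < ?c" using nn by (metis cosh_0 less_irrefl order_le_less)
  then show s: "0 < sinh ?c" by simp
  have "hdir p z \<noteq> 0"
    using hdist_eq_abs_iff[OF assms(1,3), of 0] c by auto
  then show norm_y: "norm y = 1" using px by (simp add: y_def norm_mult norm_sgn)
  have sa: "0 < sinh ?a" using a by simp
  have "cosh ?b = cosh ?a * cosh ?c - sinh ?a * sinh ?c * Re y"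
    using law_of_cosines[OF assms(1,2,3)]
    unfolding y_def Re_cnj_mult inner_commute[of "sgn (hdir p z)"] .
  then have "sinh ?a * (sinh ?c * Re y) = cosh ?b * ((cosh ?a)\<^sup>2 - 1)"
    unfolding pyth by (simp add: power2_eq_square algebra_simps)
  also have "(cosh ?a)\<^sup>2 - 1 = (sinh ?a)\<^sup>2" by (simp add: cosh_square_eq)
  finally have "sinh ?c * Re y = cosh ?b * sinh ?a"
    using sa by (simp add: power2_eq_square mult.left_commute)
  then show re: "Re y = cosh ?b * sinh ?a / sinh ?c"
    using s by (simp add: field_simps)
  have "(Re y)\<^sup>2 + (Im y)\<^sup>2 = 1"
    using norm_y by (metis cmod_power2 one_power2)
  then have "(sinh ?c * Im y)\<^sup>2 = (sinh ?c)\<^sup>2 - (cosh ?b * sinh ?a)\<^sup>2"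
    using re s by (simp add: power_mult_distrib power_divide field_simps)
  also have "\<dots> = (sinh ?b)\<^sup>2"
    unfolding power_mult_distrib sinh_square_eq pyth by (simp add: algebra_simps)
  finally have "\<bar>sinh ?c * Im y\<bar> = \<bar>sinh ?b\<bar>" by (simp add: power2_eq_iff abs_eq_iff)
  then show "\<bar>Im y\<bar> = sinh ?b / sinh ?c"
    using s nn by (simp add: abs_mult field_simps)
qed

section \<open>Isometries of the disc\<close>

text \<open>The orientation preserving isometries, described by their effect on directions: at each
  point these are rotated. In this form the closure under composition is immediate.\<close>

definition disc_iso :: "(complex \<Rightarrow> complex) \<Rightarrow> bool" where
  "disc_iso h \<longleftrightarrow> (\<forall>x\<in>ball 0 1. h x \<in> ball 0 1 \<and>
     (\<exists>u. norm u = 1 \<and> (\<forall>z\<in>ball 0 1. hdir (h x) (h z) = u * hdir x z)))"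

lemma disc_iso_id: "disc_iso id"
  by (auto simp: disc_iso_def intro!: exI[of _ 1])

lemma disc_iso_comp:
  assumes "disc_iso h" "disc_iso h'"
  shows "disc_iso (h \<circ> h')"
  unfolding disc_iso_def
proof (intro ballI conjI)
  fix x :: complex assume x: "x \<in> ball 0 1"
  obtain u where u: "norm u = 1" "\<forall>z\<in>ball 0 1. hdir (h' x) (h' z) = u * hdir x z" and x': "h' x \<in> ball 0 1"
    using assms(2) x unfolding disc_iso_def by blast
  obtain v where v: "norm v = 1" "\<forall>z\<in>ball 0 1. hdir (h (h' x)) (h z) = v * hdir (h' x) z" and x'': "h (h' x) \<in> ball 0 1"
    using assms(1) x' unfolding disc_iso_def by blast
  show "(h \<circ> h') x \<in> ball 0 1" using x'' by simp
  have "\<forall>z\<in>ball 0 1. hdir ((h \<circ> h') x) ((h \<circ> h') z) = v * u * hdir x z"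
    using u v assms(2) unfolding disc_iso_def by (metis comp_apply mult.assoc)
  then show "\<exists>u. norm u = 1 \<and> (\<forall>z\<in>ball 0 1. hdir ((h \<circ> h') x) ((h \<circ> h') z) = u * hdir x z)"
    using u v by (intro exI[of _ "v * u"]) (simp add: norm_mult)
qed

lemma disc_iso_in_ball: "disc_iso h \<Longrightarrow> z \<in> ball 0 1 \<Longrightarrow> h z \<in> ball 0 1"
  unfolding disc_iso_def by blast

lemma disc_iso_norm_hdir:
  "disc_iso h \<Longrightarrow> x \<in> ball 0 1 \<Longrightarrow> z \<in> ball 0 1 \<Longrightarrow> norm (hdir (h x) (h z)) = norm (hdir x z)"
  unfolding disc_iso_def by (metis mult_1 norm_mult)

lemma disc_iso_cnj_hdir_mult:
  assumes "disc_iso h" "x \<in> ball 0 1" "y \<in> ball 0 1" "z \<in> ball 0 1"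
  shows "cnj (hdir (h x) (h y)) * hdir (h x) (h z) = cnj (hdir x y) * hdir x z"
proof -
  obtain u where u: "norm u = 1" "\<forall>z\<in>ball 0 1. hdir (h x) (h z) = u * hdir x z"
    using assms unfolding disc_iso_def by blast
  have "cnj u * u = 1"
    using u(1) by (metis complex_norm_square mult.commute of_real_1 one_power2)
  then show ?thesis using u(2) assms(3,4) by (simp add: mult_ac)
qed

text \<open>The points outside of the disc are fixed, so that identities between isometries of the disc
  are identities between functions.\<close>

definition disc_rot :: "complex \<Rightarrow> complex \<Rightarrow> complex" where
  "disc_rot u z = (if norm z < 1 then u * z else z)"

definition disc_trans :: "real \<Rightarrow> complex \<Rightarrow> complex" where
  "disc_trans t z = (if norm z < 1 then hdir (- of_real t) z else z)"

lemma disc_iso_rot: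
  assumes "norm u = 1"
  shows "disc_iso (disc_rot u)"
proof -
  have "cnj u * u = 1"
    using assms by (metis complex_norm_square mult.commute of_real_1 one_power2)
  then have "hdir (u * x) (u * z) = u * hdir x z" for x z
    by (simp add: hdir_def right_diff_distrib)
  then show ?thesis
    using assms unfolding disc_iso_def by (auto simp: disc_rot_def norm_mult intro!: exI[of _ u])
qed

lemma disc_iso_trans:
  assumes "\<bar>t\<bar> < 1"
  shows "disc_iso (disc_trans t)"
proof -
  have t: "- complex_of_real t \<in> ball 0 1" using assms by simp
  show ?thesis
    unfolding disc_iso_def
  proof (intro ballI conjI)
    fix x :: complex assume x: "x \<in> ball 0 1"
    show "disc_trans t x \<in> ball 0 1"
      using hdir_in_ball[OF t x] x by (simp add: disc_trans_def)
    show "\<exists>u. norm u = 1 \<and> (\<forall>z\<in>ball 0 1. hdir (disc_trans t x) (disc_trans t z) = u * hdir x z)"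
      using hdir_hdir[OF t x] norm_rotation_factor[OF t x] x
      by (intro exI[of _ "(1 - - complex_of_real t * cnj x) / (1 - cnj (- complex_of_real t) * x)"])
         (simp add: disc_trans_def)
  qed
qed

lemma disc_rot_rot: "norm v = 1 \<Longrightarrow> disc_rot u \<circ> disc_rot v = disc_rot (u * v)"
  by (auto simp: disc_rot_def norm_mult fun_eq_iff)

lemma disc_rot_1 [simp]: "disc_rot 1 = id"
  by (auto simp: disc_rot_def fun_eq_iff)

lemma disc_trans_minus:
  assumes "\<bar>t\<bar> < 1"
  shows "disc_trans t \<circ> disc_trans (- t) = id"
proof
  fix z
  show "(disc_trans t \<circ> disc_trans (- t)) z = id z"
  proof (cases "norm z < 1")
    case True
    have t: "complex_of_real t \<in> ball 0 1" using assms by simp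
    have "hdir (complex_of_real t) z \<in> ball 0 1" using hdir_in_ball[OF t] True by simp
    moreover have "1 - complex_of_real t * z \<noteq> 0" "1 - complex_of_real t * t \<noteq> 0"
      using hdir_denom_nonzero[OF t, of z] hdir_denom_nonzero[OF t t] True by simp_all
    moreover define w where "w = 1 - of_real t * z"
    ultimately have w: "w \<noteq> 0" and t2: "1 - complex_of_real t * t \<noteq> 0" and b: "hdir (of_real t) z \<in> ball 0 1"
      by auto
    have "hdir (of_real t) z + of_real t = (z * (1 - of_real t * of_real t)) / w"
      using w by (simp add: hdir_def w_def field_simps)
    moreover have "1 + of_real t * hdir (of_real t) z = (1 - of_real t * of_real t) / w"
      using w by (simp add: hdir_def w_def field_simps)
    ultimately have "hdir (- of_real t) (hdir (of_real t) z) = z"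
      using w t2 by (simp add: hdir_def[of "- of_real t"])
    then show ?thesis using True b
      by (simp add: disc_trans_def)
  qed (simp add: disc_trans_def)
qed

section \<open>Flat connections over simply connected sets\<close>

text \<open>Parallel transport along the first \<open>i\<close> of \<open>N\<close> equal steps of the path \<open>p\<close>.\<close>

fun transport :: "('a \<Rightarrow> 'a \<Rightarrow> 'b \<Rightarrow> 'b) \<Rightarrow> (real \<Rightarrow> 'a) \<Rightarrow> nat \<Rightarrow> nat \<Rightarrow> 'b \<Rightarrow> 'b" where
  "transport \<tau> p N 0 = id"
| "transport \<tau> p N (Suc i) = transport \<tau> p N i \<circ> \<tau> (p (real i / real N)) (p (real (Suc i) / real N))"

text \<open>The local data of a flat connection with a discrete structure group, given by the transport
  between points of distance less than \<open>\<delta>\<close>. Taking \<open>z = x\<close> shows that the maps are invertible.\<close>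

definition local_cocycle :: "'a::metric_space set \<Rightarrow> real \<Rightarrow> ('a \<Rightarrow> 'a \<Rightarrow> 'b \<Rightarrow> 'b) \<Rightarrow> bool" where
  "local_cocycle S \<delta> \<tau> \<longleftrightarrow> 0 < \<delta> \<and> (\<forall>x\<in>S. \<tau> x x = id) \<and>
     (\<forall>x\<in>S. \<forall>y\<in>S. \<forall>z\<in>S. dist x y < \<delta> \<longrightarrow> dist y z < \<delta> \<longrightarrow> dist x z < \<delta> \<longrightarrow>
        \<tau> x y \<circ> \<tau> y z = \<tau> x z)"

lemma transport_const:
  assumes "local_cocycle S \<delta> \<tau>" "c \<in> S"
  shows "transport \<tau> (\<lambda>_. c) N i = id"
  using assms by (induction i) (auto simp: local_cocycle_def)

lemma local_cocycle_pullback: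
  fixes T :: "'c::metric_space set"
  assumes "local_cocycle S \<delta> \<tau>" "compact T" "continuous_on T k" "k ` T \<subseteq> S"
  obtains \<epsilon> where "local_cocycle T \<epsilon> (\<lambda>x y. \<tau> (k x) (k y))"
proof -
  have "uniformly_continuous_on T k"
    using assms compact_uniformly_continuous by blast
  then obtain \<epsilon> where \<epsilon>: "0 < \<epsilon>" "\<And>x y. x \<in> T \<Longrightarrow> y \<in> T \<Longrightarrow> dist x y < \<epsilon> \<Longrightarrow> dist (k x) (k y) < \<delta>"
    using assms(1) unfolding uniformly_continuous_on_def local_cocycle_def by (metis dist_commute)
  have "k x \<in> S" if "x \<in> T" for x using that assms(4) by blast
  then have "local_cocycle T \<epsilon> (\<lambda>x y. \<tau> (k x) (k y))"
    using assms(1) \<epsilon> unfolding local_cocycle_def by simp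
  then show ?thesis ..
qed

text \<open>The trivialization \<open>H x\<close> is the transport along the segment from the origin to \<open>x\<close>, in steps
  so small that the segments to two neighbouring points bound a ladder of small quadrilaterals.\<close>

lemma convex_local_cocycle_trivial:
  fixes T :: "'c::real_normed_vector set"
  assumes cocycle: "local_cocycle T \<delta> \<tau>" and "convex T" "0 \<in> T" and bound: "\<And>x. x \<in> T \<Longrightarrow> norm x \<le> B"
  obtains H where "H 0 = id" "\<And>x y. x \<in> T \<Longrightarrow> y \<in> T \<Longrightarrow> dist x y < \<delta> / 2 \<Longrightarrow> H x \<circ> \<tau> x y = H y"
proof -
  have \<delta>: "0 < \<delta>" using cocycle by (simp add: local_cocycle_def)
  have coc: "\<tau> x y \<circ> \<tau> y z = \<tau> x z"
    if "x \<in> T" "y \<in> T" "z \<in> T" "dist x y < \<delta>" "dist y z < \<delta>" "dist x z < \<delta>" for x y z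
    using cocycle that by (simp add: local_cocycle_def)
  \<comment> \<open>One number of steps for all segments, each step being shorter than half of \<open>\<delta>\<close>.\<close>
  obtain N :: nat where N: "2 * B / \<delta> < real N" "0 < N"
    by (metis gr0I less_le_trans linear not_less of_nat_0 reals_Archimedean2 zero_less_Suc of_nat_le_iff less_numeral_extra(3))
  have scale: "(real i / real N) *\<^sub>R x \<in> T" if "x \<in> T" "i \<le> N" for x i
  proof -
    have "0 \<le> real i / real N" "real i / real N \<le> 1" using that N by auto
    then show ?thesis
      using convexD[OF \<open>convex T\<close> \<open>0 \<in> T\<close> \<open>x \<in> T\<close>, of "1 - real i / real N" "real i / real N"] by simp
  qed
  have step: "dist ((real i / real N) *\<^sub>R x) ((real (Suc i) / real N) *\<^sub>R x) < \<delta> / 2" if "x \<in> T" for x i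
  proof -
    have "dist ((real i / real N) *\<^sub>R x) ((real (Suc i) / real N) *\<^sub>R x) = norm x / N"
      by (simp add: dist_norm scaleR_left_diff_distrib[symmetric] diff_divide_distrib[symmetric])
    also have "\<dots> \<le> B / N" using bound[OF that] by (simp add: divide_right_mono)
    also have "\<dots> < \<delta> / 2" using N \<delta> by (simp add: field_simps)
    finally show ?thesis .
  qed
  define H where "H x = transport \<tau> (\<lambda>t. t *\<^sub>R x) N N" for x
  have "H 0 = id"
    unfolding H_def using transport_const[OF cocycle \<open>0 \<in> T\<close>] by simp
  moreover have "H x \<circ> \<tau> x y = H y" if xy: "x \<in> T" "y \<in> T" "dist x y < \<delta> / 2" for x y
  proof -
    have "transport \<tau> (\<lambda>t. t *\<^sub>R x) N i \<circ> \<tau> ((real i / real N) *\<^sub>R x) ((real i / real N) *\<^sub>R y)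
        = transport \<tau> (\<lambda>t. t *\<^sub>R y) N i" if "i \<le> N" for i
      using that
    proof (induction i)
      case 0
      then show ?case using cocycle \<open>0 \<in> T\<close> by (simp add: local_cocycle_def)
    next
      case (Suc i)
      let ?x = "\<lambda>i. (real i / real N) *\<^sub>R x" and ?y = "\<lambda>i. (real i / real N) *\<^sub>R y"
      have T: "?x i \<in> T" "?x (Suc i) \<in> T" "?y i \<in> T" "?y (Suc i) \<in> T"
        using scale[OF xy(1), of i] scale[OF xy(1), of "Suc i"] scale[OF xy(2), of i]
          scale[OF xy(2), of "Suc i"] Suc.prems by (simp_all del: of_nat_Suc)
      have close: "dist (?x j) (?y j) < \<delta> / 2" if "j \<le> N" for j
      proof -
        have "dist (?x j) (?y j) = real j / real N * dist x y"
          by (simp add: dist_norm scaleR_right_diff_distrib[symmetric])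
        also have "\<dots> \<le> 1 * dist x y"
          using that N by (intro mult_right_mono) auto
        finally show ?thesis using xy by simp
      qed
      have d: "dist (?x i) (?x (Suc i)) < \<delta> / 2" "dist (?y i) (?y (Suc i)) < \<delta> / 2"
        "dist (?x i) (?y i) < \<delta> / 2" "dist (?x (Suc i)) (?y (Suc i)) < \<delta> / 2"
        using step[OF xy(1), of i] step[OF xy(2), of i] close[of i] close[of "Suc i"] Suc.prems
        by (simp_all del: of_nat_Suc)
      then have d': "dist (?x i) (?y (Suc i)) < \<delta>"
        using dist_triangle[of "?x i" "?y (Suc i)" "?y i"] by linarith
      have 1: "\<tau> (?x i) (?x (Suc i)) \<circ> \<tau> (?x (Suc i)) (?y (Suc i)) = \<tau> (?x i) (?y (Suc i))"
        using d d' \<delta> by (intro coc T) linarith+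
      have 2: "\<tau> (?x i) (?y i) \<circ> \<tau> (?y i) (?y (Suc i)) = \<tau> (?x i) (?y (Suc i))"
        using d d' \<delta> by (intro coc T) linarith+
      have "transport \<tau> (\<lambda>t. t *\<^sub>R x) N (Suc i) \<circ> \<tau> (?x (Suc i)) (?y (Suc i))
          = transport \<tau> (\<lambda>t. t *\<^sub>R x) N i \<circ> (\<tau> (?x i) (?y i) \<circ> \<tau> (?y i) (?y (Suc i)))"
        by (simp only: transport.simps comp_assoc 1 2)
      also have "\<dots> = transport \<tau> (\<lambda>t. t *\<^sub>R y) N (Suc i)"
        using Suc by (simp only: transport.simps comp_assoc[symmetric])
      finally show ?case .
    qed
    from this[of N] show ?thesis using N by (simp add: H_def)
  qed
  ultimately show ?thesis ..
qed

text \<open>Along a path of the parameter domain, transport telescopes to the values of a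
  trivialization.\<close>

lemma transport_telescope:
  assumes H: "\<And>x y. x \<in> T \<Longrightarrow> y \<in> T \<Longrightarrow> dist x y < \<epsilon> \<Longrightarrow> H x \<circ> \<tau> (k x) (k y) = H y"
    and c: "\<And>s. s \<in> {0..1} \<Longrightarrow> c s \<in> T" "\<And>s t. dist (c s) (c t) \<le> \<bar>s - t\<bar>"
    and N: "1 < real N * \<epsilon>" "0 < N" and p: "\<And>s. s \<in> {0..1} \<Longrightarrow> p s = k (c s)"
  shows "H (c 0) \<circ> transport \<tau> p N N = H (c 1)"
proof -
  have "H (c 0) \<circ> transport \<tau> p N i = H (c (real i / real N))" if "i \<le> N" for i
    using that
  proof (induction i)
    case (Suc i)
    let ?a = "real i / real N" and ?b = "real (Suc i) / real N"
    have ab: "?a \<in> {0..1}" "?b \<in> {0..1}" using Suc.prems by (auto simp: divide_le_eq)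
    have "\<bar>?a - ?b\<bar> = 1 / N" by (simp add: diff_divide_distrib[symmetric])
    also have "\<dots> < \<epsilon>" using N by (simp add: field_simps)
    finally have d: "dist (c ?a) (c ?b) < \<epsilon>" using c(2)[of ?a ?b] by linarith
    have "H (c 0) \<circ> transport \<tau> p N (Suc i) = (H (c 0) \<circ> transport \<tau> p N i) \<circ> \<tau> (p ?a) (p ?b)"
      by (simp only: transport.simps comp_assoc)
    also have "\<dots> = H (c ?a) \<circ> \<tau> (k (c ?a)) (k (c ?b))"
      by (simp only: Suc.IH[OF Suc_leD[OF Suc.prems]] p[OF ab(1)] p[OF ab(2)])
    also have "\<dots> = H (c ?b)" by (rule H[OF c(1)[OF ab(1)] c(1)[OF ab(2)] d])
    finally show ?case .
  qed simp
  from this[of N] show ?thesis using N by simp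
qed

text \<open>The transport along a sufficiently fine subdivision; further refinement does not change it.\<close>

definition holonomy :: "('a::real_normed_vector \<Rightarrow> 'a \<Rightarrow> 'b \<Rightarrow> 'b) \<Rightarrow> (real \<Rightarrow> 'a) \<Rightarrow> 'b \<Rightarrow> 'b" where
  "holonomy \<tau> p = (SOME g. eventually (\<lambda>N. transport \<tau> p N N = g) sequentially)"

lemma eventually_large: "0 < \<epsilon> \<Longrightarrow> eventually (\<lambda>N. 1 < real N * \<epsilon> \<and> 0 < N) sequentially"
proof -
  assume \<epsilon>: "0 < \<epsilon>"
  obtain M :: nat where M: "1 / \<epsilon> < real M" using reals_Archimedean2 by blast
  have "1 < real N * \<epsilon> \<and> 0 < N" if "Suc M \<le> N" for N
  proof -
    have "1 / \<epsilon> < real N" using M that by linarith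
    then show ?thesis using \<epsilon> that by (simp add: field_simps)
  qed
  then show ?thesis unfolding eventually_sequentially by blast
qed

lemma transport_eventually_const:
  assumes "local_cocycle S \<delta> \<tau>" "path p" "path_image p \<subseteq> S"
  shows "\<exists>g. eventually (\<lambda>N. transport \<tau> p N N = g) sequentially"
proof -
  obtain \<epsilon> where \<epsilon>: "local_cocycle {0..1} \<epsilon> (\<lambda>x y. \<tau> (p x) (p y))"
    using local_cocycle_pullback[OF assms(1), of "{0..1}" p] assms(2,3)
    by (auto simp: path_def path_image_def)
  obtain H where H: "H 0 = id" "\<And>x y. x \<in> {0..1} \<Longrightarrow> y \<in> {0..1} \<Longrightarrow> dist x y < \<epsilon> / 2 \<Longrightarrow> H x \<circ> \<tau> (p x) (p y) = H y"
    by (rule convex_local_cocycle_trivial[OF \<epsilon>, of 1]) auto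
  have "0 < \<epsilon> / 2" using \<epsilon> by (simp add: local_cocycle_def)
  from eventually_large[OF this] have "eventually (\<lambda>N. transport \<tau> p N N = H 1) sequentially"
  proof eventually_elim
    case (elim N)
    have "H (id 0) \<circ> transport \<tau> p N N = H (id 1)"
      by (rule transport_telescope[where T = "{0..1}" and \<epsilon> = "\<epsilon> / 2" and k = p and H = H]) (use elim H(2) in \<open>auto simp: dist_real_def\<close>)
    then show ?case using H(1) by simp
  qed
  then show ?thesis by blast
qed

lemma holonomy_eventually:
  assumes "local_cocycle S \<delta> \<tau>" "path p" "path_image p \<subseteq> S"
  shows "eventually (\<lambda>N. transport \<tau> p N N = holonomy \<tau> p) sequentially"
  unfolding holonomy_def using someI_ex[OF transport_eventually_const[OF assms]] .

lemma holonomy_eqI: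
  assumes "local_cocycle S \<delta> \<tau>" "path p" "path_image p \<subseteq> S"
    and "eventually (\<lambda>N. transport \<tau> p N N = c) sequentially"
  shows "holonomy \<tau> p = c"
proof -
  have "eventually (\<lambda>N. holonomy \<tau> p = c) sequentially"
    using holonomy_eventually[OF assms(1-3)] assms(4) by eventually_elim simp
  then show ?thesis by simp
qed

text \<open>The homotopy pulls the connection back to the unit square, where it is trivial. The
  transports along the left and right sides, on which the homotopy is constant, are the identity.\<close>

lemma holonomy_homotopic:
  assumes "local_cocycle S \<delta> \<tau>" "homotopic_paths S p q"
  shows "holonomy \<tau> p = holonomy \<tau> q"
proof -
  have pq: "path p" "path q" "path_image p \<subseteq> S" "path_image q \<subseteq> S"
    using homotopic_paths_imp_path homotopic_paths_imp_subset assms(2) by blast+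
  obtain k where k: "continuous_on ({0..1} \<times> {0..1}) k" "k ` ({0..1} \<times> {0..1}) \<subseteq> S"
    "\<forall>t\<in>{0..1}. k (0, t) = p t" "\<forall>t\<in>{0..1}. k (1, t) = q t"
    "\<forall>s\<in>{0..1::real}. pathstart (k \<circ> Pair s) = pathstart p \<and> pathfinish (k \<circ> Pair s) = pathfinish p"
    using assms(2) unfolding homotopic_paths by (auto simp: image_subset_iff_funcset)
  \<comment> \<open>The first coordinate is the parameter of the homotopy, the second one that of the paths.\<close>
  let ?T = "{0..1} \<times> {0..1::real} :: (real \<times> real) set"
  obtain \<epsilon> where \<epsilon>: "local_cocycle ?T \<epsilon> (\<lambda>x y. \<tau> (k x) (k y))"
    using local_cocycle_pullback[OF assms(1) _ k(1,2)] by (auto intro: compact_Times)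
  have bnd: "norm x \<le> 2" if "x \<in> ?T" for x :: "real \<times> real"
    using norm_Pair_le[of "fst x" "snd x"] that by auto
  obtain H where H: "H 0 = id" "\<And>x y. x \<in> ?T \<Longrightarrow> y \<in> ?T \<Longrightarrow> dist x y < \<epsilon> / 2 \<Longrightarrow> H x \<circ> \<tau> (k x) (k y) = H y"
    by (rule convex_local_cocycle_trivial[OF \<epsilon> _ _ bnd]) (auto intro: convex_Times simp: zero_prod_def)
  have \<epsilon>0: "0 < \<epsilon> / 2" using \<epsilon> by (simp add: local_cocycle_def)
  have start: "k (s, 0) = pathstart p" "k (s, 1) = pathfinish p" if "s \<in> {0..1}" for s
    using k(5) that by (auto simp: pathstart_def pathfinish_def)
  have in_S: "pathstart p \<in> S" "pathfinish p \<in> S"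
    using pq by (auto simp: path_image_def pathstart_def pathfinish_def)
  from eventually_large[OF \<epsilon>0]
  have "eventually (\<lambda>N. transport \<tau> p N N = transport \<tau> q N N) sequentially"
  proof eventually_elim
    case (elim N)
    note tel = transport_telescope[where T = ?T and \<epsilon> = "\<epsilon> / 2" and k = k and H = H and \<tau> = \<tau> and N = N, OF H(2)]
    have 1: "H (0, 0) \<circ> transport \<tau> p N N = H (0, 1)"
      using tel[of "\<lambda>t. (0, t)" p] elim k(3) by (simp add: dist_prod_def dist_real_def)
    have 2: "H (1, 0) \<circ> transport \<tau> q N N = H (1, 1)"
      using tel[of "\<lambda>t. (1, t)" q] elim k(4) by (simp add: dist_prod_def dist_real_def)
    have 3: "H (0, 0) \<circ> transport \<tau> (\<lambda>_. pathstart p) N N = H (1, 0)"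
      using tel[of "\<lambda>t. (t, 0)" "\<lambda>_. pathstart p"] elim start by (simp add: dist_prod_def dist_real_def)
    have 4: "H (0, 1) \<circ> transport \<tau> (\<lambda>_. pathfinish p) N N = H (1, 1)"
      using tel[of "\<lambda>t. (t, 1)" "\<lambda>_. pathfinish p"] elim start by (simp add: dist_prod_def dist_real_def)
    have "H (0, 0) = id" using H(1) by (simp add: zero_prod_def)
    then show ?case
      using 1 2 3 4 transport_const[OF assms(1) in_S(1)] transport_const[OF assms(1) in_S(2)] by simp
  qed
  then have "eventually (\<lambda>N. transport \<tau> p N N = holonomy \<tau> q) sequentially"
    using holonomy_eventually[OF assms(1) pq(2,4)] by eventually_elim simp
  then show ?thesis
    by (rule holonomy_eqI[OF assms(1) pq(1,3)])
qed

lemma transport_join: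
  assumes "0 < N" "pathfinish p = pathstart e"
  shows "transport \<tau> (p +++ e) (2 * N) (2 * N) = transport \<tau> p N N \<circ> transport \<tau> e N N"
proof -
  have p: "(p +++ e) (real i / real (2 * N)) = p (real i / real N)" if "i \<le> N" for i
    using that assms(1) by (auto simp: joinpaths_def field_simps)
  have e: "(p +++ e) (real (N + i) / real (2 * N)) = e (real i / real N)" for i
  proof (cases "i = 0")
    case True
    then show ?thesis using assms by (simp add: joinpaths_def pathfinish_def pathstart_def)
  next
    case False
    then show ?thesis using assms(1) by (simp add: joinpaths_def field_simps)
  qed
  have 1: "transport \<tau> (p +++ e) (2 * N) i = transport \<tau> p N i" if "i \<le> N" for i
    using that
  proof (induction i)
    case (Suc i)
    then show ?case using p[of i] p[of "Suc i"] by simp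
  qed simp
  have "transport \<tau> (p +++ e) (2 * N) (N + i) = transport \<tau> p N N \<circ> transport \<tau> e N i" for i
  proof (induction i)
    case 0
    then show ?case using 1 by simp
  next
    case (Suc i)
    have "transport \<tau> (p +++ e) (2 * N) (N + Suc i) = transport \<tau> (p +++ e) (2 * N) (N + i) \<circ>
        \<tau> ((p +++ e) (real (N + i) / real (2 * N))) ((p +++ e) (real (N + Suc i) / real (2 * N)))"
      by (simp only: add_Suc_right transport.simps)
    then show ?case
      unfolding e Suc.IH by (simp only: transport.simps comp_assoc)
  qed
  from this[of N] show ?thesis by (simp add: mult_2)
qed

lemma holonomy_join:
  assumes "local_cocycle S \<delta> \<tau>" "path p" "path_image p \<subseteq> S" "path e" "path_image e \<subseteq> S"
    "pathfinish p = pathstart e"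
  shows "holonomy \<tau> (p +++ e) = holonomy \<tau> p \<circ> holonomy \<tau> e"
proof -
  have j: "path (p +++ e)" "path_image (p +++ e) \<subseteq> S"
    using assms by (auto simp: path_image_join)
  have "filterlim (\<lambda>N::nat. 2 * N) sequentially sequentially"
    by (rule filterlim_subseq) (auto simp: strict_mono_def)
  from eventually_compose_filterlim[OF holonomy_eventually[OF assms(1) j] this]
  have "eventually (\<lambda>N. transport \<tau> (p +++ e) (2 * N) (2 * N) = holonomy \<tau> (p +++ e)) sequentially" .
  then have "eventually (\<lambda>N::nat. holonomy \<tau> (p +++ e) = holonomy \<tau> p \<circ> holonomy \<tau> e) sequentially"
    using holonomy_eventually[OF assms(1-3)] holonomy_eventually[OF assms(1,4,5)] eventually_gt_at_top[of 0]
  proof eventually_elim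
    case (elim N)
    then show ?case using transport_join[OF _ assms(6), of N \<tau>] by simp
  qed
  then show ?thesis by simp
qed

text \<open>The value at \<open>x\<close> is the holonomy along any path from a base point to \<open>x\<close>.\<close>

lemma flat_connection_trivial:
  assumes "local_cocycle S \<delta> \<tau>" "simply_connected S" "S \<noteq> {}"
  obtains h x0 where "\<And>e. path e \<Longrightarrow> path_image e \<subseteq> S \<Longrightarrow> h (pathstart e) \<circ> holonomy \<tau> e = h (pathfinish e)"
    "\<And>x. x \<in> S \<Longrightarrow> \<exists>p. path p \<and> path_image p \<subseteq> S \<and> h x = holonomy \<tau> p"
proof -
  obtain x0 where x0: "x0 \<in> S" using assms(3) by blast
  have "path_connected S" using assms(2) by (rule simply_connected_imp_path_connected)
  then have "\<forall>x\<in>S. \<exists>p. path p \<and> path_image p \<subseteq> S \<and> pathstart p = x0 \<and> pathfinish p = x"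
    using x0 unfolding path_connected_def by blast
  then obtain P where P: "\<And>x. x \<in> S \<Longrightarrow> path (P x) \<and> path_image (P x) \<subseteq> S \<and> pathstart (P x) = x0 \<and> pathfinish (P x) = x"
    by metis
  show ?thesis
  proof (rule that[of "\<lambda>x. holonomy \<tau> (P x)"])
    fix e assume e: "path e" "path_image e \<subseteq> S"
    have x: "pathstart e \<in> S" and y: "pathfinish e \<in> S"
      using e pathstart_in_path_image pathfinish_in_path_image by blast+
    have "holonomy \<tau> (P (pathstart e)) \<circ> holonomy \<tau> e = holonomy \<tau> (P (pathstart e) +++ e)"
      using holonomy_join[OF assms(1)] P[OF x] e by simp
    also have "\<dots> = holonomy \<tau> (P (pathfinish e))"
    proof (rule holonomy_homotopic[OF assms(1)])
      show "homotopic_paths S (P (pathstart e) +++ e) (P (pathfinish e))"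
        using assms(2) P[OF x] P[OF y] e unfolding simply_connected_eq_homotopic_paths
        by (simp add: path_image_join)
    qed
    finally show "holonomy \<tau> (P (pathstart e)) \<circ> holonomy \<tau> e = holonomy \<tau> (P (pathfinish e))" .
  next
    fix x assume "x \<in> S"
    then show "\<exists>p. path p \<and> path_image p \<subseteq> S \<and> holonomy \<tau> (P x) = holonomy \<tau> p"
      using P by blast
  qed
qed


section \<open>Flat connections on the lattice\<close>

definition lattice_point :: "int \<times> int \<Rightarrow> real \<times> real" where
  "lattice_point a = (of_int (fst a), of_int (snd a))"

definition nearest :: "real \<times> real \<Rightarrow> int \<times> int" where
  "nearest x = (\<lfloor>fst x + 1 / 2\<rfloor>, \<lfloor>snd x + 1 / 2\<rfloor>)"

definition cell :: "int \<times> int \<Rightarrow> (real \<times> real) set" where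
  "cell s = cbox (of_int (fst s), of_int (snd s)) (of_int (fst s) + 1, of_int (snd s) + 1)"

lemma cells_eq: "cells Q = (\<Union>s\<in>Q. cell s)"
  by (auto simp: cells_def cell_def)

lemma mem_cell: "x \<in> cell s \<longleftrightarrow>
    of_int (fst s) \<le> fst x \<and> fst x \<le> of_int (fst s) + 1 \<and> of_int (snd s) \<le> snd x \<and> snd x \<le> of_int (snd s) + 1"
  by (cases x) (auto simp: cell_def cbox_Pair_eq)

lemma nearest_lattice_point [simp]: "nearest (lattice_point a) = a"
  by (simp add: nearest_def lattice_point_def)

lemma lattice_point_in_cell: "a \<in> corners s \<Longrightarrow> lattice_point a \<in> cell s"
  by (auto simp: corners_def mem_cell lattice_point_def)

text \<open>Rounding moves a point of a cell to a corner of this cell, and this remains true for all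
  points which are close to the cell.\<close>

lemma nearest_in_corners:
  assumes "x \<in> cell s" "dist x y < 1 / 2"
  shows "nearest y \<in> corners s"
proof -
  have "\<bar>fst x - fst y\<bar> < 1 / 2" "\<bar>snd x - snd y\<bar> < 1 / 2"
    using dist_fst_le[of x y] dist_snd_le[of x y] assms(2) by (simp_all add: dist_real_def)
  moreover have "\<lfloor>v + 1 / 2\<rfloor> \<in> {m, m + 1}"
    if "of_int m \<le> u" "u \<le> of_int m + 1" "\<bar>u - v\<bar> < 1 / 2" for u v :: real and m :: int
  proof -
    have "of_int m \<le> v + 1 / 2" "v + 1 / 2 < of_int m + 2" using that by linarith+
    then have "m \<le> \<lfloor>v + 1 / 2\<rfloor>" "\<lfloor>v + 1 / 2\<rfloor> < m + 2"
      by (simp_all add: le_floor_iff floor_less_iff)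
    then show ?thesis by auto
  qed
  ultimately have "\<lfloor>fst y + 1 / 2\<rfloor> \<in> {fst s, fst s + 1}" "\<lfloor>snd y + 1 / 2\<rfloor> \<in> {snd s, snd s + 1}"
    using assms(1) unfolding mem_cell by blast+
  then show ?thesis
    by (simp only: corners_def nearest_def mem_Times_iff fst_conv snd_conv simp_thms)
qed

text \<open>Rounding to lattice points turns the connection on the vertices into one on the set \<open>cells
  Q\<close>, to which the topological hypothesis applies: any three nearby points are rounded to corners
  of a common square, where the cocycle condition is assumed.\<close>

lemma lattice_connection_trivial:
  fixes t :: "int \<times> int \<Rightarrow> int \<times> int \<Rightarrow> 'b \<Rightarrow> 'b"
  assumes "simply_connected (cells Q)" "Q \<noteq> {}" and refl: "\<And>a. t a a = id"
    and cocycle: "\<And>s a b c. s \<in> Q \<Longrightarrow> {a, b, c} \<subseteq> corners s \<Longrightarrow> t a b \<circ> t b c = t a c"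
    and M: "M id" "\<And>f g. M f \<Longrightarrow> M g \<Longrightarrow> M (f \<circ> g)"
      "\<And>s a b. s \<in> Q \<Longrightarrow> a \<in> corners s \<Longrightarrow> b \<in> corners s \<Longrightarrow> M (t a b)"
  obtains h where "\<And>s a b. s \<in> Q \<Longrightarrow> a \<in> corners s \<Longrightarrow> b \<in> corners s \<Longrightarrow> h a \<circ> t a b = h b"
    "\<And>a. a \<in> verts Q \<Longrightarrow> M (h a)"
proof -
  define \<tau> where "\<tau> x y = t (nearest x) (nearest y)" for x y
  have near: "\<exists>s\<in>Q. \<forall>y. dist x y < 1 / 2 \<longrightarrow> nearest y \<in> corners s" if "x \<in> cells Q" for x
    using that nearest_in_corners unfolding cells_eq by blast
  have loc: "local_cocycle (cells Q) (1 / 2) \<tau>"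
    unfolding local_cocycle_def \<tau>_def
  proof (intro conjI ballI impI)
    fix x y z assume x: "x \<in> cells Q" and d: "dist x y < 1 / 2" "dist x z < 1 / 2"
    have d0: "dist x x < 1 / 2" by simp
    from near[OF x] obtain s where s: "s \<in> Q" "\<forall>y. dist x y < 1 / 2 \<longrightarrow> nearest y \<in> corners s"
      by blast
    then have "{nearest x, nearest y, nearest z} \<subseteq> corners s"
      using d d0 by blast
    then show "t (nearest x) (nearest y) \<circ> t (nearest y) (nearest z) = t (nearest x) (nearest z)"
      by (rule cocycle[OF s(1)])
  qed (simp_all add: refl)
  have ne: "cells Q \<noteq> {}"
    using assms(2) lattice_point_in_cell by (fastforce simp: cells_eq corners_def)
  obtain h where h: "\<And>e. path e \<Longrightarrow> path_image e \<subseteq> cells Q \<Longrightarrow> h (pathstart e) \<circ> holonomy \<tau> e = h (pathfinish e)"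
    "\<And>x. x \<in> cells Q \<Longrightarrow> \<exists>p. path p \<and> path_image p \<subseteq> cells Q \<and> h x = holonomy \<tau> p"
    using flat_connection_trivial[OF loc assms(1) ne] by metis
  show ?thesis
  proof (rule that[of "\<lambda>a. h (lattice_point a)"])
    fix s a b assume s: "s \<in> Q" "a \<in> corners s" "b \<in> corners s"
    let ?e = "linepath (lattice_point a) (lattice_point b)"
    have cell: "lattice_point a \<in> cell s" "lattice_point b \<in> cell s"
      using lattice_point_in_cell s by auto
    have seg: "path_image ?e \<subseteq> cell s"
      using closed_segment_subset[OF cell] by (simp add: cell_def convex_box)
    then have sub: "path_image ?e \<subseteq> cells Q" using s by (auto simp: cells_eq)
    have "holonomy \<tau> ?e = t a b"
    proof (rule holonomy_eqI[OF loc _ sub])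
      have corner: "nearest (?e u) \<in> corners s" if "u \<in> {0..1}" for u
      proof (rule nearest_in_corners)
        have "?e u \<in> path_image ?e" using that unfolding path_image_def by (rule imageI)
        then show "?e u \<in> cell s" using seg by blast
      qed simp
      have "transport \<tau> ?e N i = t a (nearest (?e (real i / real N)))" if "i \<le> N" "0 < N" for N i
        using that(1)
      proof (induction i)
        case 0
        then show ?case by (simp add: refl linepath_def)
      next
        case (Suc i)
        have "nearest (?e (real i / real N)) \<in> corners s" "nearest (?e (real (Suc i) / real N)) \<in> corners s"
          using Suc.prems by (auto intro!: corner simp: divide_le_eq)
        then show ?case
          using Suc s cocycle[of s a "nearest (?e (real i / real N))" "nearest (?e (real (Suc i) / real N))"]
          by (simp add: \<tau>_def)
      qed
      from this[of N N for N] have "transport \<tau> ?e N N = t a b" if "0 < N" for N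
        using that by (simp add: linepath_def)
      then show "eventually (\<lambda>N. transport \<tau> ?e N N = t a b) sequentially"
        unfolding eventually_sequentially by (intro exI[of _ 1]) simp
    qed simp
    then show "h (lattice_point a) \<circ> t a b = h (lattice_point b)"
      using h(1)[OF _ sub] by simp
  next
    fix a assume "a \<in> verts Q"
    then have "lattice_point a \<in> cells Q"
      using lattice_point_in_cell unfolding verts_def cells_eq by blast
    then obtain p where p: "path p" "path_image p \<subseteq> cells Q" "h (lattice_point a) = holonomy \<tau> p"
      using h(2) by blast
    have "uniformly_continuous_on {0..1} p"
      using p(1) compact_uniformly_continuous by (auto simp: path_def)
    then have "\<exists>d>0. \<forall>v\<in>{0..1}. \<forall>u\<in>{0..1}. dist u v < d \<longrightarrow> dist (p u) (p v) < 1 / 2"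
      unfolding uniformly_continuous_on_def by (meson half_gt_zero zero_less_one)
    then obtain \<epsilon> where \<epsilon>: "0 < \<epsilon>" "\<And>u v. u \<in> {0..1} \<Longrightarrow> v \<in> {0..1} \<Longrightarrow> dist u v < \<epsilon> \<Longrightarrow> dist (p u) (p v) < 1 / 2"
      by blast
    have "eventually (\<lambda>N. transport \<tau> p N N = holonomy \<tau> p \<and> 1 < real N * \<epsilon> \<and> 0 < N) sequentially"
      using holonomy_eventually[OF loc p(1,2)] eventually_large[OF \<epsilon>(1)] by eventually_elim simp
    then obtain N where N: "transport \<tau> p N N = holonomy \<tau> p" "1 < real N * \<epsilon>" "0 < N"
      unfolding eventually_sequentially by blast
    have "M (transport \<tau> p N i)" if "i \<le> N" for i
      using that
    proof (induction i)
      case (Suc i)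
      let ?a = "real i / real N" and ?b = "real (Suc i) / real N"
      have ab: "?a \<in> {0..1}" "?b \<in> {0..1}" using Suc.prems by (auto simp: divide_le_eq)
      have "dist ?a ?b = 1 / N" by (simp add: dist_real_def diff_divide_distrib[symmetric])
      also have "\<dots> < \<epsilon>" using N by (simp add: field_simps)
      finally have d: "dist (p ?a) (p ?b) < 1 / 2" using \<epsilon>(2) ab by blast
      have "p ?a \<in> cells Q" using p(2) ab by (auto simp: path_image_def)
      from near[OF this] obtain s where s: "s \<in> Q" "\<forall>y. dist (p ?a) y < 1 / 2 \<longrightarrow> nearest y \<in> corners s"
        by blast
      have "dist (p ?a) (p ?a) < 1 / 2" by simp
      then have "s \<in> Q" "nearest (p ?a) \<in> corners s" "nearest (p ?b) \<in> corners s"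
        using s d by blast+
      then have "M (\<tau> (p ?a) (p ?b))" unfolding \<tau>_def by (rule M(3))
      then show ?case
        unfolding transport.simps by (rule M(2)[OF Suc.IH[OF Suc_leD[OF Suc.prems]]])
    qed (simp add: M(1))
    from this[of N] show "M (h (lattice_point a))" using N(1) p(3) by simp
  qed
qed

section \<open>The angles of a ring pattern\<close>

lemma sgn_of_positive_multiple:
  fixes z w :: complex
  assumes "norm z = 1" "z = of_real c * w" "0 < c"
  shows "z = sgn w"
proof -
  have "sgn z = sgn w" using assms by (simp add: sgn_mult sgn_of_real)
  then show ?thesis using assms(1) by (simp add: sgn_div_norm)
qed

lemma orthogonal_circles_cosh:
  assumes "orthogonal_circles p a p' a'" "p \<in> ball 0 1" "p' \<in> ball 0 1"
  shows "cosh (hdist p p') = cosh a * cosh a'"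
proof -
  obtain x where x: "x \<in> ball 0 1" "hdist p x = \<bar>a\<bar>" "hdist p' x = \<bar>a'\<bar>" "orthogonal (hdir x p) (hdir x p')"
    using assms(1) by (auto simp: orthogonal_circles_def hcircle_def)
  have "sgn (hdir x p) \<bullet> sgn (hdir x p') = 0"
    using x(4) by (simp add: orthogonal_def sgn_div_norm)
  then have "cosh (hdist p p') = cosh (hdist x p) * cosh (hdist x p')"
    using law_of_cosines[OF x(1) assms(2,3)] by simp
  then show ?thesis
    using x by (simp add: hdist_commute[of x] abs_if)
qed

lemma sgn_diff_dominant: "sgn (a - b * c) = - sgn b" if "\<bar>a\<bar> < \<bar>b\<bar> * c" "0 < c" for a b c :: real
proof -
  consider "0 < b" | "b < 0" | "b = 0" by linarith
  then show ?thesis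
  proof cases
    case 1
    then have "a - b * c < 0" using that by (simp add: abs_less_iff)
    then show ?thesis using 1 by simp
  next
    case 2
    then have "0 < a - b * c" using that by (simp add: abs_less_iff)
    then show ?thesis using 2 by simp
  qed (use that in simp)
qed

lemma Im_of_real_mult: "Im (complex_of_real c * z) = c * Im z"
  by simp

lemma cnj_sgn_mult: "cnj (sgn a) * sgn b = of_real (1 / (norm a * norm b)) * (cnj a * b)" for a b :: complex
  by (simp add: sgn_eq)

text \<open>The quadrilateral cut out by two neighbouring rings: centres \<open>p\<close> and \<open>p'\<close>, and vertices \<open>x\<close>
  and \<open>y\<close> with right angles. The circles of the radii \<open>r\<close> and \<open>R'\<close> meet at \<open>x\<close>, those of \<open>R\<close> and
  \<open>r'\<close> at \<open>y\<close>. The sign \<open>\<sigma>\<close> depends on the position of the rings in the lattice.\<close>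

definition kite :: "complex \<Rightarrow> complex \<Rightarrow> complex \<Rightarrow> complex \<Rightarrow> real \<Rightarrow> real \<Rightarrow> real \<Rightarrow> real \<Rightarrow> real \<Rightarrow> bool" where
  "kite p p' x y r R r' R' \<sigma> \<longleftrightarrow>
    p \<in> ball 0 1 \<and> p' \<in> ball 0 1 \<and> x \<in> ball 0 1 \<and> y \<in> ball 0 1 \<and> \<bar>r\<bar> < R \<and> \<bar>r'\<bar> < R' \<and> \<bar>\<sigma>\<bar> = 1 \<and>
    hdist p x = \<bar>r\<bar> \<and> hdist p' x = R' \<and> hdist p y = R \<and> hdist p' y = \<bar>r'\<bar> \<and>
    cosh (hdist p p') = cosh R * cosh r' \<and> cosh (hdist p p') = cosh R' * cosh r \<and>
    \<sigma> * turn p x y = sgn r \<and> \<sigma> * turn p' y x = sgn r'"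

lemma kite_swap: "kite p p' x y r R r' R' \<sigma> \<Longrightarrow> kite p' p y x r' R' r R \<sigma>"
  by (simp add: kite_def hdist_commute mult.commute)

lemma hdist_pos_imp_neq: "0 < hdist p x \<Longrightarrow> p \<in> ball 0 1 \<Longrightarrow> x \<noteq> p"
  using hdist_eq_abs_iff[of p p 0] by auto

text \<open>The angle at \<open>p\<close> between \<open>p'\<close> and \<open>x\<close> is larger than the one between \<open>p'\<close> and \<open>y\<close>, as \<open>|r| <
  R\<close> and \<open>|r'| < R'\<close>. Therefore the turn from \<open>x\<close> to \<open>y\<close> alone decides on which side of the line
  of centres \<open>x\<close> lies.\<close>

lemma kite_sides:
  assumes "kite p p' x y r R r' R' \<sigma>"
  defines "Y0 \<equiv> cnj (sgn (hdir p p')) * sgn (hdir p x)"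
    and "Y \<equiv> cnj (sgn (hdir p p')) * sgn (hdir p y)"
    and "S \<equiv> sinh (hdist p p')"
  shows "0 < S" "norm (sgn (hdir p p')) = 1"
    and "Re Y = cosh r' * sinh R / S" "\<bar>Im Y\<bar> = sinh \<bar>r'\<bar> / S" "norm Y = 1"
    and "r \<noteq> 0 \<Longrightarrow> Re Y0 = cosh R' * sinh \<bar>r\<bar> / S" "r \<noteq> 0 \<Longrightarrow> \<bar>Im Y0\<bar> = sinh R' / S" "r \<noteq> 0 \<Longrightarrow> norm Y0 = 1"
    and "r \<noteq> 0 \<Longrightarrow> sgn (Im Y0) = - \<sigma> * sgn r"
proof -
  have k: "p \<in> ball 0 1" "p' \<in> ball 0 1" "x \<in> ball 0 1" "y \<in> ball 0 1" "\<bar>r\<bar> < R" "\<bar>r'\<bar> < R'" "\<bar>\<sigma>\<bar> = 1"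
    "hdist p x = \<bar>r\<bar>" "hdist p' x = R'" "hdist p y = R" "hdist p' y = \<bar>r'\<bar>"
    "cosh (hdist p p') = cosh R * cosh r'" "cosh (hdist p p') = cosh R' * cosh r"
    "\<sigma> * turn p x y = sgn r"
    using assms(1) by (auto simp: kite_def)
  have c: "cosh \<bar>a\<bar> = cosh a" for a :: real by (simp add: abs_if)
  have "y \<noteq> p" using k hdist_pos_imp_neq[of p y] by auto
  have "cosh (hdist p p') = cosh (hdist p y) * cosh (hdist y p')"
    using k c by (simp add: hdist_commute[of y])
  note Y = right_triangle_direction[OF k(1,4,2) \<open>y \<noteq> p\<close> this, folded Y_def S_def]
  show S: "0 < S" by (rule Y(3))
  show ReY: "Re Y = cosh r' * sinh R / S" and ImY: "\<bar>Im Y\<bar> = sinh \<bar>r'\<bar> / S" and nY: "norm Y = 1"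
    using Y k c by (simp_all add: hdist_commute[of y])
  have "hdir p p' \<noteq> 0" using nY by (auto simp: Y_def)
  then show nW: "norm (sgn (hdir p p')) = 1" by (simp add: norm_sgn)
  assume r: "r \<noteq> 0"
  have "x \<noteq> p" using k r hdist_pos_imp_neq[of p x] by auto
  have "cosh (hdist p p') = cosh (hdist p x) * cosh (hdist x p')"
    using k c by (simp add: hdist_commute[of x] mult.commute)
  note Y0 = right_triangle_direction[OF k(1,3,2) \<open>x \<noteq> p\<close> this, folded Y0_def S_def]
  show ReY0: "Re Y0 = cosh R' * sinh \<bar>r\<bar> / S" and ImY0: "\<bar>Im Y0\<bar> = sinh R' / S" and nY0: "norm Y0 = 1"
    using Y0 k by (simp_all add: hdist_commute[of x])
  have W: "sgn (hdir p p') * cnj (sgn (hdir p p')) = 1"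
    using nW by (metis complex_norm_square of_real_1 one_power2)
  have "cnj Y0 * Y = (sgn (hdir p p') * cnj (sgn (hdir p p'))) * (cnj (sgn (hdir p x)) * sgn (hdir p y))"
    by (simp add: Y0_def Y_def mult_ac)
  also have "\<dots> = of_real (1 / (norm (hdir p x) * norm (hdir p y))) * (cnj (hdir p x) * hdir p y)"
    by (simp only: W mult_1 cnj_sgn_mult)
  finally have eq: "Im (cnj Y0 * Y) = 1 / (norm (hdir p x) * norm (hdir p y)) * Im (cnj (hdir p x) * hdir p y)"
    by (simp only: Im_of_real_mult)
  have "hdir p x \<noteq> 0" "hdir p y \<noteq> 0" using nY nY0 by (auto simp: Y_def Y0_def)
  then have "0 < 1 / (norm (hdir p x) * norm (hdir p y))" by simp
  then have "turn p x y = sgn (Im (cnj Y0 * Y))"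
    unfolding eq turn_def sgn_mult by simp
  also have "Im (cnj Y0 * Y) = Re Y0 * Im Y - Im Y0 * Re Y" by simp
  also have "sgn (Re Y0 * Im Y - Im Y0 * Re Y) = - sgn (Im Y0)"
  proof -
    have R: "0 < R" "0 < R'" using k by auto
    have sinh_less: "sinh a < sinh b" if "a < b" for a b :: real using that by simp
    have "cosh R' * sinh \<bar>r'\<bar> < sinh R' * cosh r'"
    proof -
      have "sinh 0 < sinh (R' - \<bar>r'\<bar>)" using k by (intro sinh_less) simp
      then show ?thesis unfolding sinh_diff c by (simp add: mult.commute)
    qed
    moreover have "sinh \<bar>r\<bar> < sinh R" using k by (intro sinh_less)
    moreover have "0 < sinh R' * cosh r'" using R sinh_less[of 0 R'] by simp
    moreover have "0 \<le> sinh \<bar>r\<bar>" by simp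
    ultimately have "(cosh R' * sinh \<bar>r'\<bar>) * sinh \<bar>r\<bar> < (sinh R' * cosh r') * sinh R"
      by (rule mult_strict_mono)
    then have "cosh R' * sinh \<bar>r\<bar> / S * (sinh \<bar>r'\<bar> / S) < sinh R' / S * (cosh r' * sinh R / S)"
      using S by (simp add: divide_strict_right_mono mult_ac)
    then have "\<bar>Re Y0 * Im Y\<bar> < \<bar>Im Y0\<bar> * Re Y"
      unfolding abs_mult ImY ImY0 ReY ReY0 using S by simp
    moreover have "0 < Re Y" unfolding ReY using S R by simp
    ultimately show ?thesis
      by (intro sgn_diff_dominant)
  qed
  finally have "turn p x y = - sgn (Im Y0)" .
  then have "\<sigma> * - sgn (Im Y0) = sgn r" using k by simp
  moreover have "\<sigma> * \<sigma> = 1" using k(7) by (metis abs_mult_self_eq mult_1)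
  ultimately show "sgn (Im Y0) = - \<sigma> * sgn r"
    by (metis minus_mult_minus minus_mult_right mult.assoc mult_1 minus_minus)
qed

lemma Complex_eq_of_real_mult: "z = of_real c * Complex a b" if "Re z = c * a" "Im z = c * b"
  using that by (simp add: complex_eq_iff)

lemma kite_horizontal:
  assumes kite: "kite p p' x y r R r' R' \<sigma>" and r: "r \<noteq> 0"
  shows "of_real (sgn r) * sgn (hdir p x) = sgn (hdir p p') * sgn (Complex (sinh r) (- \<sigma> * tanh R'))"
proof -
  define Y0 where "Y0 = cnj (sgn (hdir p p')) * sgn (hdir p x)"
  define S where "S = sinh (hdist p p')"
  note s = kite_sides[OF kite, folded Y0_def S_def]
  have W: "sgn (hdir p p') * cnj (sgn (hdir p p')) = 1"
    using s(2) by (metis complex_norm_square of_real_1 one_power2)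
  have "Im Y0 = sgn (Im Y0) * \<bar>Im Y0\<bar>" by (simp add: sgn_mult_abs)
  also have "\<dots> = - \<sigma> * sgn r * (sinh R' / S)" using s(7,9)[OF r] by simp
  finally have im: "Im Y0 = - \<sigma> * sgn r * (sinh R' / S)" .
  have sr: "sgn r * sgn r = 1" "sgn r * sinh \<bar>r\<bar> = sinh r" using r by (auto simp: sgn_if)
  have "of_real (sgn r) * Y0 = of_real (cosh R' / S) * Complex (sinh r) (- \<sigma> * tanh R')"
  proof (rule Complex_eq_of_real_mult)
    show "Re (of_real (sgn r) * Y0) = cosh R' / S * sinh r"
      using s(6)[OF r] sr(2) by simp
    have "a * (- \<sigma> * a * b) = (a * a) * (- \<sigma> * b)" for a b by simp
    then have "Im (of_real (sgn r) * Y0) = (sgn r * sgn r) * (- \<sigma> * (sinh R' / S))"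
      unfolding Im_of_real_mult im .
    then show "Im (of_real (sgn r) * Y0) = cosh R' / S * (- \<sigma> * tanh R')"
      unfolding sr by (simp add: tanh_def)
  qed
  moreover have "norm (of_real (sgn r) * Y0) = 1"
    using s(8)[OF r] r by (simp add: norm_mult)
  ultimately have "of_real (sgn r) * Y0 = sgn (Complex (sinh r) (- \<sigma> * tanh R'))"
    using s(1) sgn_of_positive_multiple[of "of_real (sgn r) * Y0" "cosh R' / S"] by simp
  moreover have "of_real (sgn r) * sgn (hdir p x) = (sgn (hdir p p') * cnj (sgn (hdir p p'))) * (of_real (sgn r) * sgn (hdir p x))"
    by (simp only: W mult_1)
  ultimately show ?thesis by (simp only: Y0_def mult_ac)
qed

text \<open>The side on which \<open>y\<close> lies is known at \<open>p'\<close>, where \<open>y\<close> plays the role of \<open>x\<close>; it is carried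
  over to \<open>p\<close>.\<close>

lemma kite_vertical:
  assumes kite: "kite p p' x y r R r' R' \<sigma>"
  shows "sgn (hdir p y) = sgn (hdir p p') * sgn (Complex (sinh R) (\<sigma> * tanh r'))"
proof -
  define Y where "Y = cnj (sgn (hdir p p')) * sgn (hdir p y)"
  define S where "S = sinh (hdist p p')"
  note s = kite_sides[OF kite, folded Y_def S_def]
  have ball: "p \<in> ball 0 1" "p' \<in> ball 0 1" "y \<in> ball 0 1" using kite by (auto simp: kite_def)
  have W: "sgn (hdir p p') * cnj (sgn (hdir p p')) = 1"
    using s(2) by (metis complex_norm_square of_real_1 one_power2)
  have sgn_prod: "sgn (Im (cnj (sgn a) * sgn b)) = sgn (Im (cnj a * b))" if "a \<noteq> 0" "b \<noteq> 0" for a b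
  proof -
    have "Im (cnj (sgn a) * sgn b) = 1 / (norm a * norm b) * Im (cnj a * b)"
      unfolding cnj_sgn_mult Im_of_real_mult ..
    then show ?thesis using that by (simp only: sgn_mult) simp
  qed
  have im: "Im Y = \<sigma> * (sinh r' / S)"
  proof (cases "r' = 0")
    case True
    then show ?thesis using s(4) by simp
  next
    case r': False
    define Y1 where "Y1 = cnj (sgn (hdir p' p)) * sgn (hdir p' y)"
    note s' = kite_sides[OF kite_swap[OF kite], folded Y1_def]
    have "hdir p' p \<noteq> 0" "hdir p' y \<noteq> 0" using s'(8)[OF r'] by (auto simp: Y1_def)
    moreover have "hdir p p' \<noteq> 0" "hdir p y \<noteq> 0" using s(5) by (auto simp: Y_def)
    ultimately have "sgn (Im Y) = - sgn (Im Y1)"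
      unfolding Y1_def Y_def using sgn_prod orientation_swap[OF ball] by simp
    also have "\<dots> = \<sigma> * sgn r'" using s'(9)[OF r'] by simp
    finally have "Im Y = \<sigma> * sgn r' * \<bar>Im Y\<bar>" by (metis sgn_mult_abs)
    also have "\<dots> = \<sigma> * ((sgn r' * sinh \<bar>r'\<bar>) / S)" using s(4) by simp
    also have "sgn r' * sinh \<bar>r'\<bar> = sinh r'" by (auto simp: sgn_if abs_if)
    finally show ?thesis .
  qed
  have "Y = of_real (cosh r' / S) * Complex (sinh R) (\<sigma> * tanh r')"
    by (rule Complex_eq_of_real_mult) (use s(3) im in \<open>simp_all add: tanh_def\<close>)
  from sgn_of_positive_multiple[OF s(5) this]
  have "Y = sgn (Complex (sinh R) (\<sigma> * tanh r'))"
    using s(1) by simp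
  moreover have "sgn (hdir p y) = (sgn (hdir p p') * cnj (sgn (hdir p p'))) * sgn (hdir p y)"
    by (simp only: W mult_1)
  ultimately show ?thesis by (simp only: Y_def mult_ac)
qed

text \<open>The turn at a positively oriented ring \<open>v\<close> from the horizontal to the vertical point which
  it shares with the ring \<open>w\<close>.\<close>

definition side_sign :: "int \<times> int \<Rightarrow> int \<times> int \<Rightarrow> real" where
  "side_sign v w = of_int ((fst w - fst v) * (snd w - snd v))"

lemma abs_side_sign: "nb Q v w \<Longrightarrow> \<bar>side_sign v w\<bar> = 1"
  by (simp add: nb_def side_sign_def abs_mult flip: of_int_diff of_int_abs)

lemma side_sign_commute: "side_sign w v = side_sign v w"
  by (simp add: side_sign_def algebra_simps)

lemma ring_patternD:
  assumes "ring_pattern Q p r R l"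
  shows "\<forall>v\<in>G Q. p v \<in> ball 0 1 \<and> 0 < R v \<and> \<bar>r v\<bar> \<le> R v"
    and "\<forall>v w. nb Q v w \<longrightarrow> orthogonal_circles (p v) (R v) (p w) (r w) \<and> orthogonal_circles (p w) (R w) (p v) (r v)"
    and "\<forall>v w. nb Q v w \<longrightarrow> l (fst w, snd v) \<in> hcircle (p v) (r v) \<inter> hcircle (p w) (R w) \<and>
      l (fst v, snd w) \<in> hcircle (p v) (R v) \<inter> hcircle (p w) (r w)"
    and "\<forall>v w w'. nb Q v w \<and> nb Q v w' \<and> w \<noteq> w' \<longrightarrow>
      (snd w = snd w' \<longrightarrow> touch_at (p w) (r w) (p w') (r w') (l (fst v, snd w))) \<and>
      (fst w = fst w' \<longrightarrow> touch_at (p w) (R w) (p w') (R w') (l (fst w, snd v)))"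
    and "\<forall>v w. nb Q v w \<longrightarrow>
      of_int ((fst w - fst v) * (snd w - snd v)) * turn (p v) (l (fst w, snd v)) (l (fst v, snd w)) = sgn (r v)"
  using assms unfolding ring_pattern_def by - ((elim conjE, assumption)+)

context elliptic_modulus
begin

lemma ring_pattern_kite:
  assumes pat: "ring_pattern Q p r R l" and ring: "\<forall>j\<in>G Q. ring_of k (\<gamma> j) (r j) (R j)" and nb: "nb Q v w"
  shows "kite (p v) (p w) (l (fst w, snd v)) (l (fst v, snd w)) (r v) (R v) (r w) (R w) (side_sign v w)"
proof -
  have G: "v \<in> G Q" "w \<in> G Q" using nb nb_in_G by blast+
  have ball: "p v \<in> ball 0 1" "p w \<in> ball 0 1" using ring_patternD(1)[OF pat] G by blast+
  have orth: "orthogonal_circles (p v) (R v) (p w) (r w)" "orthogonal_circles (p w) (R w) (p v) (r v)"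
    using ring_patternD(2)[OF pat] nb by blast+
  have mem: "l (fst w, snd v) \<in> hcircle (p v) (r v)" "l (fst w, snd v) \<in> hcircle (p w) (R w)"
    "l (fst v, snd w) \<in> hcircle (p v) (R v)" "l (fst v, snd w) \<in> hcircle (p w) (r w)"
    using ring_patternD(3)[OF pat] nb by blast+
  have t: "side_sign v w * turn (p v) (l (fst w, snd v)) (l (fst v, snd w)) = sgn (r v)"
    if "nb Q v w" for v w
    using ring_patternD(5)[OF pat] that unfolding side_sign_def by blast
  have R: "0 < R v" "0 < R w" "\<bar>r v\<bar> < R v" "\<bar>r w\<bar> < R w"
    using ring_ofD(9,10) ring G by blast+
  have "nb Q w v" using nb nb_sym by blast
  from t[OF this] t[OF nb] show ?thesis
    using ball mem R abs_side_sign[OF nb] orthogonal_circles_cosh[OF orth(1) ball]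
      orthogonal_circles_cosh[OF orth(2) ball(2,1)]
    by (simp add: kite_def hcircle_def side_sign_commute[of w v] hdist_commute[of "p w" "p v"])
qed

text \<open>The direction from the ring at \<open>v\<close> to the horizontal touching point shared with \<open>w\<close>,
  reversed if the ring is negatively oriented. For \<open>r v = 0\<close> it is the limit of this direction.\<close>

definition horizontal_dir ::
  "(int \<times> int \<Rightarrow> complex) \<Rightarrow> (int \<times> int \<Rightarrow> real) \<Rightarrow> (int \<times> int \<Rightarrow> real) \<Rightarrow> int \<times> int \<Rightarrow> int \<times> int \<Rightarrow> complex" where
  "horizontal_dir p r R v w =
     sgn (hdir (p v) (p w)) * sgn (Complex (sinh (r v)) (- side_sign v w * tanh (R w)))"

lemma horizontal_dir_rotate:
  assumes pat: "ring_pattern Q p r R l" and ring: "\<forall>j\<in>G Q. ring_of k (\<gamma> j) (r j) (R j)" and nb: "nb Q v w"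
  shows "sgn (hdir (p v) (l (fst v, snd w))) =
      horizontal_dir p r R v w * cis (side_sign v w * angle (\<gamma> v) (\<gamma> w))"
    and "horizontal_dir p r R v w \<noteq> 0"
proof -
  have G: "v \<in> G Q" "w \<in> G Q" using nb nb_in_G by blast+
  note kite = ring_pattern_kite[OF assms]
  define U where "U = Complex (sinh (r v)) (tanh (R w))"
  define V where "V = Complex (sinh (R v)) (tanh (r w))"
  have cis: "cis (angle (\<gamma> v) (\<gamma> w)) = sgn U * sgn V"
    unfolding U_def V_def using cis_angle_ring ring G by (simp add: sgn_mult)
  have "0 < R w" using ring_ofD(9) ring G by blast
  then have "U \<noteq> 0" by (simp add: U_def complex_eq_iff)
  then have U: "cnj (sgn U) * sgn U = 1"
    by (metis complex_norm_square mult.commute norm_sgn of_real_1 one_power2)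
  have sgn_cnj: "sgn (cnj z) = cnj (sgn z)" for z by (simp add: sgn_eq)
  consider "side_sign v w = 1" | "side_sign v w = - 1"
    using abs_side_sign[OF nb] by linarith
  then have "sgn (Complex (sinh (R v)) (side_sign v w * tanh (r w))) =
      sgn (Complex (sinh (r v)) (- side_sign v w * tanh (R w))) * cis (side_sign v w * angle (\<gamma> v) (\<gamma> w))"
  proof cases
    case 1
    have "Complex (sinh (r v)) (- tanh (R w)) = cnj U" by (simp add: U_def complex_eq_iff)
    then show ?thesis
      using 1 U by (simp add: cis sgn_cnj mult.assoc[symmetric] flip: V_def)
  next
    case 2
    have "Complex (sinh (R v)) (- tanh (r w)) = cnj V" by (simp add: V_def complex_eq_iff)
    moreover have "cis (- angle (\<gamma> v) (\<gamma> w)) = cnj (sgn U) * cnj (sgn V)"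
      using cis by (metis cis_cnj complex_cnj_mult)
    ultimately show ?thesis
      using 2 U by (simp add: sgn_cnj mult.assoc[symmetric] mult.commute[of "sgn U"] flip: U_def)
  qed
  then show "sgn (hdir (p v) (l (fst v, snd w))) =
      horizontal_dir p r R v w * cis (side_sign v w * angle (\<gamma> v) (\<gamma> w))"
    unfolding horizontal_dir_def kite_vertical[OF kite] by (simp add: mult.assoc)
  have "Complex (sinh (r v)) (- side_sign v w * tanh (R w)) \<noteq> 0"
    using \<open>0 < R w\<close> abs_side_sign[OF nb] by (auto simp: complex_eq_iff)
  moreover have "hdir (p v) (p w) \<noteq> 0" using kite_sides(2)[OF kite] by (auto simp: norm_sgn split: if_splits)
  ultimately show "horizontal_dir p r R v w \<noteq> 0"
    by (simp add: horizontal_dir_def sgn_zero_iff)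
qed

text \<open>If the ring is not a point, both sides are the direction of the same touching point. If \<open>r v
  = 0\<close>, this point is the centre of the ring; it is the contact of the outer circles of \<open>w\<close> and
  \<open>w'\<close>, so their centres lie in opposite directions.\<close>

lemma horizontal_dir_eq:
  assumes pat: "ring_pattern Q p r R l" and ring: "\<forall>j\<in>G Q. ring_of k (\<gamma> j) (r j) (R j)"
    and nb: "nb Q v w" "nb Q v w'" and eq: "fst w = fst w'" and neq: "w \<noteq> w'"
  shows "horizontal_dir p r R v w = horizontal_dir p r R v w'"
proof (cases "r v = 0")
  case False
  have "horizontal_dir p r R v u = of_real (sgn (r v)) * sgn (hdir (p v) (l (fst u, snd v)))" if "nb Q v u" for u
    unfolding horizontal_dir_def using kite_horizontal[OF ring_pattern_kite[OF pat ring that] False] by simp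
  then show ?thesis using nb eq by simp
next
  case True
  note kite = ring_pattern_kite[OF pat ring nb(1)] ring_pattern_kite[OF pat ring nb(2)]
  let ?x = "l (fst w, snd v)"
  have ball: "p v \<in> ball 0 1" "p w \<in> ball 0 1" "p w' \<in> ball 0 1" "?x \<in> ball 0 1"
    using kite by (auto simp: kite_def)
  have d: "hdist (p v) ?x = 0" "hdist (p w) ?x = R w" "hdist (p w') ?x = R w'"
    using kite True eq by (auto simp: kite_def)
  have "norm (hdir (p v) ?x) = 0"
    using hdist_eq_abs_iff[OF ball(1,4), of 0] d(1) by simp
  then have "?x = p v"
    using hdir_denom_nonzero[OF ball(1,4)] by (simp add: hdir_def)
  with d have dist: "hdist (p v) (p w) = R w" "hdist (p v) (p w') = R w'"
    by (simp_all add: hdist_commute)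
  have R: "0 < R w" "0 < R w'" using kite by (auto simp: kite_def)
  have "touch_at (p w) (R w) (p w') (R w') ?x"
    using ring_patternD(4)[OF pat] nb eq neq by blast
  then have "cosh (hdist (p w) (p w')) = cosh (R w + R w')"
    using R by (simp add: touch_at_def)
  then have "sinh (R w) * sinh (R w') * (sgn (hdir (p v) (p w)) \<bullet> sgn (hdir (p v) (p w'))) = - (sinh (R w) * sinh (R w'))"
    using law_of_cosines[OF ball(1-3)] by (simp add: dist cosh_add)
  then have "sinh (R w) * sinh (R w') * (sgn (hdir (p v) (p w)) \<bullet> sgn (hdir (p v) (p w')) + 1) = 0"
    by (simp add: distrib_left)
  then have inner: "sgn (hdir (p v) (p w)) \<bullet> sgn (hdir (p v) (p w')) = - 1"
    using R by (simp add: add_eq_0_iff2)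
  have norm1: "norm (sgn (hdir (p v) (p w))) = 1" "norm (sgn (hdir (p v) (p w'))) = 1"
    using kite_sides(2) kite by blast+
  have "(norm (sgn (hdir (p v) (p w)) + sgn (hdir (p v) (p w'))))\<^sup>2 = 0"
    unfolding power2_norm_eq_inner inner_add_left inner_add_right
    using norm1 inner by (simp add: inner_commute flip: power2_norm_eq_inner)
  then have opp: "sgn (hdir (p v) (p w)) = - sgn (hdir (p v) (p w'))"
    by (simp add: eq_neg_iff_add_eq_0)
  have "snd w - snd v = - (snd w' - snd v)"
    using nb neq eq by (auto simp: nb_def prod_eq_iff abs_if split: if_splits)
  then have side: "side_sign v w = - side_sign v w'"
    unfolding side_sign_def eq by (simp only: mult_minus_right of_int_minus)
  have sgnI: "sgn (Complex 0 (t * tanh a)) = Complex 0 t" if "\<bar>t\<bar> = 1" "0 < a" for t a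
    using that by (simp add: sgn_eq complex_eq_iff cmod_def abs_mult)
  have "horizontal_dir p r R v u = sgn (hdir (p v) (p u)) * Complex 0 (- side_sign v u)"
    if "nb Q v u" "0 < R u" for u
    unfolding horizontal_dir_def True sinh_0 using abs_side_sign[OF that(1)] that(2)
    by (subst sgnI) simp_all
  then have H: "horizontal_dir p r R v w = sgn (hdir (p v) (p w)) * Complex 0 (- side_sign v w)"
    "horizontal_dir p r R v w' = sgn (hdir (p v) (p w')) * Complex 0 (- side_sign v w')"
    using nb R by blast+
  have "Complex 0 (- side_sign v w) = - Complex 0 (- side_sign v w')"
    unfolding side by (simp add: complex_eq_iff)
  then show ?thesis
    unfolding H opp by (simp only: minus_mult_minus)
qed

text \<open>By \<open>horizontal_dir_rotate\<close> the four angles lead once around the ring, back to the initial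
  direction. Each of them lies in \<open>(0, \<pi>)\<close>, so that \<open>2\<pi>\<close> is the only multiple of \<open>2\<pi>\<close> which their
  sum can be.\<close>

lemma ring_pattern_inner_angle:
  assumes pat: "ring_pattern Q p r R l" and ring: "\<forall>j\<in>G Q. ring_of k (\<gamma> j) (r j) (R j)"
    and v: "v \<in> inner_verts Q"
  shows "(\<Sum>w\<in>nbs Q v. angle (\<gamma> v) (\<gamma> w)) = 2 * pi"
proof -
  obtain m n where mn: "v = (m, n)" by (cases v)
  let ?NE = "(m + 1, n + 1)" and ?NW = "(m - 1, n + 1)" and ?SW = "(m - 1, n - 1)" and ?SE = "(m + 1, n - 1)"
  have nbs: "nbs Q v = {?NE, ?NW, ?SW, ?SE}"
    using v valence_4_iff by (simp add: inner_verts_def nb_candidates_def mn)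
  then have nb: "nb Q v ?NE" "nb Q v ?NW" "nb Q v ?SW" "nb Q v ?SE"
    unfolding nbs_def by blast+
  let ?f = "\<lambda>w. angle (\<gamma> v) (\<gamma> w)" and ?H = "horizontal_dir p r R v"
  have sum: "(\<Sum>w\<in>nbs Q v. ?f w) = ?f ?NE + ?f ?NW + ?f ?SW + ?f ?SE"
    unfolding nbs by (simp add: add.assoc)
  have side: "side_sign v ?NE = 1" "side_sign v ?NW = - 1" "side_sign v ?SW = 1" "side_sign v ?SE = - 1"
    by (simp_all add: side_sign_def mn)
  have E: "?H ?NE = ?H ?SE" and W: "?H ?NW = ?H ?SW"
    using horizontal_dir_eq[OF pat ring nb(1,4)] horizontal_dir_eq[OF pat ring nb(2,3)] by simp_all
  note rot = horizontal_dir_rotate(1)[OF pat ring]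
  have N: "?H ?NE * cis (?f ?NE) = ?H ?SW * cis (- ?f ?NW)"
    using rot[OF nb(1)] rot[OF nb(2)] unfolding side W by simp
  have S: "?H ?SW * cis (?f ?SW) = ?H ?NE * cis (- ?f ?SE)"
    using rot[OF nb(3)] rot[OF nb(4)] unfolding side E by simp
  have "?H ?NE * cis (?f ?NE + ?f ?NW + ?f ?SW + ?f ?SE) = (?H ?NE * cis (?f ?NE)) * cis (?f ?NW + ?f ?SW + ?f ?SE)"
    by (simp add: cis_mult add.assoc)
  also have "\<dots> = (?H ?SW * cis (?f ?SW)) * cis (?f ?SE)"
    unfolding N by (simp add: cis_mult mult.assoc)
  also have "\<dots> = ?H ?NE"
    unfolding S by (simp add: cis_mult mult.assoc)
  finally have "cis (?f ?NE + ?f ?NW + ?f ?SW + ?f ?SE) = 1"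
    using horizontal_dir_rotate(2)[OF pat ring nb(1)] by simp
  then have "cis (?f ?NE + ?f ?NW + ?f ?SW + ?f ?SE) = cis (2 * pi)" by simp
  moreover have "0 < \<gamma> v" "\<gamma> v < 2 * ellK k"
    using ring v ring_ofD(1,2) by (auto simp: inner_verts_def)
  then have "0 < ?f w \<and> ?f w < pi" for w using angle_bounds by blast
  then have "\<bar>?f ?NE + ?f ?NW + ?f ?SW + ?f ?SE - 2 * pi\<bar> < 2 * pi"
    by (smt (verit, best))
  ultimately show ?thesis
    unfolding sum by (rule cis_eqD)
qed

end

section \<open>Frames along the edges of the lattice\<close>

definition opposite :: "int \<times> int \<Rightarrow> int \<times> int \<Rightarrow> int \<times> int" where
  "opposite s a = (2 * fst s + 1 - fst a, 2 * snd s + 1 - snd a)"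

text \<open>The left one of the two corners of a square which belong to \<open>G\<close>; it serves as the base point
  of the square.\<close>

definition left_even :: "int \<times> int \<Rightarrow> int \<times> int" where
  "left_even s = (if even (fst s + snd s) then s else (fst s, snd s + 1))"

lemma corners_iff:
  "a \<in> corners s \<longleftrightarrow> (fst a = fst s \<or> fst a = fst s + 1) \<and> (snd a = snd s \<or> snd a = snd s + 1)"
  by (cases a; cases s) (auto simp: corners_def)

lemma left_even_corners:
  "left_even s \<in> corners s" "opposite s (left_even s) \<in> corners s"
  "even (fst (left_even s) + snd (left_even s))" "left_even s \<noteq> opposite s (left_even s)"
  "fst (left_even s) = fst s"
  by (simp_all add: corners_iff left_even_def opposite_def prod_eq_iff)

lemma corners_cases:
  assumes a: "a \<in> corners s" and v: "v = left_even s" and w: "w = opposite s v"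
  shows "even (fst a + snd a) \<Longrightarrow> a = v \<or> a = w"
    and "odd (fst a + snd a) \<Longrightarrow> a = (fst w, snd v) \<or> a = (fst v, snd w)"
proof -
  have w': "fst w = 2 * fst s + 1 - fst v" "snd w = 2 * snd s + 1 - snd v"
    by (simp_all add: w opposite_def)
  have v': "fst v = fst s" "snd v = snd s \<or> snd v = snd s + 1" "even (fst s + snd v)"
    using left_even_corners[of s] by (simp_all add: v corners_iff)
  have a': "fst a = fst s \<or> fst a = fst s + 1" "snd a = snd s \<or> snd a = snd s + 1"
    using a by (simp_all add: corners_iff)
  have aux: "(even (a1 + a2) \<longrightarrow> a1 = s1 \<and> a2 = v2 \<or> a1 = s1 + 1 \<and> a2 = 2 * s2 + 1 - v2) \<and>
      (odd (a1 + a2) \<longrightarrow> a1 = s1 + 1 \<and> a2 = v2 \<or> a1 = s1 \<and> a2 = 2 * s2 + 1 - v2)"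
    if "a1 = s1 \<or> a1 = s1 + 1" "a2 = s2 \<or> a2 = s2 + 1" "v2 = s2 \<or> v2 = s2 + 1" "even (s1 + v2)"
    for a1 a2 s1 s2 v2 :: int
    using that by (elim disjE; simp)
  have "2 * fst s + 1 - fst s = fst s + 1" by simp
  note * = aux[OF a' v'(2,3)]
  show "even (fst a + snd a) \<Longrightarrow> a = v \<or> a = w"
    using * unfolding prod_eq_iff w' v'(1) \<open>2 * fst s + 1 - fst s = fst s + 1\<close> by blast
  show "odd (fst a + snd a) \<Longrightarrow> a = (fst w, snd v) \<or> a = (fst v, snd w)"
    using * unfolding prod_eq_iff w' v'(1) fst_conv snd_conv \<open>2 * fst s + 1 - fst s = fst s + 1\<close> by blast
qed

lemma nb_left_even:
  assumes "s \<in> Q"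
  shows "nb Q (left_even s) (opposite s (left_even s))"
proof -
  let ?v = "left_even s" and ?w = "opposite s (left_even s)"
  have ex: "\<exists>s'\<in>Q. ?v \<in> corners s' \<and> ?w \<in> corners s'"
    using left_even_corners(1,2)[of s] assms by (intro bexI[of _ s] conjI)
  have "even (fst ?w + snd ?w)"
    using left_even_corners(3)[of s] by (simp add: opposite_def)
  moreover have "\<bar>fst ?w - fst ?v\<bar> = 1" "\<bar>snd ?w - snd ?v\<bar> = 1"
    by (simp_all add: opposite_def left_even_def)
  moreover have "?v \<in> verts Q" "?w \<in> verts Q"
    using assms left_even_corners(1,2)[of s] by (auto simp: verts_def)
  ultimately show ?thesis
    using left_even_corners(3)[of s] ex unfolding nb_def G_def mem_Collect_eq by (intro conjI)
qed

lemma diagonal_sum: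
  assumes "a \<in> corners s" "b \<in> corners s" "a \<noteq> b" "even (fst a + snd a) = even (fst b + snd b)"
  shows "2 * fst s + 1 = fst a + fst b" "2 * snd s + 1 = snd a + snd b"
proof -
  have sum: "x \<noteq> y \<longrightarrow> 2 * m + 1 = x + y" if "x = m \<or> x = m + 1" "y = m \<or> y = m + 1" for x y m :: int
    using that by auto
  have fst_sum: "fst a \<noteq> fst b \<longrightarrow> 2 * fst s + 1 = fst a + fst b"
    and snd_sum: "snd a \<noteq> snd b \<longrightarrow> 2 * snd s + 1 = snd a + snd b"
    using assms(1,2) unfolding corners_iff by (intro sum; blast)+
  have parity: "even x \<noteq> even y" if "2 * m + 1 = x + y" for x y m :: int
    using that by presburger
  have "fst a \<noteq> fst b \<and> snd a \<noteq> snd b"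
  proof (rule ccontr)
    assume "\<not> (fst a \<noteq> fst b \<and> snd a \<noteq> snd b)"
    then consider "fst a = fst b" "snd a \<noteq> snd b" | "fst a \<noteq> fst b" "snd a = snd b"
      using assms(3) prod_eq_iff by blast
    then show False
    proof cases
      case 1
      then have "even (snd a) \<noteq> even (snd b)" using parity snd_sum by blast
      then show False using assms(4) 1(1) by auto
    next
      case 2
      then have "even (fst a) \<noteq> even (fst b)" using parity fst_sum by blast
      then show False using assms(4) 2(2) by auto
    qed
  qed
  with fst_sum snd_sum show "2 * fst s + 1 = fst a + fst b" "2 * snd s + 1 = snd a + snd b" by blast+
qed

lemma square_eqI:
  assumes "a \<in> corners s" "b \<in> corners s" "a \<in> corners s'" "b \<in> corners s'"
    and "a \<noteq> b" "even (fst a + snd a) = even (fst b + snd b)"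
  shows "s = s'"
proof -
  have "2 * fst s + 1 = 2 * fst s' + 1" "2 * snd s + 1 = 2 * snd s' + 1"
    unfolding diagonal_sum[OF assms(1,2,5,6)] diagonal_sum[OF assms(3,4,5,6)] by (rule refl)+
  then show ?thesis unfolding prod_eq_iff by linarith
qed

text \<open>A connection is prescribed on the edges \<open>(v, u)\<close> from \<open>G\<close> to \<open>G\<^sup>*\<close>. In each square it has a
  local trivialization \<open>L\<close>, starting from the base point; two different squares with two common
  corners share the edge between them, so that the transport between corners does not depend on
  the square.\<close>

lemma edge_connection_trivial:
  fixes e e' :: "int \<times> int \<Rightarrow> int \<times> int \<Rightarrow> 'b \<Rightarrow> 'b"
  assumes sc: "simply_connected (cells Q)" and ne: "Q \<noteq> {}"
    and inverse: "\<And>v u. e v u \<circ> e' v u = id" "\<And>v u. e' v u \<circ> e v u = id"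
    and square: "\<And>v w. nb Q v w \<Longrightarrow>
      e v (fst w, snd v) \<circ> e' w (fst w, snd v) = e v (fst v, snd w) \<circ> e' w (fst v, snd w)"
    and M: "M id" "\<And>h h'. M h \<Longrightarrow> M h' \<Longrightarrow> M (h \<circ> h')" "\<And>v u. M (e v u)" "\<And>v u. M (e' v u)"
  obtains h where "\<And>s v u. s \<in> Q \<Longrightarrow> v \<in> corners s \<Longrightarrow> u \<in> corners s \<Longrightarrow> even (fst v + snd v) \<Longrightarrow>
      odd (fst u + snd u) \<Longrightarrow> h v \<circ> e v u = h u"
    "\<And>a. a \<in> verts Q \<Longrightarrow> M (h a)"
proof -
  define V where "V = left_even"
  define W where "W s = opposite s (V s)" for s
  define U where "U s = (fst (W s), snd (V s))" for s
  define L where "L s a = (if a = V s then id else if a = W s then e (V s) (U s) \<circ> e' (W s) (U s) else e (V s) a)" for s a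
  define J where "J s a = (if a = V s then id else if a = W s then e (W s) (U s) \<circ> e' (V s) (U s) else e' (V s) a)" for s a
  have c1: "e v u (e' v u z) = z" and c2: "e' v u (e v u z) = z" for v u z
    using inverse[of v u] by (metis comp_apply id_apply)+
  have LJ: "L s a \<circ> J s a = id" and JL: "J s a \<circ> L s a = id" for s a
    by (rule ext, simp add: L_def J_def c1 c2)+
  have edge: "L s u = L s v \<circ> e v u"
    if "s \<in> Q" "v \<in> corners s" "u \<in> corners s" "even (fst v + snd v)" "odd (fst u + snd u)" for s v u
  proof -
    have W: "V s \<noteq> W s" unfolding V_def W_def by (rule left_even_corners)
    have u: "u \<noteq> V s" "u \<noteq> W s"
      using that left_even_corners(3)[of s] by (auto simp: V_def W_def opposite_def)
    have "v = V s \<or> v = W s" "u = U s \<or> u = (fst (V s), snd (W s))"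
      using corners_cases(1)[OF that(2) V_def[THEN fun_cong] W_def] corners_cases(2)[OF that(3) V_def[THEN fun_cong] W_def] that(4,5)
      by (simp_all add: U_def)
    moreover define U' where "U' = (fst (V s), snd (W s))"
    ultimately have cases: "v = V s \<or> v = W s" "u = U s \<or> u = U'" by simp_all
    have "nb Q (V s) (W s)" unfolding V_def W_def by (rule nb_left_even[OF that(1)])
    from square[OF this] have "e (V s) (U s) \<circ> e' (W s) (U s) = e (V s) U' \<circ> e' (W s) U'"
      by (simp only: U_def U'_def)
    moreover have "L s (W s) = e (V s) (U s) \<circ> e' (W s) (U s)"
      unfolding L_def using W by auto
    ultimately have LW: "L s (W s) = e (V s) (U s) \<circ> e' (W s) (U s)" "L s (W s) = e (V s) U' \<circ> e' (W s) U'"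
      by simp_all
    have Lu: "L s u = e (V s) u" using u by (simp add: L_def)
    from cases(1) show ?thesis
    proof
      assume "v = V s"
      then show ?thesis unfolding Lu by (simp add: L_def)
    next
      assume v: "v = W s"
      have "L s (W s) = e (V s) u \<circ> e' (W s) u" using cases(2) LW by blast
      then show ?thesis unfolding Lu v by (simp add: comp_assoc inverse)
    qed
  qed
  \<comment> \<open>The transport between corners of a common square, which is chosen arbitrarily.\<close>
  define t where "t a b = (if \<exists>s\<in>Q. a \<in> corners s \<and> b \<in> corners s
    then let s = (SOME s. s \<in> Q \<and> a \<in> corners s \<and> b \<in> corners s) in J s a \<circ> L s b else id)" for a b
  have t_eq: "t a b = J s a \<circ> L s b" if s: "s \<in> Q" "a \<in> corners s" "b \<in> corners s" for s a b
  proof -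
    define s' where "s' = (SOME s. s \<in> Q \<and> a \<in> corners s \<and> b \<in> corners s)"
    have s': "s' \<in> Q" "a \<in> corners s'" "b \<in> corners s'"
      using someI[of "\<lambda>s. s \<in> Q \<and> a \<in> corners s \<and> b \<in> corners s" s] s by (simp_all add: s'_def)
    have "J s' a \<circ> L s' b = J s a \<circ> L s b"
    proof (cases "even (fst a + snd a) = even (fst b + snd b)")
      case True
      show ?thesis
      proof (cases "a = b")
        case True
        then show ?thesis by (simp only: JL)
      next
        case neq: False
        have "s' = s" by (rule square_eqI[OF s'(2,3) s(2,3) neq True])
        then show ?thesis by simp
      qed
    next
      case False
      show ?thesis
      proof (cases "even (fst a + snd a)")
        case True
        then have "L s b = L s a \<circ> e a b" "L s' b = L s' a \<circ> e a b"
          using edge s s' False by blast+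
        then show ?thesis by (simp add: comp_assoc[symmetric] JL)
      next
        case a: False
        then have "L s a = L s b \<circ> e b a" "L s' a = L s' b \<circ> e b a"
          using edge s s' False by blast+
        then have L: "L s b = L s a \<circ> e' b a" "L s' b = L s' a \<circ> e' b a"
          by (simp_all add: comp_assoc inverse)
        have "J s a \<circ> L s b = e' b a" "J s' a \<circ> L s' b = e' b a"
          unfolding L by (simp_all add: comp_assoc[symmetric] JL)
        then show ?thesis by simp
      qed
    qed
    moreover have "\<exists>s\<in>Q. a \<in> corners s \<and> b \<in> corners s" using s by blast
    ultimately show ?thesis by (simp only: t_def if_True Let_def s'_def)
  qed
  obtain h where h: "\<And>s a b. s \<in> Q \<Longrightarrow> a \<in> corners s \<Longrightarrow> b \<in> corners s \<Longrightarrow> h a \<circ> t a b = h b"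
    "\<And>a. a \<in> verts Q \<Longrightarrow> M (h a)"
  proof (rule lattice_connection_trivial[OF sc ne, of t M])
    show "t a a = id" for a
    proof (cases "\<exists>s\<in>Q. a \<in> corners s")
      case True
      then obtain s where "s \<in> Q" "a \<in> corners s" by blast
      then show ?thesis by (simp only: t_eq JL)
    next
      case False
      then show ?thesis unfolding t_def by (simp only: conj_absorb if_False)
    qed
    show "t a b \<circ> t b c = t a c" if "s \<in> Q" "{a, b, c} \<subseteq> corners s" for s a b c
    proof -
      have "J s a \<circ> L s b \<circ> (J s b \<circ> L s c) = J s a \<circ> (L s b \<circ> J s b) \<circ> L s c"
        by (simp only: comp_assoc)
      then show ?thesis using that by (simp add: t_eq[OF that(1)] LJ)
    qed
    show "M (t a b)" if "s \<in> Q" "a \<in> corners s" "b \<in> corners s" for s a b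
      unfolding t_eq[OF that] L_def J_def by (simp add: M)
    show "M id" by (rule M(1))
    show "M (f \<circ> f')" if "M f" "M f'" for f f' by (rule M(2)[OF that])
    fix h
    assume "\<And>s a b. s \<in> Q \<Longrightarrow> a \<in> corners s \<Longrightarrow> b \<in> corners s \<Longrightarrow> h a \<circ> t a b = h b"
      and "\<And>a. a \<in> verts Q \<Longrightarrow> M (h a)"
    then show thesis by (rule that)
  qed
  show ?thesis
  proof (rule that[of h])
    fix s v u assume *: "s \<in> Q" "v \<in> corners s" "u \<in> corners s" "even (fst v + snd v)" "odd (fst u + snd u)"
    have "t v u = J s v \<circ> (L s v \<circ> e v u)"
      unfolding t_eq[OF *(1,2,3)] edge[OF *] ..
    then have "t v u = e v u" by (simp add: comp_assoc[symmetric] JL)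
    then show "h v \<circ> e v u = h u" using h(1)[OF *(1,2,3)] by simp
  next
    fix a assume "a \<in> verts Q"
    then show "M (h a)" by (rule h(2))
  qed
qed


section \<open>The kite identity\<close>

lemma
  fixes a :: real
  shows sinh_half: "sinh a = 2 * tanh (a / 2) / (1 - (tanh (a / 2))\<^sup>2)"
  and tanh_half: "tanh a = 2 * tanh (a / 2) / (1 + (tanh (a / 2))\<^sup>2)"
proof -
  let ?c = "cosh (a / 2)" and ?s = "sinh (a / 2)"
  have c: "0 < ?c" by simp
  have 1: "1 - (tanh (a / 2))\<^sup>2 = 1 / ?c\<^sup>2"
  proof -
    have "1 - (tanh (a / 2))\<^sup>2 = (?c\<^sup>2 - ?s\<^sup>2) / ?c\<^sup>2"
      using c by (simp add: tanh_def power_divide diff_divide_distrib)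
    then show ?thesis by (simp add: hyperbolic_pythagoras)
  qed
  have s: "sinh a = 2 * ?s * ?c" using sinh_double[of "a / 2"] by simp
  then show sinh: "sinh a = 2 * tanh (a / 2) / (1 - (tanh (a / 2))\<^sup>2)"
    unfolding 1 by (simp add: tanh_def power2_eq_square)
  have "0 < 1 - (tanh (a / 2))\<^sup>2" unfolding 1 by simp
  then show "tanh a = 2 * tanh (a / 2) / (1 + (tanh (a / 2))\<^sup>2)"
    unfolding tanh_def[of a] sinh cosh_double_tanh[of a] by simp
qed

lemma abs_tanh_less_1: "\<bar>tanh a\<bar> < 1" for a :: real
  using tanh_real_bounds[of a] by (simp add: abs_less_iff)

lemma tanh_sq_less_1: "(tanh a)\<^sup>2 < 1" for a :: real
  using abs_tanh_less_1 by (simp add: abs_square_less_1)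

text \<open>The direction of the centre of the second ring, computed along the two sides of the kite.
  After multiplication with conjugates, the factors are positive multiples of those in
  \<open>cis_angle_ring\<close>; the moduli agree because \<open>cosh r cosh R' = cosh R cosh r'\<close> for rings with a
  common modulus.\<close>

lemma (in elliptic_modulus) kite_factor:
  assumes ring: "ring_of k x r R" "ring_of k y r' R'"
  defines "\<tau> \<equiv> complex_of_real (tanh (r / 2))" and "\<sigma> \<equiv> complex_of_real (tanh (R / 2))"
    and "\<tau>' \<equiv> complex_of_real (tanh (r' / 2))" and "\<sigma>' \<equiv> complex_of_real (tanh (R' / 2))"
  shows "(\<tau> + \<i> * \<sigma>') * (1 - \<i> * \<sigma> * \<tau>') = cis (angle x y) * ((\<sigma> - \<i> * \<tau>') * (1 + \<i> * \<tau> * \<sigma>'))"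
proof -
  define a b c d where "a = tanh (r / 2)" and "b = tanh (R' / 2)" and "c = tanh (R / 2)" and "d = tanh (r' / 2)"
  have lt: "a\<^sup>2 < 1" "b\<^sup>2 < 1" "c\<^sup>2 < 1" "d\<^sup>2 < 1"
    using tanh_sq_less_1 by (simp_all add: a_def b_def c_def d_def)
  define A P B T where "A = \<tau> + \<i> * \<sigma>'" and "P = 1 + \<i> * \<tau> * \<sigma>'" and "B = \<sigma> - \<i> * \<tau>'" and "T = 1 - \<i> * \<sigma> * \<tau>'"
  have vals: "A = Complex a b" "P = Complex 1 (a * b)" "B = Complex c (- d)" "T = Complex 1 (- (c * d))"
    by (simp_all add: A_def P_def B_def T_def a_def b_def c_def d_def \<tau>_def \<sigma>_def \<tau>'_def \<sigma>'_def complex_eq_iff)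
  have R: "0 < R" using ring_ofD(9)[OF ring(1)] .
  have nz: "P \<noteq> 0" "B \<noteq> 0" using R by (auto simp: vals complex_eq_iff c_def)
  have nA: "(norm A)\<^sup>2 = a\<^sup>2 + b\<^sup>2" "(norm P)\<^sup>2 = 1 + a\<^sup>2 * b\<^sup>2" "(norm B)\<^sup>2 = c\<^sup>2 + d\<^sup>2" "(norm T)\<^sup>2 = 1 + c\<^sup>2 * d\<^sup>2"
    by (simp_all add: vals cmod_power2 power_mult_distrib)
  have "cosh r * cosh R' = cosh R * cosh r'"
  proof -
    have "0 < sn k x" "0 < sn k y" using ring_ofD(1,2)[OF ring(1)] ring_ofD(1,2)[OF ring(2)] sn_pos by blast+
    moreover have "cosh r = 1 / sn k x" "cosh R = 1 / (k * sn k x)" "cosh r' = 1 / sn k y" "cosh R' = 1 / (k * sn k y)"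
      using ring_ofD(3,6)[OF ring(1)] ring_ofD(3,6)[OF ring(2)] calculation k_pos by (simp_all add: field_simps)
    ultimately show ?thesis by simp
  qed
  then have ratio: "(1 + a\<^sup>2) / (1 - a\<^sup>2) * ((1 + b\<^sup>2) / (1 - b\<^sup>2)) = (1 + c\<^sup>2) / (1 - c\<^sup>2) * ((1 + d\<^sup>2) / (1 - d\<^sup>2))"
    unfolding a_def b_def c_def d_def cosh_double_tanh[symmetric] .
  have "(a\<^sup>2 + b\<^sup>2) * (1 + c\<^sup>2 * d\<^sup>2) = (c\<^sup>2 + d\<^sup>2) * (1 + a\<^sup>2 * b\<^sup>2)"
  proof -
    have "(1 + a\<^sup>2) * (1 + b\<^sup>2) * ((1 - c\<^sup>2) * (1 - d\<^sup>2)) = (1 + c\<^sup>2) * (1 + d\<^sup>2) * ((1 - a\<^sup>2) * (1 - b\<^sup>2))"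
      using ratio lt by (simp add: frac_eq_eq)
    then show ?thesis by algebra
  qed
  then have "(norm (A * T))\<^sup>2 = (norm (B * P))\<^sup>2"
    by (simp add: norm_mult power_mult_distrib nA)
  then have norm: "norm (A * T) = norm (B * P)"
    by (simp only: power2_eq_iff_nonneg norm_ge_zero)
  have scale: "Complex (u * (1 + v\<^sup>2)) (v * (1 - u\<^sup>2)) = of_real ((1 - u\<^sup>2) * (1 + v\<^sup>2) / 2) *
      Complex (2 * u / (1 - u\<^sup>2)) (2 * v / (1 + v\<^sup>2))" if "u\<^sup>2 < 1" for u v :: real
  proof -
    have "0 < 1 + v\<^sup>2" by (simp add: add_pos_nonneg)
    then show ?thesis using that by (simp add: complex_eq_iff)
  qed
  have "A * cnj P = Complex (a * (1 + b\<^sup>2)) (b * (1 - a\<^sup>2))"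
    by (simp add: vals complex_eq_iff power2_eq_square algebra_simps)
  then have AP: "A * cnj P = of_real ((1 - a\<^sup>2) * (1 + b\<^sup>2) / 2) * Complex (sinh r) (tanh R')"
    unfolding scale[OF lt(1)] sinh_half[of r, folded a_def] tanh_half[of R', folded b_def] .
  have "T * cnj B = Complex (c * (1 + d\<^sup>2)) (d * (1 - c\<^sup>2))"
    by (simp add: vals complex_eq_iff power2_eq_square algebra_simps)
  then have TB: "T * cnj B = of_real ((1 - c\<^sup>2) * (1 + d\<^sup>2) / 2) * Complex (sinh R) (tanh r')"
    unfolding scale[OF lt(3)] sinh_half[of R, folded c_def] tanh_half[of r', folded d_def] .
  have "0 < (1 - a\<^sup>2) * (1 + b\<^sup>2) / 2" "0 < (1 - c\<^sup>2) * (1 + d\<^sup>2) / 2"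
    using lt by (simp_all add: add_pos_nonneg)
  then have "sgn (A * cnj P) * sgn (T * cnj B) = cis (angle x y)"
    unfolding AP TB sgn_mult sgn_of_real cis_angle_ring[OF ring] by simp
  moreover have "sgn (A * cnj P) * sgn (T * cnj B) = sgn (A * T) * cnj (sgn (B * P))"
    by (simp add: sgn_mult mult_ac) (simp add: sgn_eq)
  moreover have "cnj (sgn (B * P)) * sgn (B * P) = 1"
    using nz by (metis complex_norm_square mult.commute mult_eq_0_iff norm_sgn of_real_1 one_power2)
  ultimately have "cis (angle x y) * sgn (B * P) = sgn (A * T)"
    by (metis mult.assoc mult_1_right)
  then have "cis (angle x y) * (B * P) = A * T"
    using nz norm by (simp add: sgn_eq)
  then show ?thesis by (simp add: A_def B_def P_def T_def)
qed

text \<open>Both sides are Moebius transformations of \<open>z\<close>. The first relation says that they agree at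
  the origin; the other two then make their numerators and their denominators proportional. In the
  application \<open>j\<close> is \<open>\<i>\<close> or \<open>-\<i>\<close>, the numbers \<open>a, b, c, d\<close> are real, and the third relation
  compares moduli.\<close>

lemma kite_identity_algebra:
  fixes a b c d z j u u' :: complex
  assumes j: "j * j = - 1"
    and 1: "(a + j * b) * (1 - j * c * d) = u * ((c - j * d) * (1 + j * a * b))"
    and 2: "(d + j * c) * (1 - j * b * a) = u' * ((b - j * a) * (1 + j * d * c))"
    and 3: "(a - j * b) * (1 + j * c * d) * (a + j * b) * (1 - j * c * d) =
      (c + j * d) * (1 - j * a * b) * (c - j * d) * (1 + j * a * b)"
    and nz: "a + j * b \<noteq> 0" "c - j * d \<noteq> 0" "1 - j * c * d \<noteq> 0" "1 + j * a * b \<noteq> 0" "1 + j * c * d \<noteq> 0" "1 - j * a * b \<noteq> 0"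
      "1 - b * z \<noteq> 0" "1 - d * (u' * z) \<noteq> 0"
      "1 + a * (- j * ((z - b) / (1 - b * z))) \<noteq> 0"
  shows "(- j * ((z - b) / (1 - b * z)) + a) / (1 + a * (- j * ((z - b) / (1 - b * z)))) =
    u * ((j * ((u' * z - d) / (1 - d * (u' * z))) + c) / (1 + c * (j * ((u' * z - d) / (1 - d * (u' * z))))))"
proof -
  define A P B T where "A = a + j * b" and "P = 1 + j * a * b" and "B = c - j * d" and "T = 1 - j * c * d"
  define A' P' B' T' where "A' = a - j * b" and "P' = 1 - j * a * b" and "B' = c + j * d" and "T' = 1 + j * c * d"
  note defs = A_def P_def B_def T_def A'_def P'_def B'_def T'_def
  define y where "y = u' * z"
  have n: "A \<noteq> 0" "B \<noteq> 0" "T \<noteq> 0" "P \<noteq> 0" "T' \<noteq> 0" "P' \<noteq> 0" using nz by (simp_all add: defs)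
  have jb: "j * (j * w) = - w" for w using j by (simp add: mult.assoc[symmetric])
  have num: "- j * ((z - b) / (1 - b * z)) + a = (A - j * P' * z) / (1 - b * z)"
    and den: "1 + a * (- j * ((z - b) / (1 - b * z))) = (P - j * A' * z) / (1 - b * z)"
    using nz(7) j by (simp_all add: defs field_simps jb)
  then have l1: "(- j * ((z - b) / (1 - b * z)) + a) / (1 + a * (- j * ((z - b) / (1 - b * z)))) = (A - j * P' * z) / (P - j * A' * z)"
    using nz(7) by simp
  have l2: "(j * ((y - d) / (1 - d * y)) + c) / (1 + c * (j * ((y - d) / (1 - d * y)))) = (B + j * T' * y) / (T + j * B' * y)"
  proof -
    have nz8: "1 - d * y \<noteq> 0" using nz(8) by (simp add: y_def)
    have "j * ((y - d) / (1 - d * y)) + c = (B + j * T' * y) / (1 - d * y)"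
      using nz8 j by (simp add: defs field_simps jb)
    moreover have "1 + c * (j * ((y - d) / (1 - d * y))) = (T + j * B' * y) / (1 - d * y)"
      using nz8 j by (simp add: defs field_simps jb)
    ultimately show ?thesis using nz8 by simp
  qed
  have e1: "A * T = u * (B * P)" using 1 by (simp add: defs)
  have e2: "B * P' = - u' * (A * T')"
  proof -
    have "j * B * P' = u' * (- j * A * T')"
      using 2 j by (simp add: defs algebra_simps jb)
    then have "j * (B * P') = j * (- u' * (A * T'))" by (simp add: mult_ac)
    moreover have "j \<noteq> 0" using j by auto
    ultimately show ?thesis using mult_left_cancel by blast
  qed
  have e3: "A' * T' * A * T = B' * P' * B * P" using 3 by (simp add: defs)
  have f1: "A * (B + j * T' * y) = B * (A - j * P' * z)"
  proof -
    have "A * (B + j * T' * y) = A * B - j * z * (- u' * (A * T'))"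
      by (simp add: y_def algebra_simps)
    also have "\<dots> = B * (A - j * P' * z)"
      unfolding e2[symmetric] by (simp add: algebra_simps)
    finally show ?thesis .
  qed
  have f2: "P * (T + j * B' * y) = T * (P - j * A' * z)"
  proof -
    have "(A * T') * (P * (T + j * B' * y)) = (A * T') * (P * T) - j * z * (P * B' * (- u' * (A * T')))"
      by (simp add: y_def algebra_simps)
    also have "\<dots> = (A * T') * (P * T) - j * z * (B' * P' * B * P)"
      unfolding e2[symmetric] by (simp add: algebra_simps)
    also have "\<dots> = (A * T') * (T * (P - j * A' * z))"
      unfolding e3[symmetric] by (simp add: algebra_simps)
    finally show ?thesis using n by simp
  qed
  have d1: "P - j * A' * z \<noteq> 0"
    using nz(9) den by auto
  then have d2: "T + j * B' * y \<noteq> 0" using f2 n by (metis mult_eq_0_iff)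
  have "u * ((B + j * T' * y) / (T + j * B' * y)) = (A - j * P' * z) / (P - j * A' * z)"
  proof -
    have "(u * (B * P)) * ((B + j * T' * y) * (P - j * A' * z)) = (A * (B + j * T' * y)) * (T * (P - j * A' * z))"
      unfolding e1[symmetric] by (simp add: mult_ac)
    also have "\<dots> = (B * P) * ((A - j * P' * z) * (T + j * B' * y))"
      unfolding f1 f2[symmetric] by (simp add: mult_ac)
    finally have "(B * P) * (u * (B + j * T' * y) * (P - j * A' * z)) = (B * P) * ((A - j * P' * z) * (T + j * B' * y))"
      by (simp add: mult_ac)
    then have "u * (B + j * T' * y) * (P - j * A' * z) = (A - j * P' * z) * (T + j * B' * y)"
      using mult_left_cancel[of "B * P"] n by (metis mult_eq_0_iff)
    then show ?thesis by (simp only: times_divide_eq_right frac_eq_eq[OF d2 d1])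
  qed
  from this[symmetric] have "(- j * ((z - b) / (1 - b * z)) + a) / (1 + a * (- j * ((z - b) / (1 - b * z)))) =
      u * ((j * ((y - d) / (1 - d * y)) + c) / (1 + c * (j * ((y - d) / (1 - d * y)))))"
    unfolding l1 l2 .
  then show ?thesis unfolding y_def .
qed

section \<open>Construction of the ring pattern\<close>

text \<open>If one of the four squares is missing, the directions are propagated from one of its ends to
  the other. Otherwise the hypothesis on the sum closes the cycle.\<close>

lemma angle_chain:
  fixes f1 f2 f3 f4 :: real
  assumes "P1 \<Longrightarrow> P2 \<Longrightarrow> P3 \<Longrightarrow> P4 \<Longrightarrow> f1 + f2 + f3 + f4 = 2 * pi"
  shows "\<exists>e n w s :: complex. norm e = 1 \<and> norm n = 1 \<and> norm w = 1 \<and> norm s = 1 \<and>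
    (P1 \<longrightarrow> n = e * cis f1) \<and> (P2 \<longrightarrow> w = n * cis f2) \<and> (P3 \<longrightarrow> s = w * cis f3) \<and> (P4 \<longrightarrow> e = s * cis f4)"
proof -
  consider "\<not> P1" | "\<not> P2" | "\<not> P3" | "P1" "P2" "P3" by blast
  then show ?thesis
  proof cases
    case 1
    then show ?thesis
      by (intro exI[of _ "cis (f2 + f3 + f4)"] exI[of _ 1] exI[of _ "cis f2"] exI[of _ "cis (f2 + f3)"])
         (simp add: cis_mult)
  next
    case 2
    then show ?thesis
      by (intro exI[of _ "cis (f3 + f4)"] exI[of _ "cis (f3 + f4 + f1)"] exI[of _ 1] exI[of _ "cis f3"])
         (simp add: cis_mult)
  next
    case 3
    then show ?thesis
      by (intro exI[of _ "cis f4"] exI[of _ "cis (f4 + f1)"] exI[of _ "cis (f4 + f1 + f2)"] exI[of _ 1])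
         (simp add: cis_mult)
  next
    case 4
    have "1 = cis (f1 + f2 + f3) * cis f4" if P4
      using assms[OF 4 that] by (simp add: cis_mult)
    then show ?thesis
      by (intro exI[of _ 1] exI[of _ "cis f1"] exI[of _ "cis (f1 + f2)"] exI[of _ "cis (f1 + f2 + f3)"])
         (simp add: cis_mult)
  qed
qed

lemma disc_trans_eq: "norm z < 1 \<Longrightarrow> disc_trans t z = (z + of_real t) / (1 + of_real t * z)"
  by (simp add: disc_trans_def hdir_def)

lemma norm_disc_trans: "\<bar>t\<bar> < 1 \<Longrightarrow> norm z < 1 \<Longrightarrow> norm (disc_trans t z) < 1"
  using disc_iso_in_ball[OF disc_iso_trans, of t z] by simp

lemma one_plus_real_mult_nonzero:
  assumes "\<bar>t\<bar> < 1" "norm (z::complex) < 1"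
  shows "1 + of_real t * z \<noteq> 0"
  using hdir_denom_nonzero[of "- of_real t" z] assms by simp

context elliptic_modulus
begin

text \<open>Walking along the two sides \<open>p x p'\<close> and \<open>p y p'\<close> of the kite leads to the same frame at
  \<open>p'\<close>. With signed radii this holds for all orientations of the rings.\<close>

lemma kite_identity:
  assumes ring: "ring_of k x r R" "ring_of k y r' R'" and s: "\<bar>s\<bar> = 1"
  shows "disc_trans (tanh (r / 2)) \<circ> disc_rot (- \<i> * of_real s) \<circ> disc_trans (- tanh (R' / 2)) =
    disc_rot (cis (s * angle x y)) \<circ> disc_trans (tanh (R / 2)) \<circ> disc_rot (\<i> * of_real s) \<circ>
      disc_trans (- tanh (r' / 2)) \<circ> disc_rot (cis (s * angle y x))"
proof
  fix z :: complex
  define a b c d where "a = tanh (r / 2)" and "b = tanh (R' / 2)" and "c = tanh (R / 2)" and "d = tanh (r' / 2)"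
  have lt: "\<bar>a\<bar> < 1" "\<bar>b\<bar> < 1" "\<bar>c\<bar> < 1" "\<bar>d\<bar> < 1"
    unfolding a_def b_def c_def d_def by (rule abs_tanh_less_1)+
  have pos: "0 < b" "0 < c" using ring_ofD(9) ring by (auto simp: b_def c_def)
  define j where "j = \<i> * complex_of_real s"
  have ss: "s = 1 \<or> s = - 1" using s by auto
  have j: "j * j = - 1" using ss by (auto simp: j_def)
  have nj: "norm j = 1" using s by (simp add: j_def norm_mult)
  have signed: "(of_real a' + j * of_real b') * (1 - j * of_real c' * of_real d') =
      cis (s * t) * ((of_real c' - j * of_real d') * (1 + j * of_real a' * of_real b'))"
    if *: "(of_real a' + \<i> * of_real b') * (1 - \<i> * of_real c' * of_real d') =
      cis t * ((of_real c' - \<i> * of_real d') * (1 + \<i> * of_real a' * of_real b'))" for a' b' c' d' t :: real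
    using ss
  proof
    assume s1: "s = 1"
    then have j1: "j = \<i>" by (simp add: j_def)
    from * show ?thesis unfolding j1 s1 mult_1 .
  next
    assume "s = - 1"
    then have j1: "j = - \<i>" and c1: "cis (s * t) = cnj (cis t)" by (simp_all add: j_def cis_cnj)
    from arg_cong[OF *, of cnj] show ?thesis
      unfolding j1 c1
      by (simp only: complex_cnj_mult complex_cnj_add complex_cnj_diff complex_cnj_one complex_cnj_i
          complex_cnj_complex_of_real)
  qed
  note 1 = signed[OF kite_factor[OF ring, folded a_def b_def c_def d_def]]
  note 2 = signed[OF kite_factor[OF ring(2,1), folded a_def b_def c_def d_def]]
  have cj: "cnj j = - j" by (simp add: j_def)
  have 3: "(of_real a - j * of_real b) * (1 + j * of_real c * of_real d) * (of_real a + j * of_real b) * (1 - j * of_real c * of_real d) =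
      (of_real c + j * of_real d) * (1 - j * of_real a * of_real b) * (of_real c - j * of_real d) * (1 + j * of_real a * of_real b)"
  proof -
    let ?u = "cis (s * angle x y)"
    have u: "cnj ?u * ?u = 1"
      by (simp add: cis_cnj cis_mult)
    have "(of_real a + - j * of_real b) * (1 - - j * of_real c * of_real d) =
        cnj ?u * ((of_real c - - j * of_real d) * (1 + - j * of_real a * of_real b))"
      using arg_cong[OF 1, of cnj]
      by (simp only: complex_cnj_mult complex_cnj_add complex_cnj_diff complex_cnj_one cj
          complex_cnj_complex_of_real)
    then have c1: "(of_real a - j * of_real b) * (1 + j * of_real c * of_real d) =
        cnj ?u * ((of_real c + j * of_real d) * (1 - j * of_real a * of_real b))"
      by (simp only: mult_minus_left diff_minus_eq_add add_uminus_conv_diff)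
    have "(of_real a - j * of_real b) * (1 + j * of_real c * of_real d) * ((of_real a + j * of_real b) * (1 - j * of_real c * of_real d))
        = (cnj ?u * ?u) * (((of_real c + j * of_real d) * (1 - j * of_real a * of_real b)) * ((of_real c - j * of_real d) * (1 + j * of_real a * of_real b)))"
      unfolding c1 1 by (simp only: mult_ac)
    then show ?thesis unfolding u by (simp only: mult_1 mult.assoc)
  qed
  show "(disc_trans (tanh (r / 2)) \<circ> disc_rot (- \<i> * of_real s) \<circ> disc_trans (- tanh (R' / 2))) z =
    (disc_rot (cis (s * angle x y)) \<circ> disc_trans (tanh (R / 2)) \<circ> disc_rot (\<i> * of_real s) \<circ>
      disc_trans (- tanh (r' / 2)) \<circ> disc_rot (cis (s * angle y x))) z"
  proof (cases "norm z < 1")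
    case False
    then show ?thesis by (simp add: disc_trans_def disc_rot_def)
  next
    case True
    let ?u = "cis (s * angle x y)" and ?u' = "cis (s * angle y x)"
    define z1 where "z1 = (z - of_real b) / (1 - of_real b * z)"
    define z2 where "z2 = (?u' * z - of_real d) / (1 - of_real d * (?u' * z))"
    have u'z: "norm (?u' * z) < 1" using True by (simp add: norm_mult)
    have z1: "disc_trans (- b) z = z1" "norm z1 < 1"
      using disc_trans_eq[OF True, of "- b"] norm_disc_trans[of "- b" z] lt True by (simp_all add: z1_def)
    have z2: "disc_trans (- d) (?u' * z) = z2" "norm z2 < 1"
      using disc_trans_eq[OF u'z, of "- d"] norm_disc_trans[of "- d" "?u' * z"] lt u'z by (simp_all add: z2_def)
    have njz: "norm (- j * z1) < 1" "norm (j * z2) < 1" using z1 z2 nj by (simp_all add: norm_mult)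
    have L: "(disc_trans a \<circ> disc_rot (- j) \<circ> disc_trans (- b)) z = (- j * z1 + of_real a) / (1 + of_real a * (- j * z1))"
      using z1 njz disc_trans_eq[OF njz(1), of a] by (simp add: disc_rot_def)
    have "norm (disc_trans c (j * z2)) < 1" using norm_disc_trans lt njz by blast
    then have R: "(disc_rot ?u \<circ> disc_trans c \<circ> disc_rot j \<circ> disc_trans (- d) \<circ> disc_rot ?u') z =
        ?u * ((j * z2 + of_real c) / (1 + of_real c * (j * z2)))"
      using z2 njz True disc_trans_eq[OF njz(2), of c] by (simp add: disc_rot_def)
    have nz: "1 - of_real b * z \<noteq> 0" "1 - of_real d * (?u' * z) \<noteq> 0" "1 + of_real a * (- j * z1) \<noteq> 0"
      using one_plus_real_mult_nonzero[of "- b" z] one_plus_real_mult_nonzero[of "- d" "?u' * z"]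
        one_plus_real_mult_nonzero[of a "- j * z1"] lt True u'z njz by simp_all
    have nz2: "of_real a + j * of_real b \<noteq> 0" "of_real c - j * of_real d \<noteq> 0"
      "1 - j * of_real c * of_real d \<noteq> 0" "1 + j * of_real a * of_real b \<noteq> 0"
      "1 + j * of_real c * of_real d \<noteq> 0" "1 - j * of_real a * of_real b \<noteq> 0"
      using pos ss by (auto simp: complex_eq_iff j_def)
    have "(- j * z1 + of_real a) / (1 + of_real a * (- j * z1)) = ?u * ((j * z2 + of_real c) / (1 + of_real c * (j * z2)))"
      unfolding z1_def z2_def by (rule kite_identity_algebra[OF j 1 2 3 nz2 nz[unfolded z1_def]])
    then show ?thesis
      using L R by (simp add: j_def flip: a_def b_def c_def d_def)
  qed
qed

lemma vertex_directions:
  assumes inner: "v \<in> inner_verts Q \<Longrightarrow> (\<Sum>w\<in>nbs Q v. angle (\<gamma> v) (\<gamma> w)) = 2 * pi"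
  shows "\<exists>\<alpha>. (\<forall>u. norm (\<alpha> u) = 1) \<and>
    (\<forall>w. nb Q v w \<longrightarrow> \<alpha> (fst v, snd w) = \<alpha> (fst w, snd v) * cis (side_sign v w * angle (\<gamma> v) (\<gamma> w)))"
proof -
  obtain m n where mn: "v = (m, n)" by (cases v)
  let ?NE = "(m + 1, n + 1)" and ?NW = "(m - 1, n + 1)" and ?SW = "(m - 1, n - 1)" and ?SE = "(m + 1, n - 1)"
  let ?f = "\<lambda>w. angle (\<gamma> v) (\<gamma> w)"
  have sum: "?f ?NE + ?f ?NW + ?f ?SW + ?f ?SE = 2 * pi" if "nb Q v ?NE" "nb Q v ?NW" "nb Q v ?SW" "nb Q v ?SE"
  proof -
    have nbs: "nbs Q v = {?NE, ?NW, ?SW, ?SE}"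
      using that nbs_subset[of Q v] by (auto simp: nbs_def nb_candidates_def mn)
    then have "valence Q v = 4" by (simp add: valence_4_iff nb_candidates_def mn)
    then have "v \<in> inner_verts Q" using that(1) nb_in_G by (simp add: inner_verts_def)
    from inner[OF this] show ?thesis unfolding nbs by (simp add: add.assoc)
  qed
  have "\<exists>e n' w s :: complex. norm e = 1 \<and> norm n' = 1 \<and> norm w = 1 \<and> norm s = 1 \<and>
      (nb Q v ?NE \<longrightarrow> n' = e * cis (?f ?NE)) \<and> (nb Q v ?NW \<longrightarrow> w = n' * cis (?f ?NW)) \<and>
      (nb Q v ?SW \<longrightarrow> s = w * cis (?f ?SW)) \<and> (nb Q v ?SE \<longrightarrow> e = s * cis (?f ?SE))"
    by (rule angle_chain[OF sum])
  then obtain e n' w s :: complex where c: "norm e = 1" "norm n' = 1" "norm w = 1" "norm s = 1"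
    "nb Q v ?NE \<Longrightarrow> n' = e * cis (?f ?NE)" "nb Q v ?NW \<Longrightarrow> w = n' * cis (?f ?NW)"
    "nb Q v ?SW \<Longrightarrow> s = w * cis (?f ?SW)" "nb Q v ?SE \<Longrightarrow> e = s * cis (?f ?SE)"
    by blast
  define \<alpha> where "\<alpha> u = (if u = (m + 1, n) then e else if u = (m, n + 1) then n' else if u = (m - 1, n) then w else s)"
    for u :: "int \<times> int"
  have rotate_back: "z = z * cis t * cis (- t)" for z t by (simp add: cis_mult mult.assoc)
  have "\<alpha> (fst v, snd u) = \<alpha> (fst u, snd v) * cis (side_sign v u * ?f u)" if nb: "nb Q v u" for u
  proof -
    have "u \<in> nb_candidates v" using nb nbs_subset[of Q v] by (auto simp: nbs_def)
    then consider "u = ?NE" | "u = ?NW" | "u = ?SW" | "u = ?SE" by (auto simp: nb_candidates_def mn)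
    then show ?thesis
    proof cases
      case 1
      have "side_sign v u = 1" by (simp add: side_sign_def 1 mn)
      then show ?thesis using c(5) nb by (simp add: \<alpha>_def 1 mn)
    next
      case 2
      have "side_sign v u = - 1" by (simp add: side_sign_def 2 mn)
      then show ?thesis using c(6) nb rotate_back[of n' "?f ?NW"] by (simp add: \<alpha>_def 2 mn)
    next
      case 3
      have "side_sign v u = 1" by (simp add: side_sign_def 3 mn)
      then show ?thesis using c(7) nb by (simp add: \<alpha>_def 3 mn)
    next
      case 4
      have "side_sign v u = - 1" by (simp add: side_sign_def 4 mn)
      then show ?thesis using c(8) nb rotate_back[of s "?f ?SE"] by (simp add: \<alpha>_def 4 mn)
    qed
  qed
  moreover have "norm (\<alpha> u) = 1" for u using c(1-4) by (simp add: \<alpha>_def)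
  ultimately show ?thesis by blast
qed

end

text \<open>The direction of an edge of the lattice; the value for \<open>u = v\<close> only serves to make it a unit
  number.\<close>

definition edge_dir :: "int \<times> int \<Rightarrow> int \<times> int \<Rightarrow> complex" where
  "edge_dir v u = (if u = v then 1 else sgn (Complex (of_int (fst u - fst v)) (of_int (snd u - snd v))))"

lemma norm_edge_dir: "norm (edge_dir v u) = 1"
  by (auto simp: edge_dir_def norm_sgn prod_eq_iff complex_eq_iff)

lemma edge_dir_horizontal: "edge_dir v (a, snd v) = of_int (a - fst v)" if "\<bar>a - fst v\<bar> = 1"
proof -
  have "a = fst v + 1 \<or> a = fst v - 1" using that by linarith
  then show ?thesis
    by (cases v) (auto simp: edge_dir_def complex_eq_iff sgn_eq cmod_def)
qed

lemma edge_dir_vertical: "edge_dir v (fst v, b) = \<i> * of_int (b - snd v)" if "\<bar>b - snd v\<bar> = 1"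
proof -
  have "b = snd v + 1 \<or> b = snd v - 1" using that by linarith
  then show ?thesis
    by (cases v) (auto simp: edge_dir_def complex_eq_iff sgn_eq cmod_def)
qed

definition half_tanh :: "(int \<times> int \<Rightarrow> real) \<Rightarrow> (int \<times> int \<Rightarrow> real) \<Rightarrow> int \<times> int \<Rightarrow> int \<times> int \<Rightarrow> real" where
  "half_tanh r R v u = tanh ((if snd u = snd v then r v else R v) / 2)"

lemma abs_half_tanh: "\<bar>half_tanh r R v u\<bar> < 1"
  by (simp add: half_tanh_def abs_tanh_less_1)

lemma disc_rot_cnj: "norm u = 1 \<Longrightarrow> disc_rot u \<circ> disc_rot (cnj u) = id" "norm u = 1 \<Longrightarrow> disc_rot (cnj u) \<circ> disc_rot u = id"
proof -
  assume u: "norm u = 1"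
  have "u * cnj u = 1" using u by (metis complex_norm_square of_real_1 one_power2)
  then show "disc_rot u \<circ> disc_rot (cnj u) = id" "disc_rot (cnj u) \<circ> disc_rot u = id"
    using u by (simp_all add: disc_rot_rot mult.commute)
qed

text \<open>The frame at \<open>u\<close> relative to the frame at \<open>v\<close>: the frame at a point of \<open>G\<^sup>*\<close> has its
  coordinate axes along the edges of the lattice, and \<open>\<alpha> v u\<close> is the direction of the edge in the
  frame at \<open>v\<close>.\<close>

definition edge_frame where
  "edge_frame \<alpha> r R v u = disc_rot (\<alpha> v u) \<circ> disc_trans (half_tanh r R v u) \<circ> disc_rot (cnj (edge_dir v u))"

definition edge_frame_inv where
  "edge_frame_inv \<alpha> r R v u = disc_rot (edge_dir v u) \<circ> disc_trans (- half_tanh r R v u) \<circ> disc_rot (cnj (\<alpha> v u))"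

lemma edge_frame_inverse:
  assumes "norm (\<alpha> v u) = 1"
  shows "edge_frame \<alpha> r R v u \<circ> edge_frame_inv \<alpha> r R v u = id"
    and "edge_frame_inv \<alpha> r R v u \<circ> edge_frame \<alpha> r R v u = id"
proof -
  let ?A = "disc_rot (\<alpha> v u)" and ?A' = "disc_rot (cnj (\<alpha> v u))" and ?D = "disc_rot (edge_dir v u)"
    and ?D' = "disc_rot (cnj (edge_dir v u))" and ?T = "disc_trans (half_tanh r R v u)" and ?T' = "disc_trans (- half_tanh r R v u)"
  have T: "?T \<circ> ?T' = id" "?T' \<circ> ?T = id"
    using disc_trans_minus[of "half_tanh r R v u"] disc_trans_minus[of "- half_tanh r R v u"] abs_half_tanh by simp_all
  have "edge_frame \<alpha> r R v u \<circ> edge_frame_inv \<alpha> r R v u = ?A \<circ> (?T \<circ> (?D' \<circ> ?D) \<circ> ?T') \<circ> ?A'"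
    by (simp only: edge_frame_def edge_frame_inv_def comp_assoc)
  then show "edge_frame \<alpha> r R v u \<circ> edge_frame_inv \<alpha> r R v u = id"
    by (simp only: disc_rot_cnj[OF norm_edge_dir] disc_rot_cnj[OF assms] T comp_id id_comp)
  have "edge_frame_inv \<alpha> r R v u \<circ> edge_frame \<alpha> r R v u = ?D \<circ> (?T' \<circ> (?A' \<circ> ?A) \<circ> ?T) \<circ> ?D'"
    by (simp only: edge_frame_def edge_frame_inv_def comp_assoc)
  then show "edge_frame_inv \<alpha> r R v u \<circ> edge_frame \<alpha> r R v u = id"
    by (simp only: disc_rot_cnj[OF norm_edge_dir] disc_rot_cnj[OF assms] T comp_id id_comp)
qed

lemma disc_iso_edge_frame:
  assumes "norm (\<alpha> v u) = 1"
  shows "disc_iso (edge_frame \<alpha> r R v u)" "disc_iso (edge_frame_inv \<alpha> r R v u)"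
  unfolding edge_frame_def edge_frame_inv_def using assms norm_edge_dir[of v u] abs_half_tanh[of r R v u]
  by (auto intro!: disc_iso_comp disc_iso_rot disc_iso_trans)

lemma edge_frame_0:
  "edge_frame \<alpha> r R v u 0 = \<alpha> v u * of_real (half_tanh r R v u)"
  "edge_frame_inv \<alpha> r R v u 0 = - edge_dir v u * of_real (half_tanh r R v u)"
  using abs_half_tanh[of r R v u]
  by (simp_all add: edge_frame_def edge_frame_inv_def disc_rot_def disc_trans_def hdir_def)

text \<open>Flatness of the connection around a square: up to the choice of directions at \<open>v\<close> and \<open>w\<close>
  this is \<open>kite_identity\<close>.\<close>

lemma (in elliptic_modulus) edge_frame_square:
  assumes ring: "ring_of k (\<gamma> v) (r v) (R v)" "ring_of k (\<gamma> w) (r w) (R w)" and nb: "nb Q v w"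
    and unit: "\<And>v u. norm (\<alpha> v u) = 1"
    and \<alpha>: "\<And>v w. nb Q v w \<Longrightarrow> \<alpha> v (fst v, snd w) = \<alpha> v (fst w, snd v) * cis (side_sign v w * angle (\<gamma> v) (\<gamma> w))"
  shows "edge_frame \<alpha> r R v (fst w, snd v) \<circ> edge_frame_inv \<alpha> r R w (fst w, snd v) =
    edge_frame \<alpha> r R v (fst v, snd w) \<circ> edge_frame_inv \<alpha> r R w (fst v, snd w)"
proof -
  define s where "s = side_sign v w"
  have s: "\<bar>s\<bar> = 1" using abs_side_sign[OF nb] by (simp add: s_def)
  have d: "\<bar>fst w - fst v\<bar> = 1" "\<bar>snd w - snd v\<bar> = 1" "\<bar>fst v - fst w\<bar> = 1" "\<bar>snd v - snd w\<bar> = 1"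
    using nb by (auto simp: nb_def)
  have neq: "snd v \<noteq> snd w" "snd w \<noteq> snd v" using d by auto
  let ?u = "(fst w, snd v)" and ?u' = "(fst v, snd w)"
  have d1: "cnj (edge_dir v ?u) * edge_dir w ?u = - \<i> * of_real s"
    unfolding edge_dir_horizontal[OF d(1)] edge_dir_vertical[OF d(4)]
    by (simp add: s_def side_sign_def algebra_simps)
  have d2: "cnj (edge_dir v ?u') * edge_dir w ?u' = \<i> * of_real s"
    unfolding edge_dir_horizontal[OF d(3)] edge_dir_vertical[OF d(2)]
    by (simp add: s_def side_sign_def algebra_simps)
  have len: "half_tanh r R v ?u = tanh (r v / 2)" "half_tanh r R w ?u = tanh (R w / 2)"
    "half_tanh r R v ?u' = tanh (R v / 2)" "half_tanh r R w ?u' = tanh (r w / 2)"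
    using neq by (simp_all add: half_tanh_def)
  have a1: "\<alpha> v ?u' = \<alpha> v ?u * cis (s * angle (\<gamma> v) (\<gamma> w))"
    using \<alpha>[OF nb] by (simp add: s_def)
  have "\<alpha> w ?u = \<alpha> w ?u' * cis (s * angle (\<gamma> w) (\<gamma> v))"
    using \<alpha>[of w v] nb nb_sym by (simp add: s_def side_sign_commute[of w v])
  then have "cnj (\<alpha> w ?u) * cis (s * angle (\<gamma> w) (\<gamma> v)) = cnj (\<alpha> w ?u')"
    by (simp add: cis_cnj cis_mult mult.assoc)
  then have a2: "cis (s * angle (\<gamma> w) (\<gamma> v)) * cnj (\<alpha> w ?u) = cnj (\<alpha> w ?u')"
    by (simp add: mult.commute)
  have "edge_frame \<alpha> r R v ?u \<circ> edge_frame_inv \<alpha> r R w ?u = disc_rot (\<alpha> v ?u) \<circ>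
      (disc_trans (tanh (r v / 2)) \<circ> (disc_rot (cnj (edge_dir v ?u)) \<circ> disc_rot (edge_dir w ?u)) \<circ> disc_trans (- tanh (R w / 2))) \<circ> disc_rot (cnj (\<alpha> w ?u))"
    by (simp only: edge_frame_def edge_frame_inv_def comp_assoc len)
  also have "\<dots> = disc_rot (\<alpha> v ?u) \<circ> (disc_rot (cis (s * angle (\<gamma> v) (\<gamma> w))) \<circ> disc_trans (tanh (R v / 2)) \<circ> disc_rot (\<i> * of_real s) \<circ>
      disc_trans (- tanh (r w / 2)) \<circ> disc_rot (cis (s * angle (\<gamma> w) (\<gamma> v)))) \<circ> disc_rot (cnj (\<alpha> w ?u))"
    unfolding disc_rot_rot[OF norm_edge_dir] d1 kite_identity[OF ring s] ..
  also have "\<dots> = (disc_rot (\<alpha> v ?u) \<circ> disc_rot (cis (s * angle (\<gamma> v) (\<gamma> w)))) \<circ> disc_trans (tanh (R v / 2)) \<circ> disc_rot (\<i> * of_real s) \<circ>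
      disc_trans (- tanh (r w / 2)) \<circ> (disc_rot (cis (s * angle (\<gamma> w) (\<gamma> v))) \<circ> disc_rot (cnj (\<alpha> w ?u)))"
    by (simp only: comp_assoc)
  also have "\<dots> = disc_rot (\<alpha> v ?u') \<circ> disc_trans (tanh (R v / 2)) \<circ> (disc_rot (cnj (edge_dir v ?u')) \<circ> disc_rot (edge_dir w ?u')) \<circ>
      disc_trans (- tanh (r w / 2)) \<circ> disc_rot (cnj (\<alpha> w ?u'))"
    using unit by (simp only: disc_rot_rot norm_cis norm_edge_dir complex_mod_cnj a1[symmetric] a2 d2)
  also have "\<dots> = edge_frame \<alpha> r R v ?u' \<circ> edge_frame_inv \<alpha> r R w ?u'"
    by (simp only: edge_frame_def edge_frame_inv_def comp_assoc len)
  finally show ?thesis .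
qed

context elliptic_modulus
begin

text \<open>The frames are distributed over the complex by \<open>edge_connection_trivial\<close>. As each condition
  on a ring pattern concerns the neighbourhood of a single vertex, it can be checked in the frame
  at this vertex, where the adjacent points are known explicitly.\<close>

lemma ring_pattern_exists:
  assumes "simply_connected (cells Q)"
    and range: "\<And>j. j \<in> G Q \<Longrightarrow> 0 < \<gamma> j \<and> \<gamma> j < 2 * ellK k"
    and inner: "\<And>v. v \<in> inner_verts Q \<Longrightarrow> (\<Sum>w\<in>nbs Q v. angle (\<gamma> v) (\<gamma> w)) = 2 * pi"
  shows "\<exists>p r R l. ring_pattern Q p r R l \<and> (\<forall>j\<in>G Q. ring_of k (\<gamma> j) (r j) (R j))"
proof (cases "Q = {}")
  case True
  then show ?thesis
    by (simp add: ring_pattern_def G_def Gstar_def verts_def nb_def inner_verts_def)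
next
  case False
  define r where "r v = arsinh (cn k (\<gamma> v) / sn k (\<gamma> v))" for v
  define R where "R v = arcosh (1 / (k * sn k (\<gamma> v)))" for v
  have ring: "ring_of k (\<gamma> v) (r v) (R v)" if "v \<in> G Q" for v
    unfolding r_def R_def using ring_of_exists range[OF that] by blast
  have "\<forall>v. \<exists>\<alpha>. (\<forall>u. norm (\<alpha> u) = 1) \<and>
      (\<forall>w. nb Q v w \<longrightarrow> \<alpha> (fst v, snd w) = \<alpha> (fst w, snd v) * cis (side_sign v w * angle (\<gamma> v) (\<gamma> w)))"
    using vertex_directions[OF inner] by blast
  from choice[OF this] obtain \<alpha> :: "int \<times> int \<Rightarrow> int \<times> int \<Rightarrow> complex"
    where \<alpha>': "\<forall>v. (\<forall>u. norm (\<alpha> v u) = 1) \<and>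
      (\<forall>w. nb Q v w \<longrightarrow> \<alpha> v (fst v, snd w) = \<alpha> v (fst w, snd v) * cis (side_sign v w * angle (\<gamma> v) (\<gamma> w)))"
    by blast
  then have unit: "norm (\<alpha> v u) = 1"
    and \<alpha>: "nb Q v w \<Longrightarrow> \<alpha> v (fst v, snd w) = \<alpha> v (fst w, snd v) * cis (side_sign v w * angle (\<gamma> v) (\<gamma> w))" for u v w
    by blast+
  let ?e = "edge_frame \<alpha> r R" and ?e' = "edge_frame_inv \<alpha> r R" and ?t = "half_tanh r R"
  have square: "?e v (fst w, snd v) \<circ> ?e' w (fst w, snd v) = ?e v (fst v, snd w) \<circ> ?e' w (fst v, snd w)"
    if nb: "nb Q v w" for v w
    by (rule edge_frame_square[OF ring ring nb unit \<alpha>]) (rule nb_in_G[OF nb])+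
  obtain h where frame: "\<And>s v u. s \<in> Q \<Longrightarrow> v \<in> corners s \<Longrightarrow> u \<in> corners s \<Longrightarrow> even (fst v + snd v) \<Longrightarrow>
      odd (fst u + snd u) \<Longrightarrow> h v \<circ> ?e v u = h u"
    and iso: "\<And>a. a \<in> verts Q \<Longrightarrow> disc_iso (h a)"
  proof (rule edge_connection_trivial[OF assms(1) False, of ?e ?e' disc_iso])
    show "?e v u \<circ> ?e' v u = id" "?e' v u \<circ> ?e v u = id" for v u
      by (rule edge_frame_inverse[of \<alpha> v u, OF unit])+
    show "?e v (fst w, snd v) \<circ> ?e' w (fst w, snd v) = ?e v (fst v, snd w) \<circ> ?e' w (fst v, snd w)"
      if "nb Q v w" for v w by (rule square[OF that])
    show "disc_iso id" by (rule disc_iso_id)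
    show "disc_iso (f \<circ> f')" if "disc_iso f" "disc_iso f'" for f f' by (rule disc_iso_comp[OF that])
    show "disc_iso (?e v u)" "disc_iso (?e' v u)" for v u
      by (rule disc_iso_edge_frame[of \<alpha> v u, OF unit])+
    fix h
    assume "\<And>s v u. s \<in> Q \<Longrightarrow> v \<in> corners s \<Longrightarrow> u \<in> corners s \<Longrightarrow> even (fst v + snd v) \<Longrightarrow>
      odd (fst u + snd u) \<Longrightarrow> h v \<circ> ?e v u = h u"
      and "\<And>a. a \<in> verts Q \<Longrightarrow> disc_iso (h a)"
    then show thesis by (rule that)
  qed
  define p l where "p v = h v 0" and "l u = h u 0" for v u :: "int \<times> int"
  have zero: "(0::complex) \<in> ball 0 1" by simp
  have in_ball: "p v \<in> ball 0 1" "l v \<in> ball 0 1" if "v \<in> verts Q" for v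
    unfolding p_def l_def using disc_iso_in_ball[OF iso[OF that] zero] by blast+
  have vG: "v \<in> verts Q" "even (fst v + snd v)" if "v \<in> G Q" for v using that by (auto simp: G_def)
  have square_of: "\<exists>s\<in>Q. v \<in> corners s \<and> (fst w, snd v) \<in> corners s \<and> (fst v, snd w) \<in> corners s"
    and odd_of: "odd (fst w + snd v)" "odd (fst v + snd w)" and step: "\<bar>fst w - fst v\<bar> = 1" "\<bar>snd w - snd v\<bar> = 1"
    if nb: "nb Q v w" for v w
  proof -
    from nb obtain s where s: "s \<in> Q" "v \<in> corners s" "w \<in> corners s"
      and d: "\<bar>fst w - fst v\<bar> = 1" "\<bar>snd w - snd v\<bar> = 1" and ev: "even (fst v + snd v)"
      by (auto simp: nb_def G_def)
    have "(fst w, snd v) \<in> corners s" "(fst v, snd w) \<in> corners s"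
      using s by (auto simp: corners_iff)
    then show "\<exists>s\<in>Q. v \<in> corners s \<and> (fst w, snd v) \<in> corners s \<and> (fst v, snd w) \<in> corners s"
      using s by blast
    show "\<bar>fst w - fst v\<bar> = 1" "\<bar>snd w - snd v\<bar> = 1" by (rule d)+
    have "fst w = fst v + 1 \<or> fst w = fst v - 1" "snd w = snd v + 1 \<or> snd w = snd v - 1" using d by linarith+
    then show "odd (fst w + snd v)" "odd (fst v + snd w)" using ev by auto
  qed
  have frame_h: "h v \<circ> ?e v (fst w, snd v) = h (fst w, snd v)" "h v \<circ> ?e v (fst v, snd w) = h (fst v, snd w)"
    if nb: "nb Q v w" for v w
  proof -
    obtain s where "s \<in> Q" "v \<in> corners s" "(fst w, snd v) \<in> corners s" "(fst v, snd w) \<in> corners s"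
      using square_of[OF nb] by blast
    then show "h v \<circ> ?e v (fst w, snd v) = h (fst w, snd v)" "h v \<circ> ?e v (fst v, snd w) = h (fst v, snd w)"
      using frame vG(2)[OF nb_in_G(1)[OF nb]] odd_of[OF nb] by simp_all
  qed
  have frame_inv: "h v = h u \<circ> ?e' v u" if "h v \<circ> ?e v u = h u" for v u
    using that edge_frame_inverse(1)[of \<alpha> v u r R, OF unit] by (metis comp_assoc comp_id)
  have verts_of: "(fst w, snd v) \<in> verts Q" "(fst v, snd w) \<in> verts Q" "v \<in> verts Q" if nb: "nb Q v w" for v w
    using square_of[OF nb] by (auto simp: verts_def)
  have t_in_ball: "z * of_real (?t v u) \<in> ball 0 1" if "norm z = 1" for z :: complex and v u
    using abs_half_tanh[of r R v u] that by (simp add: norm_mult)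
  \<comment> \<open>The touching points in the frame at a centre, and the centres in the frame at a touching point.\<close>
  have point: "l u = h v (\<alpha> v u * of_real (?t v u))" if "h v \<circ> ?e v u = h u" for v u
    unfolding l_def that[symmetric] by (simp add: edge_frame_0)
  have centre: "p v = h u (- edge_dir v u * of_real (?t v u))" if "h v \<circ> ?e v u = h u" for v u
    unfolding p_def by (subst frame_inv[OF that]) (simp add: edge_frame_0)
  have radius: "norm (hdir (p v) (l u)) = \<bar>?t v u\<bar>" if "h v \<circ> ?e v u = h u" "v \<in> verts Q" for v u
  proof -
    have "norm (hdir (p v) (l u)) = norm (hdir 0 (\<alpha> v u * of_real (?t v u)))"
      unfolding point[OF that(1)] unfolding p_def
      by (rule disc_iso_norm_hdir[OF iso[OF that(2)] zero t_in_ball[OF unit]])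
    then show ?thesis by (simp add: norm_mult unit)
  qed
  have len_nb: "?t v (fst w, snd v) = tanh (r v / 2)" "?t v (fst v, snd w) = tanh (R v / 2)"
    "?t w (fst w, snd v) = tanh (R w / 2)" "?t w (fst v, snd w) = tanh (r w / 2)" if nb: "nb Q v w" for v w
    using step(2)[OF nb] by (auto simp: half_tanh_def)
  have circles: "l (fst w, snd v) \<in> hcircle (p v) (r v)" "l (fst v, snd w) \<in> hcircle (p v) (R v)"
    if nb: "nb Q v w" for v w
    using radius[OF frame_h(1)[OF nb] verts_of(3)[OF nb]] radius[OF frame_h(2)[OF nb] verts_of(3)[OF nb]]
      hcircle_iff[OF in_ball(1)[OF verts_of(3)[OF nb]] in_ball(2)[OF verts_of(1)[OF nb]]]
      hcircle_iff[OF in_ball(1)[OF verts_of(3)[OF nb]] in_ball(2)[OF verts_of(2)[OF nb]]]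
    by (simp_all only: len_nb[OF nb])
  have circles': "l (fst v, snd w) \<in> hcircle (p w) (r w)" "l (fst w, snd v) \<in> hcircle (p w) (R w)"
    if nb: "nb Q v w" for v w
  proof -
    have "nb Q w v" using nb nb_sym by blast
    from circles[OF this] show "l (fst v, snd w) \<in> hcircle (p w) (r w)" "l (fst w, snd v) \<in> hcircle (p w) (R w)" .
  qed
  \<comment> \<open>At a common point of two rings, the two centres lie on different axes of the frame.\<close>
  have orth: "orthogonal_circles (p v) (R v) (p w) (r w)" if nb: "nb Q v w" for v w
    unfolding orthogonal_circles_def
  proof (intro bexI IntI)
    let ?u = "(fst v, snd w)"
    have nb': "nb Q w v" using nb nb_sym by blast
    have c: "p v = h ?u (- edge_dir v ?u * of_real (?t v ?u))" "p w = h ?u (- edge_dir w ?u * of_real (?t w ?u))"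
      using centre[OF frame_h(2)[OF nb]] centre[OF frame_h(1)[OF nb']] by blast+
    have b: "- edge_dir v ?u * of_real (?t v ?u) \<in> ball 0 1" "- edge_dir w ?u * of_real (?t w ?u) \<in> ball 0 1"
      by (rule t_in_ball, simp add: norm_edge_dir)+
    have dir: "edge_dir v ?u = \<i> * of_int (snd w - snd v)" "edge_dir w ?u = of_int (fst v - fst w)"
      by (rule edge_dir_vertical[OF step(2)[OF nb]], rule edge_dir_horizontal[OF step(1)[OF nb']])
    have "cnj (hdir (l ?u) (p v)) * hdir (l ?u) (p w) =
        cnj (hdir 0 (- edge_dir v ?u * of_real (?t v ?u))) * hdir 0 (- edge_dir w ?u * of_real (?t w ?u))"
      unfolding c unfolding l_def
      by (rule disc_iso_cnj_hdir_mult[OF iso[OF verts_of(2)[OF nb]] zero b])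
    also have "Re \<dots> = 0" unfolding dir by simp
    finally show "orthogonal (hdir (l ?u) (p v)) (hdir (l ?u) (p w))"
      by (simp only: orthogonal_def flip: Re_cnj_mult)
    show "l ?u \<in> hcircle (p v) (R v)" "l ?u \<in> hcircle (p w) (r w)"
      using circles[OF nb] circles'[OF nb] by blast+
  qed
  \<comment> \<open>Two centres on the same axis of the frame, at signed distances \<open>a\<close> and \<open>a'\<close> on opposite sides of the point \<open>u\<close>.\<close>
  have dist: "hdist (p w) (p w') = \<bar>a + a'\<bar>"
    if f: "h w \<circ> ?e w u = h u" "h w' \<circ> ?e w' u = h u" and u: "u \<in> verts Q"
      and d: "edge_dir w' u = - edge_dir w u" and a: "?t w u = tanh (a / 2)" "?t w' u = tanh (a' / 2)"
      and v: "w \<in> verts Q" "w' \<in> verts Q" for w w' u a a'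
  proof -
    let ?d = "edge_dir w u" and ?x = "of_real (tanh (a / 2)) :: complex" and ?y = "of_real (tanh (a' / 2)) :: complex"
    have b: "- ?d * ?x \<in> ball 0 1" "?d * ?y \<in> ball 0 1"
      using t_in_ball[of "- ?d" w u] t_in_ball[of ?d w' u] a by (simp_all add: norm_edge_dir)
    have dd: "cnj ?d * ?d = 1"
      using norm_edge_dir by (metis complex_norm_square mult.commute of_real_1 one_power2)
    have "norm (hdir (p w) (p w')) = norm (hdir (- ?d * ?x) (?d * ?y))"
      using disc_iso_norm_hdir[OF iso[OF u] b] centre[OF f(1)] centre[OF f(2)] by (simp add: d a)
    also have "hdir (- ?d * ?x) (?d * ?y) = ?d * of_real ((tanh (a / 2) + tanh (a' / 2)) / (1 + tanh (a / 2) * tanh (a' / 2)))"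
    proof -
      have "cnj (- ?d * ?x) * (?d * ?y) = - ((cnj ?d * ?d) * (?x * ?y))" by (simp add: mult_ac)
      then show ?thesis
        unfolding hdir_def dd by (simp add: distrib_left add.commute)
    qed
    also have "(tanh (a / 2) + tanh (a' / 2)) / (1 + tanh (a / 2) * tanh (a' / 2)) = tanh ((a + a') / 2)"
      by (simp add: tanh_add add_divide_distrib)
    finally have "norm (hdir (p w) (p w')) = \<bar>tanh ((a + a') / 2)\<bar>"
      by (simp add: norm_mult norm_edge_dir del: of_real_divide)
    then show ?thesis using hdist_eq_abs_iff[OF in_ball(1)[OF v(1)] in_ball(1)[OF v(2)]] by blast
  qed
  have touch_h: "touch_at (p w) (r w) (p w') (r w') (l (fst v, snd w))"
    if nb: "nb Q v w" "nb Q v w'" and neq: "w \<noteq> w'" and eq: "snd w = snd w'" for v w w'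
  proof -
    have nb': "nb Q w v" "nb Q w' v" using nb nb_sym by blast+
    have opp: "fst v - fst w' = - (fst v - fst w)"
      using step(1)[OF nb(1)] step(1)[OF nb(2)] neq eq by (auto simp: prod_eq_iff abs_if split: if_splits)
    have d: "edge_dir w' (fst v, snd w) = - edge_dir w (fst v, snd w)"
      unfolding edge_dir_horizontal[OF step(1)[OF nb'(1)]]
      unfolding eq
      unfolding edge_dir_horizontal[OF step(1)[OF nb'(2)]] opp
      by simp
    have "hdist (p w) (p w') = \<bar>r w + r w'\<bar>"
      using dist[OF frame_h(1)[OF nb'(1)] _ verts_of(2)[OF nb(1)] d] frame_h(1)[OF nb'(2)] len_nb(1)[OF nb'(1)] len_nb(1)[OF nb'(2)]
        verts_of(3)[OF nb'(1)] verts_of(3)[OF nb'(2)] eq by simp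
    then show ?thesis using circles'(1)[OF nb(1)] circles'(1)[OF nb(2)] eq by (simp add: touch_at_def)
  qed
  have touch_v: "touch_at (p w) (R w) (p w') (R w') (l (fst w, snd v))"
    if nb: "nb Q v w" "nb Q v w'" and neq: "w \<noteq> w'" and eq: "fst w = fst w'" for v w w'
  proof -
    have nb': "nb Q w v" "nb Q w' v" using nb nb_sym by blast+
    have opp: "snd v - snd w' = - (snd v - snd w)"
      using step(2)[OF nb(1)] step(2)[OF nb(2)] neq eq by (auto simp: prod_eq_iff abs_if split: if_splits)
    have d: "edge_dir w' (fst w, snd v) = - edge_dir w (fst w, snd v)"
      unfolding edge_dir_vertical[OF step(2)[OF nb'(1)]]
      unfolding eq
      unfolding edge_dir_vertical[OF step(2)[OF nb'(2)]] opp
      by (simp add: algebra_simps)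
    have "hdist (p w) (p w') = \<bar>R w + R w'\<bar>"
      using dist[OF frame_h(2)[OF nb'(1)] _ verts_of(1)[OF nb(1)] d] frame_h(2)[OF nb'(2)] len_nb(2)[OF nb'(1)] len_nb(2)[OF nb'(2)]
        verts_of(3)[OF nb'(1)] verts_of(3)[OF nb'(2)] eq by simp
    then show ?thesis using circles'(2)[OF nb(1)] circles'(2)[OF nb(2)] eq by (simp add: touch_at_def)
  qed
  have seen: "\<exists>U. norm U = 1 \<and> (\<forall>u. h v \<circ> ?e v u = h u \<longrightarrow> hdir (p v) (l u) = U * (\<alpha> v u * of_real (?t v u)))"
    if v: "v \<in> verts Q" for v
  proof -
    obtain U where U: "norm U = 1" "\<forall>z\<in>ball 0 1. hdir (h v 0) (h v z) = U * hdir 0 z"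
      using iso[OF v] zero unfolding disc_iso_def by blast
    have "hdir (p v) (l u) = U * (\<alpha> v u * of_real (?t v u))" if "h v \<circ> ?e v u = h u" for u
      unfolding point[OF that] unfolding p_def using U(2) t_in_ball[OF unit] by simp
    then show ?thesis using U(1) by blast
  qed
  \<comment> \<open>The directions of the two edges at \<open>v\<close> differ by the rotation about an angle in \<open>(0, \<pi>)\<close>, and the signs of
    the radii say whether the points lie in these or in the opposite directions.\<close>
  have turn: "of_int ((fst w - fst v) * (snd w - snd v)) * turn (p v) (l (fst w, snd v)) (l (fst v, snd w)) = sgn (r v)"
    if nb: "nb Q v w" for v w
  proof -
    let ?u = "(fst w, snd v)" and ?u' = "(fst v, snd w)" and ?f = "angle (\<gamma> v) (\<gamma> w)" and ?s = "side_sign v w"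
    obtain U where U: "norm U = 1" "\<And>u. h v \<circ> ?e v u = h u \<Longrightarrow> hdir (p v) (l u) = U * (\<alpha> v u * of_real (?t v u))"
      using seen[OF verts_of(3)[OF nb]] by blast
    have unit1: "cnj z * z = 1" if "norm z = 1" for z
      using that by (metis complex_norm_square mult.commute of_real_1 one_power2)
    have "cnj (hdir (p v) (l ?u)) * hdir (p v) (l ?u') =
        (cnj U * U) * (cnj (\<alpha> v ?u) * \<alpha> v ?u) * (of_real (tanh (r v / 2) * tanh (R v / 2)) * cis (?s * ?f))"
      unfolding U(2)[OF frame_h(1)[OF nb]] U(2)[OF frame_h(2)[OF nb]] \<alpha>[OF nb] len_nb[OF nb] by (simp add: mult_ac)
    then have "Im (cnj (hdir (p v) (l ?u)) * hdir (p v) (l ?u')) = tanh (r v / 2) * tanh (R v / 2) * sin (?s * ?f)"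
      unfolding unit1[OF U(1)] unit1[OF unit] mult_1 by (simp only: Im_of_real_mult cis.sel)
    moreover have "sin (?s * ?f) = ?s * sin ?f" and s: "?s * ?s = 1"
      using abs_side_sign[OF nb] by (auto simp: abs_if split: if_splits)
    moreover have vG': "v \<in> G Q" using nb nb_in_G by blast
    then have "0 < sin ?f" using angle_bounds range by (intro sin_gt_zero) blast+
    moreover have "0 < tanh (R v / 2)" using ring_ofD(9)[OF ring[OF vG']] by simp
    moreover have "sgn (tanh (r v / 2)) = sgn (r v)" by (simp add: sgn_if)
    ultimately have "turn (p v) (l ?u) (l ?u') = sgn (r v) * sgn ?s"
      by (simp add: turn_def sgn_mult)
    moreover have "?s * sgn ?s = 1"
      using abs_side_sign[OF nb] by (simp add: mult_sgn_abs abs_mult_sgn flip: abs_sgn)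
    ultimately show ?thesis
      by (simp only: side_sign_def[symmetric]) (metis mult.left_commute mult.right_neutral)
  qed
  \<comment> \<open>At an inner vertex the directions of the edges have the arguments \<open>t\<close>, \<open>t + f1\<close>, \<open>t + f1 + f2\<close>, \<open>t + f1 + f2 + f3\<close>.\<close>
  have ccw: "(0 < r (m, n) \<longrightarrow> ccw_around (p (m, n)) (l (m + 1, n)) (l (m, n + 1)) (l (m - 1, n)) (l (m, n - 1))) \<and>
      (r (m, n) < 0 \<longrightarrow> ccw_around (p (m, n)) (l (m, n - 1)) (l (m - 1, n)) (l (m, n + 1)) (l (m + 1, n)))"
    if inn: "(m, n) \<in> inner_verts Q" for m n
  proof -
    let ?v = "(m, n)"
    let ?NE = "(m + 1, n + 1)" and ?NW = "(m - 1, n + 1)" and ?SW = "(m - 1, n - 1)" and ?SE = "(m + 1, n - 1)"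
    let ?E = "(m + 1, n)" and ?N = "(m, n + 1)" and ?W = "(m - 1, n)" and ?S = "(m, n - 1)"
    have v: "?v \<in> G Q" using inn by (simp add: inner_verts_def)
    have nbs: "nbs Q ?v = {?NE, ?NW, ?SW, ?SE}"
      using inn valence_4_iff by (simp add: inner_verts_def nb_candidates_def)
    then have nb: "nb Q ?v ?NE" "nb Q ?v ?NW" "nb Q ?v ?SW" "nb Q ?v ?SE"
      unfolding nbs_def by blast+
    obtain U where U: "norm U = 1" "\<And>u. h ?v \<circ> ?e ?v u = h u \<Longrightarrow> hdir (p ?v) (l u) = U * (\<alpha> ?v u * of_real (?t ?v u))"
      using seen[OF vG(1)[OF v]] by blast
    define f1 f2 f3 f4 where "f1 = angle (\<gamma> ?v) (\<gamma> ?NE)" and "f2 = angle (\<gamma> ?v) (\<gamma> ?NW)"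
      and "f3 = angle (\<gamma> ?v) (\<gamma> ?SW)" and "f4 = angle (\<gamma> ?v) (\<gamma> ?SE)"
    have f: "0 < f1" "f1 < pi" "0 < f2" "f2 < pi" "0 < f3" "f3 < pi" "0 < f4" "f4 < pi"
      unfolding f1_def f2_def f3_def f4_def using angle_bounds range[OF v] by blast+
    have sum: "f1 + f2 + f3 + f4 = 2 * pi"
      using inner[OF inn] unfolding nbs by (simp add: f1_def f2_def f3_def f4_def add.assoc)
    define t where "t = Arg (U * \<alpha> ?v ?E)"
    have E: "U * \<alpha> ?v ?E = cis t"
    proof -
      have n: "norm (U * \<alpha> ?v ?E) = 1" unfolding norm_mult U(1) unit by simp
      then have "U * \<alpha> ?v ?E \<noteq> 0" by (metis norm_zero zero_neq_one)
      from cis_Arg[OF this] show ?thesis unfolding t_def sgn_div_norm n by simp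
    qed
    have rotate_back: "a = b * cis g" if "b = a * cis (- g)" for a b g
      unfolding that by (simp add: cis_mult mult.assoc)
    have \<alpha>N: "\<alpha> ?v ?N = \<alpha> ?v ?E * cis f1"
      using \<alpha>[OF nb(1)] by (simp add: side_sign_def f1_def)
    have \<alpha>W: "\<alpha> ?v ?W = \<alpha> ?v ?N * cis f2"
      by (rule rotate_back) (use \<alpha>[OF nb(2)] in \<open>simp add: side_sign_def f2_def\<close>)
    have \<alpha>S: "\<alpha> ?v ?S = \<alpha> ?v ?W * cis f3"
      using \<alpha>[OF nb(3)] by (simp add: side_sign_def f3_def)
    have N: "U * \<alpha> ?v ?N = cis (t + f1)" unfolding \<alpha>N mult.assoc[symmetric] E by (simp add: cis_mult)
    have W: "U * \<alpha> ?v ?W = cis (t + f1 + f2)" unfolding \<alpha>W mult.assoc[symmetric] N by (simp add: cis_mult)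
    have S: "U * \<alpha> ?v ?S = cis (t + f1 + f2 + f3)" unfolding \<alpha>S mult.assoc[symmetric] W by (simp add: cis_mult)
    define a b where "a = tanh (r ?v / 2)" and "b = tanh (R ?v / 2)"
    have b: "0 < b" using ring_ofD(9)[OF ring[OF v]] by (simp add: b_def)
    have z: "hdir (p ?v) (l ?E) = of_real a * cis t" "hdir (p ?v) (l ?N) = of_real b * cis (t + f1)"
      "hdir (p ?v) (l ?W) = of_real a * cis (t + f1 + f2)" "hdir (p ?v) (l ?S) = of_real b * cis (t + f1 + f2 + f3)"
      using U(2)[OF frame_h(1)[OF nb(1)]] U(2)[OF frame_h(2)[OF nb(1)]] U(2)[OF frame_h(1)[OF nb(3)]] U(2)[OF frame_h(2)[OF nb(3)]]
        E N W S by (simp_all add: half_tanh_def a_def b_def mult.assoc[symmetric] mult.commute)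
    have arg: "is_Arg (of_real c * cis g) g" if "0 < c" for c g
      using that by (simp add: is_Arg_def norm_mult cis_conv_exp)
    have arg_neg: "is_Arg (of_real c * cis g) (g + pi)" "is_Arg (of_real c * cis g) (g + 3 * pi)"
      if "c < 0" for c g
    proof -
      have "cis (3 * pi) = cis pi * cis (2 * pi)"
        unfolding cis_mult by (rule arg_cong[where f = cis]) simp
      then have "cis (3 * pi) = - 1" by simp
      then have e: "of_real c * cis g = of_real (- c) * cis (g + pi)" "of_real c * cis g = of_real (- c) * cis (g + 3 * pi)"
        by (simp_all flip: cis_mult)
      show "is_Arg (of_real c * cis g) (g + pi)"
        unfolding e(1) by (rule arg) (use that in simp)
      show "is_Arg (of_real c * cis g) (g + 3 * pi)"
        unfolding e(2) by (rule arg) (use that in simp)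
    qed
    show ?thesis
    proof (intro conjI impI)
      assume "0 < r ?v"
      then have a: "0 < a" by (simp add: a_def)
      show "ccw_around (p ?v) (l ?E) (l ?N) (l ?W) (l ?S)"
        unfolding ccw_around_def z
        by (rule exI[of _ t], rule exI[of _ "t + f1"], rule exI[of _ "t + f1 + f2"], rule exI[of _ "t + f1 + f2 + f3"])
           (use f sum arg[OF a] arg[OF b] in auto)
    next
      assume "r ?v < 0"
      then have a: "a < 0" by (simp add: a_def)
      \<comment> \<open>For a negative radius the horizontal touching points lie opposite to the axes of the frame.\<close>
      have o: "t + f1 + f2 + f3 < t + f1 + f2 + pi" "t + f1 + f2 + pi < t + f1 + 2 * pi" "t + f1 + 2 * pi < t + 3 * pi"
        "t + 3 * pi < t + f1 + f2 + f3 + 2 * pi" using f sum by linarith+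
      have "cis (t + f1) = cis (t + f1 + 2 * pi)" by (simp flip: cis_mult)
      then have "is_Arg (of_real b * cis (t + f1)) (t + f1 + 2 * pi)"
        using arg[OF b, of "t + f1 + 2 * pi"] by simp
      then show "ccw_around (p ?v) (l ?S) (l ?W) (l ?N) (l ?E)"
        unfolding ccw_around_def z
        by (intro exI[of _ "t + f1 + f2 + f3"] exI[of _ "t + f1 + f2 + pi"] exI[of _ "t + f1 + 2 * pi"] exI[of _ "t + 3 * pi"] conjI
            o arg[OF b] arg_neg[OF a])
    qed
  qed
  have "ring_pattern Q p r R l"
    unfolding ring_pattern_def
  proof (intro conjI ballI allI impI)
    fix v assume v: "v \<in> G Q"
    show "p v \<in> ball 0 1" using in_ball vG(1)[OF v] by blast
    show "0 < R v" "\<bar>r v\<bar> \<le> R v" using ring_ofD(9,10)[OF ring[OF v]] by simp_all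
  next
    fix u assume "u \<in> Gstar Q"
    then show "l u \<in> ball 0 1" using in_ball(2)[of u] by (simp add: Gstar_def)
  next
    fix v w assume nb: "nb Q v w"
    then have nb': "nb Q w v" using nb_sym by blast
    show "orthogonal_circles (p v) (R v) (p w) (r w)" "orthogonal_circles (p w) (R w) (p v) (r v)"
      by (rule orth[OF nb], rule orth[OF nb'])
    show "l (fst w, snd v) \<in> hcircle (p v) (r v) \<inter> hcircle (p w) (R w)"
      "l (fst v, snd w) \<in> hcircle (p v) (R v) \<inter> hcircle (p w) (r w)"
      using circles[OF nb] circles'[OF nb] by blast+
    show "of_int ((fst w - fst v) * (snd w - snd v)) * turn (p v) (l (fst w, snd v)) (l (fst v, snd w)) = sgn (r v)"
      by (rule turn[OF nb])
  next
    fix v w w' assume "nb Q v w \<and> nb Q v w' \<and> w \<noteq> w'"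
    then show "touch_at (p w) (r w) (p w') (r w') (l (fst v, snd w))" if "snd w = snd w'"
      using touch_h that by blast
  next
    fix v w w' assume "nb Q v w \<and> nb Q v w' \<and> w \<noteq> w'"
    then show "touch_at (p w) (R w) (p w') (R w') (l (fst w, snd v))" if "fst w = fst w'"
      using touch_v that by blast
  next
    fix m n assume "(m, n) \<in> inner_verts Q"
    then show "ccw_around (p (m, n)) (l (m + 1, n)) (l (m, n + 1)) (l (m - 1, n)) (l (m, n - 1))" if "0 < r (m, n)"
      using ccw that by blast
  next
    fix m n assume "(m, n) \<in> inner_verts Q"
    then show "ccw_around (p (m, n)) (l (m, n - 1)) (l (m - 1, n)) (l (m, n + 1)) (l (m + 1, n))" if "r (m, n) < 0"
      using ccw that by blast
  qed
  then show ?thesis using ring by blast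
qed

end

theorem theorem5p2:
  fixes Q :: "(int \<times> int) set" and q :: real and \<Theta> :: "int \<times> int \<Rightarrow> real"
  assumes "finite Q" and "simply_connected (cells Q)"
    and "0 < q" and "q < 1"
    and "\<forall>j\<in>boundary_verts Q. -2 * pi < \<Theta> j \<and> \<Theta> j < 2 * pi \<and> \<Theta> j \<noteq> 0"
    and "\<forall>j\<in>boundary_verts Q. valence Q j = 1 \<longrightarrow> \<bar>\<Theta> j\<bar> < pi"
  shows
    "(\<forall>\<gamma>. critical_point (G Q) (S_hyp Q q (\<Phi>_of Q \<Theta>)) \<gamma> \<longrightarrow>
        (\<forall>j\<in>G Q. \<gamma> j \<in> {0 .. 2 * ellK q})) \<and>
     (\<forall>\<gamma>. critical_point (G Q) (S_hyp Q q (\<Phi>_of Q \<Theta>)) \<gamma> \<longleftrightarrow>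
        (\<exists>p r R l. ring_pattern Q p r R l \<and>
           (\<forall>j\<in>G Q. ring_of q (\<gamma> j) (r j) (R j)) \<and>
           (\<forall>j\<in>boundary_verts Q. prescribed_angle Q q \<Theta> \<gamma> j))) \<and>
     (\<forall>\<gamma> p r R l. ring_pattern Q p r R l \<and> (\<forall>j\<in>G Q. ring_of q (\<gamma> j) (r j) (R j)) \<longrightarrow>
        (\<forall>j\<in>boundary_verts Q. sgn (r j) = sgn (\<Theta> j) \<longrightarrow>
           (prescribed_angle Q q \<Theta> \<gamma> j \<longleftrightarrow> cone_angle Q r R j = \<Theta> j))) \<and>
     (\<forall>p r R l. ring_pattern Q p r R l \<and> (\<forall>j\<in>G Q. cosh (r j) = q * cosh (R j)) \<longrightarrow>
        (\<exists>!\<gamma>. \<gamma> \<in> G Q \<rightarrow>\<^sub>E {0 .. 2 * ellK q} \<and>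
           (\<forall>j\<in>G Q. ring_of q (\<gamma> j) (r j) (R j))))"
proof -
  interpret elliptic_modulus q using assms(3,4) by unfold_locales
  let ?crit = "critical_point (G Q) (S_hyp Q q (\<Phi>_of Q \<Theta>))"
  let ?sum = "\<lambda>\<gamma> j. \<Sum>i\<in>nbs Q j. angle (\<gamma> j) (\<gamma> i)"
  note crit = critical_point_iff[OF assms(1), where \<Phi> = "\<Phi>_of Q \<Theta>"]
  have range: "0 < \<gamma> j \<and> \<gamma> j < 2 * ellK q" if "?crit \<gamma>" "j \<in> G Q" for \<gamma> j
    using critical_point_range[where Q = Q and \<gamma> = \<gamma> and j = j and \<Theta> = \<Theta>] crit[where \<gamma> = \<gamma>] that assms(5,6) by blast
  have inner: "- \<Phi>_of Q \<Theta> j = 2 * pi" if "j \<in> inner_verts Q" for j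
    using that by (simp add: \<Phi>_of_def)
  have 1: "\<gamma> j \<in> {0..2 * ellK q}" if "?crit \<gamma>" "j \<in> G Q" for \<gamma> j
    using range[OF that] by simp
  have 2: "?crit \<gamma> \<longleftrightarrow> (\<exists>p r R l. ring_pattern Q p r R l \<and> (\<forall>j\<in>G Q. ring_of q (\<gamma> j) (r j) (R j)) \<and>
      (\<forall>j\<in>boundary_verts Q. prescribed_angle Q q \<Theta> \<gamma> j))" for \<gamma>
  proof
    assume c: "?crit \<gamma>"
    have "?sum \<gamma> v = 2 * pi" if "v \<in> inner_verts Q" for v
      using c crit[where \<gamma> = \<gamma>] inner[OF that] that G_cases by metis
    then obtain p r R l where "ring_pattern Q p r R l" "\<forall>j\<in>G Q. ring_of q (\<gamma> j) (r j) (R j)"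
      using ring_pattern_exists[OF assms(2), of \<gamma>] range[OF c] by blast
    moreover have "prescribed_angle Q q \<Theta> \<gamma> j" if "j \<in> boundary_verts Q" for j
      using c crit[where \<gamma> = \<gamma>] prescribed_angle_iff[OF that] that G_cases by blast
    ultimately show "\<exists>p r R l. ring_pattern Q p r R l \<and> (\<forall>j\<in>G Q. ring_of q (\<gamma> j) (r j) (R j)) \<and>
        (\<forall>j\<in>boundary_verts Q. prescribed_angle Q q \<Theta> \<gamma> j)" by blast
  next
    assume "\<exists>p r R l. ring_pattern Q p r R l \<and> (\<forall>j\<in>G Q. ring_of q (\<gamma> j) (r j) (R j)) \<and>
        (\<forall>j\<in>boundary_verts Q. prescribed_angle Q q \<Theta> \<gamma> j)"
    then obtain p r R l where pat: "ring_pattern Q p r R l" "\<forall>j\<in>G Q. ring_of q (\<gamma> j) (r j) (R j)"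
      and pre: "\<forall>j\<in>boundary_verts Q. prescribed_angle Q q \<Theta> \<gamma> j" by blast
    have "?sum \<gamma> j = - \<Phi>_of Q \<Theta> j" if "j \<in> G Q" for j
    proof (cases "j \<in> inner_verts Q")
      case True
      then show ?thesis using ring_pattern_inner_angle[OF pat True] inner[OF True] by simp
    next
      case False
      then have "j \<in> boundary_verts Q" using that G_cases by blast
      then show ?thesis using pre prescribed_angle_iff by blast
    qed
    then show "?crit \<gamma>" using crit by blast
  qed
  have 3: "prescribed_angle Q q \<Theta> \<gamma> j \<longleftrightarrow> cone_angle Q r R j = \<Theta> j"
    if pat: "\<forall>j\<in>G Q. ring_of q (\<gamma> j) (r j) (R j)" and j: "j \<in> boundary_verts Q" and s: "sgn (r j) = sgn (\<Theta> j)" for \<gamma> r R j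
  proof -
    have \<Theta>: "\<Theta> j \<noteq> 0" using assms(5) j by blast
    then have r: "r j \<noteq> 0" and pos: "0 < r j \<longleftrightarrow> 0 < \<Theta> j" using s by (auto simp: sgn_if split: if_splits)
    have "j \<in> G Q" using j G_cases by blast
    from cone_angle_eq[OF pat this r] show ?thesis
      unfolding prescribed_angle_iff[OF j] \<Phi>_of_def using not_inner_boundary[OF j] pos by auto
  qed
  have 4: "\<exists>!\<gamma>. \<gamma> \<in> G Q \<rightarrow>\<^sub>E {0 .. 2 * ellK q} \<and> (\<forall>j\<in>G Q. ring_of q (\<gamma> j) (r j) (R j))"
    if pat: "ring_pattern Q p r R l" and c: "\<forall>j\<in>G Q. cosh (r j) = q * cosh (R j)" for p r R l
  proof -
    have ex: "\<exists>!x. ring_of q x (r j) (R j)" if "j \<in> G Q" for j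
      using ring_of_unique[of "R j" "r j"] ring_patternD(1)[OF pat] c that by blast
    define \<gamma> where "\<gamma> = (\<lambda>j\<in>G Q. THE x. ring_of q x (r j) (R j))"
    have \<gamma>: "ring_of q (\<gamma> j) (r j) (R j)" if "j \<in> G Q" for j
      using theI'[OF ex[OF that]] that by (simp add: \<gamma>_def)
    show ?thesis
    proof (rule ex1I[of _ \<gamma>])
      show "\<gamma> \<in> G Q \<rightarrow>\<^sub>E {0 .. 2 * ellK q} \<and> (\<forall>j\<in>G Q. ring_of q (\<gamma> j) (r j) (R j))"
        using \<gamma> by (auto simp: PiE_def extensional_def \<gamma>_def[abs_def] ring_of_def Pi_def)
      fix \<gamma>' assume *: "\<gamma>' \<in> G Q \<rightarrow>\<^sub>E {0 .. 2 * ellK q} \<and> (\<forall>j\<in>G Q. ring_of q (\<gamma>' j) (r j) (R j))"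
      show "\<gamma>' = \<gamma>"
      proof
        fix j
        show "\<gamma>' j = \<gamma> j"
        proof (cases "j \<in> G Q")
          case True
          then show ?thesis using * \<gamma> ex by blast
        next
          case False
          then show ?thesis using * PiE_arb by (simp add: \<gamma>_def) fastforce
        qed
      qed
    qed
  qed
  show ?thesis
    by (intro conjI allI impI ballI, rule 1, assumption, assumption, rule 2, elim conjE, rule 3,
        assumption, assumption, assumption, elim conjE, rule 4, assumption, assumption)
qed

end
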